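(* Let $y_0\in L^2(\Omega)$ and let $\rho,\rho_0$ be the Carleman weights described in the context. For $R>0$ put $\rho_R:=\min(R,\rho)$ and $$I_R(v):=\frac12\iint_Q \rho_R^2\,|Mv+\overline y|^2\,dx\,dt+\frac12\iint_{Q_\omega}\rho_0^2|v|^2\,dx\,dt,\qquad v\in\mathcal U .$$ For each $R>0$ let $v_R\in\mathcal U$ be the unique minimizer of $I_R$ over $\mathcal U$. Then $$v_R\to\widehat v\quad\text{strongly in }\mathcal U\text{ as }R\to+\infty,$$ where $\widehat v$, together with $\widehat y:=M\widehat v+\overline y$, is the unique minimizer $(\widehat y,\widehat v)$ of $$J(y,v)=\frac12\iint_Q\rho^2|y|^2\,dx\,dt+\frac12\iint_{Q_\omega}\rho_0^2|v|^2\,dx\,dt$$ over the set $\mathcal C(y_0,T)=\{(y,v)\in\mathcal Y\times\mathcal U:\ y=Mv+\overline y\}$.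
   Context: Setting. $\Omega\subset\mathbb R^d$ ($d\ge1$) is a bounded domain with $C^2$ boundary, $T>0$, $\omega\subset\Omega$ is a non-empty open set, $Q=\Omega\times(0,T)$, $\Sigma=\partial\Omega\times(0,T)$, $Q_\omega=\omega\times(0,T)$. Coefficients: $a\in W^{1,\infty}(Q)$ with $a\ge a_0>0$ in $Q$, and $b\in L^\infty(Q)$. Operator: $Ly=\partial_t y-\mathrm{div}(a\nabla y)+by$. For $v\in L^2(Q_\omega)$, the state is the weak solution $y\in C^0([0,T];L^2(\Omega))\cap L^2(0,T;H^1_0(\Omega))$ of $Ly=v\mathbb 1_\omega$ in $Q$, $y=0$ on $\Sigma$, $y(\cdot,0)=y_0$ in $\Omega$ (here $v\mathbb 1_\omega$ is the extension of $v$ by zero). $\overline y$ denotes the state for $v\equiv0$. $M:L^2(Q_\omega)\to L^2(Q)$ is the linear operator sending $v$ to the weak solution of the same problem with zero initial datum; so the state associated with $v$ is $Mv+\overline y$. Weights. $\eta^0\in C^2(\overline\Omega)$ satisfies $\eta^0=0$ on $\partial\Omega$, $|\nabla\eta^0|>0$ in $\Omega\setminus\overline\omega$, $\partial_\nu\eta^0<0$ on $\partial\Omega$. With constants $K_1,K_2>0$ sufficiently large, $$\alpha(x,t)=K_1\frac{e^{K_2}-e^{\eta^0(x)}}{T-t},\quad \rho=e^{\alpha},\quad \rho_0=(T-t)^{3/2}\rho .$$ In particular $\rho,\rho_0$ are continuous in $Q$, bounded below by some $\rho_*>0$, and $\min_{x\in\overline\Omega}\rho(x,t)\to+\infty$,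 $\min_{x\in\overline\Omega}\rho_0(x,t)\to+\infty$ as $t\to T^-$. It is a known fact (Fursikov–Imanuvilov, via Carleman estimates), taken for granted as part of "$K_1,K_2$ sufficiently large", that $\mathcal C(y_0,T)\ne\emptyset$ for every $y_0\in L^2(\Omega)$ and that $J$ has a unique minimizer on $\mathcal C(y_0,T)$. Spaces. $\mathcal U=\{v\in L^2(Q_\omega):\rho_0v\in L^2(Q_\omega)\}$, a Hilbert space with norm $\|v\|_{\mathcal U}=\|\rho_0v\|_{L^2(Q_\omega)}$; $\mathcal Y=\{y\in L^2(Q):\rho y\in L^2(Q)\}$. *)

theory Defs
  imports "HOL-Analysis.Analysis"
begin

text \<open>
  Points of the space-time cylinder are pairs \<open>(x, t)\<close> of type \<open>'a \<times> real\<close>, where \<open>'a\<close> is the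
  Euclidean space containing the domain. Elements of Lebesgue spaces are represented by functions
  whose values off the underlying set are irrelevant; equality in these spaces is equality almost
  everywhere. Since \<open>lborel\<close> carries the Borel sigma-algebra, representatives are Borel.
\<close>

definition L2 :: "'a::euclidean_space set \<Rightarrow> ('a \<Rightarrow> 'b::euclidean_space) set" where
  "L2 S = {f. set_borel_measurable lborel S f \<and>
              set_integrable lborel S (\<lambda>x. (norm (f x))\<^sup>2)}"

definition Linfty :: "'a::euclidean_space set \<Rightarrow> ('a \<Rightarrow> 'b::euclidean_space) set" where
  "Linfty S = {f. set_borel_measurable lborel S f \<and>
                  (\<exists>C. AE x\<in>S in lborel. norm (f x) \<le> C)}"

definition L2_norm :: "'a::euclidean_space set \<Rightarrow> ('a \<Rightarrow> 'b::euclidean_space) \<Rightarrow> real" where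
  "L2_norm S f = sqrt (LINT x:S|lborel. (norm (f x))\<^sup>2)"

definition grad :: "('a::euclidean_space \<Rightarrow> real) \<Rightarrow> 'a \<Rightarrow> 'a" where
  "grad f x = (\<Sum>i\<in>Basis. frechet_derivative f (at x) i *\<^sub>R i)"

text \<open>\<open>C\<^sup>k\<close> on an open set, by recursion on the partial derivatives.\<close>

primrec Ck_on :: "nat \<Rightarrow> 'a::euclidean_space set \<Rightarrow> ('a \<Rightarrow> real) \<Rightarrow> bool" where
  "Ck_on 0 S f \<longleftrightarrow> continuous_on S f"
| "Ck_on (Suc k) S f \<longleftrightarrow> (\<forall>x\<in>S. f differentiable (at x)) \<and>
     (\<forall>i\<in>Basis. Ck_on k S (\<lambda>x. frechet_derivative f (at x) i))"

definition test_function :: "'a::euclidean_space set \<Rightarrow> ('a \<Rightarrow> real) \<Rightarrow> bool" where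
  "test_function S \<phi> \<longleftrightarrow> (\<forall>k. Ck_on k UNIV \<phi>) \<and>
     compact (closure {x. \<phi> x \<noteq> 0}) \<and> closure {x. \<phi> x \<noteq> 0} \<subseteq> S"

text \<open>Used only for \<open>u\<close> and \<open>G\<close> in \<open>L2 S\<close> or \<open>Linfty S\<close>, so that both integrals exist.\<close>

definition weak_gradient ::
    "'a::euclidean_space set \<Rightarrow> ('a \<Rightarrow> real) \<Rightarrow> ('a \<Rightarrow> 'a) \<Rightarrow> bool" where
  "weak_gradient S u G \<longleftrightarrow> (\<forall>\<phi>. test_function S \<phi> \<longrightarrow>
     (LINT x:S|lborel. u x *\<^sub>R grad \<phi> x) = - (LINT x:S|lborel. \<phi> x *\<^sub>R G x))"

definition W1infty :: "'a::euclidean_space set \<Rightarrow> ('a \<Rightarrow> real) set" where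
  "W1infty S = {u. u \<in> Linfty S \<and> (\<exists>G\<in>Linfty S. weak_gradient S u G)}"

text \<open>
  \<open>H10 S u Du\<close>: the function \<open>u\<close> belongs to \<open>H\<^sup>1\<^sub>0(S)\<close>, the \<open>H\<^sup>1\<close>-closure of the test functions,
  and \<open>Du\<close> is its weak gradient.
\<close>

definition H10 :: "'a::euclidean_space set \<Rightarrow> ('a \<Rightarrow> real) \<Rightarrow> ('a \<Rightarrow> 'a) \<Rightarrow> bool" where
  "H10 S u Du \<longleftrightarrow> u \<in> L2 S \<and> Du \<in> L2 S \<and> weak_gradient S u Du \<and>
     (\<exists>\<phi>::nat \<Rightarrow> 'a \<Rightarrow> real. (\<forall>n. test_function S (\<phi> n)) \<and>
        (\<lambda>n. L2_norm S (\<lambda>x. \<phi> n x - u x)) \<longlonglongrightarrow> 0 \<and>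
        (\<lambda>n. L2_norm S (\<lambda>x. grad (\<phi> n) x - Du x)) \<longlonglongrightarrow> 0)"

text \<open>
  Near the boundary point \<open>p\<close> the set \<open>S\<close> is the epigraph, in direction \<open>e\<close>, of a \<open>C\<^sup>2\<close> function of
  the coordinates orthogonal to \<open>e\<close>. Only the values of \<open>\<gamma>\<close> on that hyperplane matter.
\<close>

definition local_defining :: "'a::euclidean_space \<Rightarrow> ('a \<Rightarrow> real) \<Rightarrow> 'a \<Rightarrow> real" where
  "local_defining e \<gamma> x = \<gamma> (x - (x \<bullet> e) *\<^sub>R e) - x \<bullet> e"

definition C2_chart ::
    "'a::euclidean_space set \<Rightarrow> 'a \<Rightarrow> real \<Rightarrow> 'a \<Rightarrow> ('a \<Rightarrow> real) \<Rightarrow> bool" where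
  "C2_chart S p r e \<gamma> \<longleftrightarrow> r > 0 \<and> norm e = 1 \<and> Ck_on 2 UNIV \<gamma> \<and>
     S \<inter> ball p r = {x \<in> ball p r. local_defining e \<gamma> x < 0}"

definition bounded_C2_domain :: "'a::euclidean_space set \<Rightarrow> bool" where
  "bounded_C2_domain S \<longleftrightarrow> open S \<and> connected S \<and> S \<noteq> {} \<and> bounded S \<and>
     (\<forall>p\<in>frontier S. \<exists>r e \<gamma>. C2_chart S p r e \<gamma>)"

definition outward_normal :: "'a::euclidean_space set \<Rightarrow> 'a \<Rightarrow> 'a \<Rightarrow> bool" where
  "outward_normal S p \<nu> \<longleftrightarrow> (\<exists>r e \<gamma>. C2_chart S p r e \<gamma> \<and>
     \<nu> = sgn (grad (local_defining e \<gamma>) p))"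

text \<open>
  \<open>C2_closure S f Df\<close>: \<open>f\<close> is \<open>C\<^sup>2\<close> in the open set \<open>S\<close>, it and its first and second derivatives
  extend continuously to the closure of \<open>S\<close>, and \<open>Df\<close> is its gradient extended in this way.
\<close>

definition C2_closure :: "'a::euclidean_space set \<Rightarrow> ('a \<Rightarrow> real) \<Rightarrow> ('a \<Rightarrow> 'a) \<Rightarrow> bool" where
  "C2_closure S f Df \<longleftrightarrow> continuous_on (closure S) f \<and> continuous_on (closure S) Df \<and>
     (\<forall>x\<in>S. GDERIV f x :> Df x) \<and>
     (\<exists>H::'a \<Rightarrow> 'a \<Rightarrow>\<^sub>L 'a. continuous_on (closure S) H \<and>
        (\<forall>x\<in>S. (Df has_derivative blinfun_apply (H x)) (at x)))"

definition weight_generator ::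
    "'a::euclidean_space set \<Rightarrow> 'a set \<Rightarrow> ('a \<Rightarrow> real) \<Rightarrow> bool" where
  "weight_generator \<Omega> \<omega> \<eta>0 \<longleftrightarrow> (\<exists>D. C2_closure \<Omega> \<eta>0 D \<and>
     (\<forall>x\<in>frontier \<Omega>. \<eta>0 x = 0) \<and>
     (\<forall>x\<in>\<Omega> - closure \<omega>. norm (D x) > 0) \<and>
     (\<forall>p\<in>frontier \<Omega>. \<forall>\<nu>. outward_normal \<Omega> p \<nu> \<longrightarrow> D p \<bullet> \<nu> < 0))"

definition cylinder :: "'a set \<Rightarrow> real \<Rightarrow> ('a \<times> real) set" where
  "cylinder S T = S \<times> {0<..<T}"

text \<open>
  Weak solutions of \<open>\<partial>\<^sub>t y - div (a \<nabla>y) + b y = f\<close> with homogeneous Dirichlet condition and initial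
  datum \<open>y0\<close>, in \<open>C([0,T]; L\<^sup>2) \<inter> L\<^sup>2(0,T; H\<^sup>1\<^sub>0)\<close>. The function \<open>y\<close> is a representative whose time
  slices at every \<open>t\<close> in \<open>[0,T]\<close> form the continuous \<open>L\<^sup>2\<close>-valued curve, and \<open>G\<close> is the spatial
  gradient. The equation is the usual
  \<open>d/dt (y(t), w) + \<integral> a \<nabla>y \<cdot> \<nabla>w + \<integral> b y w = (f(t), w)\<close> for all \<open>w\<close> in \<open>H\<^sup>1\<^sub>0\<close>, in the sense of
  distributions on \<open>(0,T)\<close>, integrated from \<open>0\<close> to \<open>t\<close>.
\<close>

definition weak_solution ::
    "'a::euclidean_space set \<Rightarrow> real \<Rightarrow> ('a \<times> real \<Rightarrow> real) \<Rightarrow> ('a \<times> real \<Rightarrow> real) \<Rightarrow>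
     ('a \<times> real \<Rightarrow> real) \<Rightarrow> ('a \<Rightarrow> real) \<Rightarrow> ('a \<times> real \<Rightarrow> real) \<Rightarrow> bool" where
  "weak_solution \<Omega> T a b f y0 y \<longleftrightarrow>
     y \<in> L2 (cylinder \<Omega> T) \<and>
     (\<forall>t\<in>{0..T}. (\<lambda>x. y (x, t)) \<in> L2 \<Omega>) \<and>
     (\<forall>t\<in>{0..T}. ((\<lambda>s. L2_norm \<Omega> (\<lambda>x. y (x, s) - y (x, t))) \<longlongrightarrow> 0) (at t within {0..T})) \<and>
     (AE x\<in>\<Omega> in lborel. y (x, 0) = y0 x) \<and>
     (\<exists>G::'a \<times> real \<Rightarrow> 'a. G \<in> L2 (cylinder \<Omega> T) \<and>
        (AE t\<in>{0<..<T} in lborel. H10 \<Omega> (\<lambda>x. y (x, t)) (\<lambda>x. G (x, t))) \<and>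
        (\<forall>w Dw. H10 \<Omega> w Dw \<longrightarrow> (\<forall>t\<in>{0..T}.
           (LINT x:\<Omega>|lborel. y (x, t) * w x) - (LINT x:\<Omega>|lborel. y0 x * w x)
           + (LINT (x, s):cylinder \<Omega> t|lborel.
                a (x, s) * (G (x, s) \<bullet> Dw x) + b (x, s) * y (x, s) * w x)
           = (LINT (x, s):cylinder \<Omega> t|lborel. f (x, s) * w x))))"

definition extend_control :: "'a set \<Rightarrow> ('a \<times> real \<Rightarrow> real) \<Rightarrow> 'a \<times> real \<Rightarrow> real" where
  "extend_control \<omega> v = (\<lambda>(x, t). if x \<in> \<omega> then v (x, t) else 0)"

definition carleman_alpha ::
    "real \<Rightarrow> real \<Rightarrow> real \<Rightarrow> ('a \<Rightarrow> real) \<Rightarrow> 'a \<times> real \<Rightarrow> real" where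
  "carleman_alpha K1 K2 T \<eta>0 = (\<lambda>(x, t). K1 * ((exp K2 - exp (\<eta>0 x)) / (T - t)))"

definition carleman_rho ::
    "real \<Rightarrow> real \<Rightarrow> real \<Rightarrow> ('a \<Rightarrow> real) \<Rightarrow> 'a \<times> real \<Rightarrow> real" where
  "carleman_rho K1 K2 T \<eta>0 z = exp (carleman_alpha K1 K2 T \<eta>0 z)"

definition carleman_rho0 ::
    "real \<Rightarrow> real \<Rightarrow> real \<Rightarrow> ('a \<Rightarrow> real) \<Rightarrow> 'a \<times> real \<Rightarrow> real" where
  "carleman_rho0 K1 K2 T \<eta>0 z = (T - snd z) powr (3/2) * carleman_rho K1 K2 T \<eta>0 z"

text \<open>
  With \<open>S = cylinder \<omega> T\<close> and \<open>\<sigma> = \<rho>0\<close> this is the control space \<open>\<U>\<close>; with \<open>S = cylinder \<Omega> T\<close> and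
  \<open>\<sigma> = \<rho>\<close> it is \<open>\<Y>\<close>.
\<close>

definition weighted_L2 ::
    "'a::euclidean_space set \<Rightarrow> ('a \<Rightarrow> real) \<Rightarrow> ('a \<Rightarrow> real) set" where
  "weighted_L2 S \<sigma> = {f. f \<in> L2 S \<and> (\<lambda>z. \<sigma> z * f z) \<in> L2 S}"

definition weighted_L2_norm ::
    "'a::euclidean_space set \<Rightarrow> ('a \<Rightarrow> real) \<Rightarrow> ('a \<Rightarrow> real) \<Rightarrow> real" where
  "weighted_L2_norm S \<sigma> f = L2_norm S (\<lambda>z. \<sigma> z * f z)"

definition cost_J ::
    "('a::euclidean_space \<times> real) set \<Rightarrow> ('a \<times> real) set \<Rightarrow> ('a \<times> real \<Rightarrow> real) \<Rightarrow>
     ('a \<times> real \<Rightarrow> real) \<Rightarrow> ('a \<times> real \<Rightarrow> real) \<times> ('a \<times> real \<Rightarrow> real) \<Rightarrow> real" where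
  "cost_J Q Q\<omega> \<rho> \<rho>0 = (\<lambda>(y, v).
     1/2 * (LINT z:Q|lborel. (\<rho> z)\<^sup>2 * (y z)\<^sup>2) + 1/2 * (LINT z:Q\<omega>|lborel. (\<rho>0 z)\<^sup>2 * (v z)\<^sup>2))"

text \<open>The argument \<open>M\<close> is the solution operator with zero initial datum, \<open>ybar\<close> the free state.\<close>

definition cost_I ::
    "('a::euclidean_space \<times> real) set \<Rightarrow> ('a \<times> real) set \<Rightarrow> ('a \<times> real \<Rightarrow> real) \<Rightarrow>
     ('a \<times> real \<Rightarrow> real) \<Rightarrow> (('a \<times> real \<Rightarrow> real) \<Rightarrow> 'a \<times> real \<Rightarrow> real) \<Rightarrow>
     ('a \<times> real \<Rightarrow> real) \<Rightarrow> real \<Rightarrow> ('a \<times> real \<Rightarrow> real) \<Rightarrow> real" where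
  "cost_I Q Q\<omega> \<rho> \<rho>0 M ybar R v =
     1/2 * (LINT z:Q|lborel. (min R (\<rho> z))\<^sup>2 * (M v z + ybar z)\<^sup>2)
     + 1/2 * (LINT z:Q\<omega>|lborel. (\<rho>0 z)\<^sup>2 * (v z)\<^sup>2)"

definition controlled_pairs ::
    "('a::euclidean_space \<times> real) set \<Rightarrow> ('a \<times> real) set \<Rightarrow> ('a \<times> real \<Rightarrow> real) \<Rightarrow>
     ('a \<times> real \<Rightarrow> real) \<Rightarrow> (('a \<times> real \<Rightarrow> real) \<Rightarrow> 'a \<times> real \<Rightarrow> real) \<Rightarrow>
     ('a \<times> real \<Rightarrow> real) \<Rightarrow> (('a \<times> real \<Rightarrow> real) \<times> ('a \<times> real \<Rightarrow> real)) set" where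
  "controlled_pairs Q Q\<omega> \<rho> \<rho>0 M ybar =
     {(y, v). y \<in> weighted_L2 Q \<rho> \<and> v \<in> weighted_L2 Q\<omega> \<rho>0 \<and>
              (AE z\<in>Q in lborel. y z = M v z + ybar z)}"

end

theory Submission
  imports Defs
begin

text \<open>
  Let \<open>m\<^sub>R\<close> be the minimum of \<open>I\<^sub>R\<close>. It increases with \<open>R\<close> and is bounded by the values of \<open>J\<close> on
  the controlled pairs. The parallelogram identity for the quadratic functional \<open>I\<^sub>R\<close> gives
  \<open>\<parallel>\<rho>\<^sub>0 (v - v\<^sub>R)\<parallel>\<^sup>2 \<le> 4 (I\<^sub>R(v) - m\<^sub>R)\<close> for every \<open>v\<close>; with \<open>v = v\<^sub>S\<close>, \<open>S \<ge> R\<close>, the minimizers form a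
  Cauchy family, and by Fatou their limit has cost \<open>J \<le> lim m\<^sub>R\<close>, so it is the minimizer of \<open>J\<close>.

  All that is used of the parabolic equation is that \<open>M\<close> is linear and bounded on \<open>L\<^sup>2\<close>, that is, the
  energy estimate for weak solutions with zero initial datum. It is obtained without a
  Lions--Magenes lemma: testing the equation between the times \<open>t - h\<close> and \<open>t\<close> with
  \<open>y(t) + y(t - h)\<close> gives \<open>\<parallel>y(t)\<parallel>\<^sup>2 - \<parallel>y(t - h)\<parallel>\<^sup>2\<close>. Multiplying by \<open>e\<^bsup>-Kt\<^esup>\<close>, integrating in \<open>t\<close>, dividing by
  \<open>h\<close> and letting \<open>h \<rightarrow> 0\<close> by the continuity of translations in \<open>L\<^sup>2\<close> yields the weighted energy
  inequality, where \<open>K\<close> large absorbs the zeroth order terms.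
\<close>

section \<open>Square-integrable functions\<close>

text \<open>The obstacle is that the time derivative of a state is only a functional on H^1_0, so
  the state is no admissible time-dependent test function and its squared norm is not known to be
  differentiable in time. The integrated equation admits test functions of x alone; a slice at a
  fixed time \<tau> is one for almost every \<tau>. Extending the state by zero to negative times
  agrees with the zero initial datum, so the increment identity survives when t - h is negative and
  no boundary term appears at t = 0. \<open>M\<close> is given only as a selection of weak
  solutions. Its linearity has to be extracted from the energy estimate and holds up to null sets,
  which is why the arguments on minimizers ask for midpoints only, and only almost everywhere. The
  weight \<rho> is unbounded near t = T, so the cost of a control and its state may be infinite,
  whereas I_R is continuous on the control space because the truncated weight is at most R. Bounds
  are therefore proved for fixed R on the limit control before R tends to infinity. The weight
  \<rho>0 is bounded below, which makes the control space complete and embeds it in L^2.\<close>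

definition sq_integrable :: "'c measure \<Rightarrow> ('c \<Rightarrow> 'd::euclidean_space) \<Rightarrow> bool" where
  "sq_integrable M f \<longleftrightarrow> f \<in> borel_measurable M \<and> integrable M (\<lambda>x. (norm (f x))\<^sup>2)"

definition sq_norm :: "'c measure \<Rightarrow> ('c \<Rightarrow> 'd::euclidean_space) \<Rightarrow> real" where
  "sq_norm M f = (\<integral>x. (norm (f x))\<^sup>2 \<partial>M)"

lemma sq_norm_nonneg [simp]: "sq_norm M f \<ge> 0"
  by (simp add: sq_norm_def)

lemma sq_integrable_bound:
  assumes "sq_integrable M f" "g \<in> borel_measurable M" "AE x in M. norm (g x) \<le> C * norm (f x)"
  shows "sq_integrable M g"
proof -
  have m: "f \<in> borel_measurable M" and i: "integrable M (\<lambda>x. (norm (f x))\<^sup>2)"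
    using assms(1) by (auto simp: sq_integrable_def)
  have "integrable M (\<lambda>x. (norm (g x))\<^sup>2)"
  proof (rule Bochner_Integration.integrable_bound)
    show "integrable M (\<lambda>x. C\<^sup>2 * (norm (f x))\<^sup>2)" using i by simp
    show "(\<lambda>x. (norm (g x))\<^sup>2) \<in> borel_measurable M" using assms(2) by measurable
    show "AE x in M. norm ((norm (g x))\<^sup>2) \<le> norm (C\<^sup>2 * (norm (f x))\<^sup>2)"
      using assms(3)
    proof eventually_elim
      fix x assume "norm (g x) \<le> C * norm (f x)"
      then have "(norm (g x))\<^sup>2 \<le> (C * norm (f x))\<^sup>2"
        by (intro power_mono) auto
      then show "norm ((norm (g x))\<^sup>2) \<le> norm (C\<^sup>2 * (norm (f x))\<^sup>2)"
        by (simp add: power_mult_distrib)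
    qed
  qed
  then show ?thesis using assms(2) by (simp add: sq_integrable_def)
qed

lemma norm_add_sq_le: "(norm (u + v :: 'd::euclidean_space))\<^sup>2 \<le> 2 * (norm u)\<^sup>2 + 2 * (norm v)\<^sup>2"
proof -
  have "(norm (u + v))\<^sup>2 + (norm (u - v))\<^sup>2 = 2 * (norm u)\<^sup>2 + 2 * (norm v)\<^sup>2"
    by (simp add: power2_norm_eq_inner algebra_simps inner_commute)
  then show ?thesis by (smt (verit) zero_le_power2)
qed

lemma sq_integrable_add:
  assumes "sq_integrable M f" "sq_integrable M g"
  shows "sq_integrable M (\<lambda>x. f x + g x)"
proof -
  have [measurable]: "f \<in> borel_measurable M" "g \<in> borel_measurable M"
    using assms by (auto simp: sq_integrable_def)
  have "integrable M (\<lambda>x. (norm (f x + g x))\<^sup>2)"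
    by (rule Bochner_Integration.integrable_bound[of _ "\<lambda>x. 2 * (norm (f x))\<^sup>2 + 2 * (norm (g x))\<^sup>2"])
       (use assms norm_add_sq_le in \<open>auto simp: sq_integrable_def\<close>)
  then show ?thesis by (simp add: sq_integrable_def)
qed

lemma sq_integrable_scaleR:
  "sq_integrable M f \<Longrightarrow> sq_integrable M (\<lambda>x. c *\<^sub>R f x)"
  by (rule sq_integrable_bound[where C = "\<bar>c\<bar>"]) (auto simp: sq_integrable_def)

lemma sq_integrable_diff:
  assumes "sq_integrable M f" "sq_integrable M g"
  shows "sq_integrable M (\<lambda>x. f x - g x)"
  using sq_integrable_add[OF assms(1) sq_integrable_scaleR[OF assms(2), of "-1"]] by simp

lemma sq_norm_cong_AE:
  assumes "f \<in> borel_measurable M" "g \<in> borel_measurable M" "AE x in M. f x = g x"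
  shows "sq_norm M f = sq_norm M g"
  unfolding sq_norm_def using assms by (intro integral_cong_AE) auto

lemma sq_norm_scaleR: "sq_norm M (\<lambda>x. c *\<^sub>R f x) = c\<^sup>2 * sq_norm M f"
  by (simp add: sq_norm_def power_mult_distrib)

lemma sq_norm_minus_commute: "sq_norm M (\<lambda>x. f x - g x) = sq_norm M (\<lambda>x. g x - f x)"
  by (simp add: sq_norm_def norm_minus_commute)

lemma sq_norm_eq_0_iff:
  assumes "sq_integrable M f"
  shows "sq_norm M f = 0 \<longleftrightarrow> (AE x in M. f x = 0)"
  using integral_nonneg_eq_0_iff_AE[of M "\<lambda>x. (norm (f x))\<^sup>2"] assms
  by (simp add: sq_norm_def sq_integrable_def)

lemma sq_norm_add_le:
  assumes "sq_integrable M f" "sq_integrable M g"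
  shows "sq_norm M (\<lambda>x. f x + g x) \<le> 2 * sq_norm M f + 2 * sq_norm M g"
proof -
  have "sq_norm M (\<lambda>x. f x + g x) \<le> (\<integral>x. 2 * (norm (f x))\<^sup>2 + 2 * (norm (g x))\<^sup>2 \<partial>M)"
    unfolding sq_norm_def
    by (rule integral_mono)
       (use assms sq_integrable_add[OF assms] norm_add_sq_le in \<open>auto simp: sq_integrable_def\<close>)
  then show ?thesis using assms by (simp add: sq_norm_def sq_integrable_def)
qed

lemma sq_norm_diff_le:
  assumes "sq_integrable M f" "sq_integrable M g" "sq_integrable M h"
  shows "sq_norm M (\<lambda>x. f x - h x) \<le> 2 * sq_norm M (\<lambda>x. f x - g x) + 2 * sq_norm M (\<lambda>x. g x - h x)"
  using sq_norm_add_le[OF sq_integrable_diff[OF assms(1,2)] sq_integrable_diff[OF assms(2,3)]]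
  by simp

lemma sq_norm_parallelogram:
  assumes "sq_integrable M f" "sq_integrable M g"
  shows "sq_norm M (\<lambda>x. f x - g x) =
    2 * sq_norm M f + 2 * sq_norm M g - 4 * sq_norm M (\<lambda>x. (1/2) *\<^sub>R (f x + g x))"
proof -
  have "sq_norm M (\<lambda>x. f x - g x) + sq_norm M (\<lambda>x. f x + g x)
      = (\<integral>x. (norm (f x - g x))\<^sup>2 + (norm (f x + g x))\<^sup>2 \<partial>M)"
    unfolding sq_norm_def
    by (rule Bochner_Integration.integral_add[symmetric])
       (use sq_integrable_add[OF assms] sq_integrable_diff[OF assms] in
         \<open>auto simp: sq_integrable_def\<close>)
  also have "\<dots> = (\<integral>x. 2 * (norm (f x))\<^sup>2 + 2 * (norm (g x))\<^sup>2 \<partial>M)"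
    by (simp add: power2_norm_eq_inner algebra_simps inner_commute)
  also have "\<dots> = 2 * sq_norm M f + 2 * sq_norm M g"
    using assms by (simp add: sq_norm_def sq_integrable_def)
  finally show ?thesis
    using sq_norm_scaleR[of M "1/2" "\<lambda>x. f x + g x"] by (simp add: power2_eq_square)
qed

lemma sq_integrable_inner:
  assumes "sq_integrable M f" "sq_integrable M g"
  shows "integrable M (\<lambda>x. f x \<bullet> g x)"
proof (rule Bochner_Integration.integrable_bound)
  have [measurable]: "f \<in> borel_measurable M" "g \<in> borel_measurable M"
    using assms by (auto simp: sq_integrable_def)
  show "(\<lambda>x. f x \<bullet> g x) \<in> borel_measurable M" by measurable
  show "integrable M (\<lambda>x. (norm (f x))\<^sup>2 + (norm (g x))\<^sup>2)"
    using assms by (simp add: sq_integrable_def)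
  have "\<bar>u \<bullet> v\<bar> \<le> (norm u)\<^sup>2 + (norm v)\<^sup>2" for u v :: 'b
  proof -
    have "0 \<le> norm u * norm v" by simp
    then show ?thesis
      using Cauchy_Schwarz_ineq2[of u v] sum_squares_bound[of "norm u" "norm v"] by linarith
  qed
  then show "AE x in M. norm (f x \<bullet> g x) \<le> norm ((norm (f x))\<^sup>2 + (norm (g x))\<^sup>2)"
    by simp
qed

lemma norm_add_scaleR_sq:
  "(norm (u + c *\<^sub>R v :: 'd::euclidean_space))\<^sup>2 = (norm u)\<^sup>2 + 2 * c * (u \<bullet> v) + c\<^sup>2 * (norm v)\<^sup>2"
  unfolding power2_norm_eq_inner
  by (simp add: inner_simps inner_commute power2_eq_square algebra_simps)

lemma sq_norm_Cauchy_Schwarz: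
  assumes "sq_integrable M f" "sq_integrable M g"
  shows "\<bar>\<integral>x. f x \<bullet> g x \<partial>M\<bar> \<le> sqrt (sq_norm M f) * sqrt (sq_norm M g)"
proof -
  have quad: "0 \<le> sq_norm M f + 2 * c * (\<integral>x. f x \<bullet> g x \<partial>M) + c\<^sup>2 * sq_norm M g" for c
  proof -
    have "0 \<le> sq_norm M (\<lambda>x. f x + c *\<^sub>R g x)" by simp
    also have "sq_norm M (\<lambda>x. f x + c *\<^sub>R g x) =
        (\<integral>x. (norm (f x))\<^sup>2 + 2 * c * (f x \<bullet> g x) + c\<^sup>2 * (norm (g x))\<^sup>2 \<partial>M)"
      by (simp add: sq_norm_def norm_add_scaleR_sq)
    also have "\<dots> = sq_norm M f + 2 * c * (\<integral>x. f x \<bullet> g x \<partial>M) + c\<^sup>2 * sq_norm M g"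
      using assms sq_integrable_inner[OF assms] by (simp add: sq_norm_def sq_integrable_def)
    finally show ?thesis .
  qed
  define p where "p = (\<integral>x. f x \<bullet> g x \<partial>M)"
  have "p\<^sup>2 \<le> sq_norm M f * sq_norm M g"
  proof (cases "sq_norm M g = 0")
    case True
    then have "AE x in M. g x = 0" using sq_norm_eq_0_iff[OF assms(2)] by simp
    then have "p = 0" unfolding p_def
      by (intro integral_eq_zero_AE) auto
    then show ?thesis by simp
  next
    case False
    then have pos: "sq_norm M g > 0" using sq_norm_nonneg[of M g] by linarith
    \<comment> \<open>The quadratic in \<open>c\<close> attains its minimum at
      \<open>c = - p / sq_norm M g\<close>.\<close>
    have "0 \<le> sq_norm M f + 2 * (- p / sq_norm M g) * p + (- p / sq_norm M g)\<^sup>2 * sq_norm M g"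
      using quad[of "- p / sq_norm M g"] by (simp add: p_def)
    also have "\<dots> = sq_norm M f - p\<^sup>2 / sq_norm M g"
      using pos by (simp add: field_simps power2_eq_square)
    finally show ?thesis using pos by (simp add: field_simps)
  qed
  then have "sqrt (p\<^sup>2) \<le> sqrt (sq_norm M f * sq_norm M g)" by (rule real_sqrt_le_mono)
  then show ?thesis by (simp add: p_def real_sqrt_mult)
qed

lemma sq_norm_triangle:
  assumes "sq_integrable M f" "sq_integrable M g"
  shows "sqrt (sq_norm M (\<lambda>x. f x + g x)) \<le> sqrt (sq_norm M f) + sqrt (sq_norm M g)"
proof (rule real_le_lsqrt)
  have "sq_norm M (\<lambda>x. f x + g x) =
      (\<integral>x. (norm (f x))\<^sup>2 + 2 * (f x \<bullet> g x) + (norm (g x))\<^sup>2 \<partial>M)"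
    using norm_add_scaleR_sq[of "f _" 1 "g _"] by (simp add: sq_norm_def)
  also have "\<dots> = sq_norm M f + 2 * (\<integral>x. f x \<bullet> g x \<partial>M) + sq_norm M g"
    using assms sq_integrable_inner[OF assms] by (simp add: sq_norm_def sq_integrable_def)
  also have "\<dots> \<le> (sqrt (sq_norm M f) + sqrt (sq_norm M g))\<^sup>2"
    using sq_norm_Cauchy_Schwarz[OF assms] by (simp add: power2_sum)
  finally show "sq_norm M (\<lambda>x. f x + g x) \<le> (sqrt (sq_norm M f) + sqrt (sq_norm M g))\<^sup>2" .
qed auto

section \<open>Fatou, completeness and least norm in L^2\<close>

lemma ennreal_sq_norm:
  "sq_integrable M f \<Longrightarrow> ennreal (sq_norm M f) = (\<integral>\<^sup>+x. ennreal ((norm (f x))\<^sup>2) \<partial>M)"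
  unfolding sq_norm_def sq_integrable_def by (subst nn_integral_eq_integral) auto

text \<open>Integrability of the limit belongs to the conclusion. This serves completeness of L^2
  and later, with truncated weights, the membership of the limit state in the space weighted by
  \<rho>.\<close>

lemma sq_integrable_Fatou:
  assumes "\<And>k. sq_integrable M (f k)" "g \<in> borel_measurable M"
    and lim: "AE x in M. (\<lambda>k. f k x) \<longlonglongrightarrow> g x"
    and bd: "\<forall>\<^sub>F k in sequentially. sq_norm M (f k) \<le> B"
  shows "sq_integrable M g" "sq_norm M g \<le> B"
proof -
  have [measurable]: "f k \<in> borel_measurable M" for k
    using assms(1)[of k] by (simp add: sq_integrable_def)
  note [measurable] = assms(2)
  have B: "B \<ge> 0"
  proof -
    obtain k where "sq_norm M (f k) \<le> B" using eventually_happens[OF bd] by auto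
    then show ?thesis using sq_norm_nonneg[of M "f k"] by linarith
  qed
  have "(\<integral>\<^sup>+x. ennreal ((norm (g x))\<^sup>2) \<partial>M) = (\<integral>\<^sup>+x. liminf (\<lambda>k. ennreal ((norm (f k x))\<^sup>2)) \<partial>M)"
  proof (rule nn_integral_cong_AE, use lim in eventually_elim)
    fix x assume "(\<lambda>k. f k x) \<longlonglongrightarrow> g x"
    then have "(\<lambda>k. ennreal ((norm (f k x))\<^sup>2)) \<longlonglongrightarrow> ennreal ((norm (g x))\<^sup>2)"
      by (intro tendsto_ennrealI tendsto_intros)
    from lim_imp_Liminf[OF _ this]
    show "ennreal ((norm (g x))\<^sup>2) = liminf (\<lambda>k. ennreal ((norm (f k x))\<^sup>2))" by simp
  qed
  also have "\<dots> \<le> liminf (\<lambda>k. \<integral>\<^sup>+x. ennreal ((norm (f k x))\<^sup>2) \<partial>M)"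
    by (rule nn_integral_liminf) measurable
  also have "\<dots> = liminf (\<lambda>k. ennreal (sq_norm M (f k)))"
    by (simp add: ennreal_sq_norm assms(1))
  also have "\<dots> \<le> liminf (\<lambda>k. ennreal B)"
    by (rule Liminf_mono) (use bd in \<open>auto elim!: eventually_mono intro: ennreal_leI\<close>)
  also have "\<dots> = ennreal B" by (simp add: Liminf_const)
  finally have le: "(\<integral>\<^sup>+x. ennreal ((norm (g x))\<^sup>2) \<partial>M) \<le> ennreal B" .
  have "integrable M (\<lambda>x. (norm (g x))\<^sup>2)"
    by (rule integrableI_bounded) (use le in \<open>auto simp: top.not_eq_extremum intro: le_less_trans\<close>)
  then show gi: "sq_integrable M g" using assms(2) by (simp add: sq_integrable_def)
  show "sq_norm M g \<le> B"
    using le ennreal_sq_norm[OF gi] B by (metis ennreal_le_iff)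
qed

text \<open>The factor \<open>2 ^ k\<close> on the squares bounds the unsquared increments by
  \<open>sqrt C * (1 / sqrt 2) ^ k\<close>, which is summable.\<close>

lemma convergent_if_fast_Cauchy:
  fixes u :: "nat \<Rightarrow> 'd::banach"
  assumes "\<And>k. 2 ^ k * (norm (u (Suc k) - u k))\<^sup>2 \<le> C"
  shows "convergent u"
proof -
  have le: "norm (u (Suc k) - u k) \<le> sqrt C * (1 / sqrt 2) ^ k" for k
  proof -
    have "(norm (u (Suc k) - u k))\<^sup>2 \<le> C / 2 ^ k"
      using assms[of k] by (simp add: field_simps)
    then have "norm (u (Suc k) - u k) \<le> sqrt (C / 2 ^ k)"
      by (rule real_le_rsqrt)
    also have "\<dots> = sqrt C * (1 / sqrt 2) ^ k"
      by (simp add: real_sqrt_divide real_sqrt_power power_divide)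
    finally show ?thesis .
  qed
  have "summable (\<lambda>k. sqrt C * (1 / sqrt 2) ^ k)"
    by (intro summable_mult summable_geometric) simp
  then have "summable (\<lambda>k. u (Suc k) - u k)"
    by (rule summable_comparison_test[rotated]) (use le in auto)
  then have "convergent (\<lambda>n. \<Sum>k<n. u (Suc k) - u k)"
    by (simp add: summable_iff_convergent)
  then have "convergent (\<lambda>n. u n - u 0)" by (simp add: sum_lessThan_telescope)
  then have "convergent (\<lambda>n. (u n - u 0) + u 0)"
    by (rule convergent_add) (rule convergent_const)
  then show ?thesis by simp
qed

text \<open>Riesz-Fischer. Along a subsequence with squared increments of norm at most
  \<open>(1/4) ^ k\<close>, the series of squared increments weighted by \<open>2 ^ k\<close> has
  integral at most the sum of \<open>(1/2) ^ k\<close>. It is therefore finite almost everywhere,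
  which gives pointwise convergence.\<close>

lemma sq_integrable_complete:
  fixes f :: "nat \<Rightarrow> 'c \<Rightarrow> 'd::euclidean_space"
  assumes si: "\<And>n. sq_integrable M (f n)"
    and cauchy: "\<And>e. e > 0 \<Longrightarrow> \<exists>N. \<forall>m\<ge>N. \<forall>n\<ge>N. sq_norm M (\<lambda>x. f m x - f n x) \<le> e"
  obtains g where "sq_integrable M g" "(\<lambda>n. sq_norm M (\<lambda>x. f n x - g x)) \<longlonglongrightarrow> 0"
proof -
  have [measurable]: "f k \<in> borel_measurable M" for k
    using si[of k] by (simp add: sq_integrable_def)
  have "\<exists>N. \<forall>m\<ge>N. \<forall>n\<ge>N. sq_norm M (\<lambda>x. f m x - f n x) \<le> (1/4) ^ k" for k :: nat
    by (rule cauchy) simp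
  then obtain N where N: "\<And>k m n. m \<ge> N k \<Longrightarrow> n \<ge> N k \<Longrightarrow> sq_norm M (\<lambda>x. f m x - f n x) \<le> (1/4) ^ k"
    by metis
  \<comment> \<open>The maximum gives \<open>r j \<ge> N k\<close> for every
    \<open>j \<ge> k\<close>; the summand \<open>k\<close> makes \<open>r\<close> tend to infinity,
    so that the whole sequence can be compared with the subsequence.\<close>
  define r where "r k = k + Max (N ` {..k})" for k
  have rN: "r j \<ge> N k" if "k \<le> j" for k j
    unfolding r_def using that by (intro trans_le_add2 Max_ge) auto
  define u where "u k x = f (r k) x" for k x
  have [measurable]: "u k \<in> borel_measurable M" for k
    unfolding u_def[abs_def] by measurable
  have ui: "sq_integrable M (u k)" for k unfolding u_def[abs_def] by (rule si)
  have d: "sq_norm M (\<lambda>x. u (Suc k) x - u k x) \<le> (1/4) ^ k" for k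
    unfolding u_def by (rule N) (auto intro: rN)
  define S where "S x = (\<Sum>k. ennreal (2 ^ k * (norm (u (Suc k) x - u k x))\<^sup>2))" for x
  have [measurable]: "S \<in> borel_measurable M" unfolding S_def[abs_def] by measurable
  have "(\<integral>\<^sup>+x. S x \<partial>M) = (\<Sum>k. \<integral>\<^sup>+x. ennreal (2 ^ k * (norm (u (Suc k) x - u k x))\<^sup>2) \<partial>M)"
    unfolding S_def by (rule nn_integral_suminf) measurable
  also have "\<dots> = (\<Sum>k. ennreal (2 ^ k) * ennreal (sq_norm M (\<lambda>x. u (Suc k) x - u k x)))"
    by (subst ennreal_sq_norm[OF sq_integrable_diff[OF ui ui]])
       (simp add: nn_integral_cmult ennreal_mult)
  also have "\<dots> \<le> (\<Sum>k. ennreal ((1/2) ^ k))"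
  proof (rule suminf_le)
    fix k
    have "2 ^ k * sq_norm M (\<lambda>x. u (Suc k) x - u k x) \<le> 2 ^ k * (1/4) ^ k"
      using d by (intro mult_left_mono) auto
    also have "\<dots> = (1/2) ^ k" by (simp flip: power_mult_distrib)
    finally show "ennreal (2 ^ k) * ennreal (sq_norm M (\<lambda>x. u (Suc k) x - u k x)) \<le> ennreal ((1/2) ^ k)"
      by (simp flip: ennreal_mult add: ennreal_leI)
  qed auto
  also have "\<dots> = ennreal (\<Sum>k. (1/2) ^ k)"
    by (rule suminf_ennreal_eq) (auto intro: summable_sums summable_geometric)
  also have "\<dots> < \<infinity>" by simp
  finally have "AE x in M. S x \<noteq> \<infinity>"
    by (intro nn_integral_PInf_AE) auto
  then have conv: "AE x in M. convergent (\<lambda>k. u k x)"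
  proof eventually_elim
    fix x assume S: "S x \<noteq> \<infinity>"
    have le: "ennreal (2 ^ k * (norm (u (Suc k) x - u k x))\<^sup>2) \<le> S x" for k
    proof -
      have "(\<Sum>k\<in>{k}. ennreal (2 ^ k * (norm (u (Suc k) x - u k x))\<^sup>2)) \<le> S x"
        unfolding S_def by (rule sum_le_suminf) auto
      then show ?thesis by simp
    qed
    have "2 ^ k * (norm (u (Suc k) x - u k x))\<^sup>2 \<le> enn2real (S x)" for k
    proof -
      obtain c where "S x = ennreal c" "c \<ge> 0" using S by (cases "S x") auto
      then show ?thesis using le[of k] by (simp add: ennreal_le_iff)
    qed
    then show "convergent (\<lambda>k. u k x)" by (rule convergent_if_fast_Cauchy)
  qed
  \<comment> \<open>\<open>lim\<close> is total, so \<open>g\<close> is measurable on the whole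
    space; its values on the null set of divergence do not matter.\<close>
  define g where "g x = lim (\<lambda>k. u k x)" for x
  have [measurable]: "g \<in> borel_measurable M" unfolding g_def[abs_def] by measurable
  have lim: "AE x in M. (\<lambda>k. u k x) \<longlonglongrightarrow> g x"
    using conv by eventually_elim (simp add: g_def convergent_LIMSEQ_iff)
  \<comment> \<open>Fatou in the second index: \<open>f n\<close> stays fixed and the subsequence
    runs to its limit.\<close>
  have key: "sq_integrable M (\<lambda>x. f n x - g x) \<and> sq_norm M (\<lambda>x. f n x - g x) \<le> e"
    if "\<forall>m\<ge>K. \<forall>n\<ge>K. sq_norm M (\<lambda>x. f m x - f n x) \<le> e" "n \<ge> K" for n K e
  proof -
    have ev: "\<forall>\<^sub>F k in sequentially. sq_norm M (\<lambda>x. f n x - u k x) \<le> e"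
      using eventually_ge_at_top[of K]
    proof eventually_elim
      fix k assume "k \<ge> K"
      then have "r k \<ge> K" by (simp add: r_def)
      then show "sq_norm M (\<lambda>x. f n x - u k x) \<le> e"
        unfolding u_def using that by simp
    qed
    have l: "AE x in M. (\<lambda>k. f n x - u k x) \<longlonglongrightarrow> f n x - g x"
      using lim by eventually_elim (intro tendsto_intros)
    show ?thesis
      using sq_integrable_Fatou[OF sq_integrable_diff[OF si ui] _ l ev] by simp
  qed
  obtain K where "\<forall>m\<ge>K. \<forall>n\<ge>K. sq_norm M (\<lambda>x. f m x - f n x) \<le> 1" using cauchy[of 1] by auto
  from key[OF this, of K] have "sq_integrable M (\<lambda>x. f K x - g x)" by simp
  from sq_integrable_diff[OF si[of K] this] have "sq_integrable M g" by simp
  moreover have "(\<lambda>n. sq_norm M (\<lambda>x. f n x - g x)) \<longlonglongrightarrow> 0"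
  proof (rule LIMSEQ_I)
    fix e :: real assume "e > 0"
    then obtain K where "\<forall>m\<ge>K. \<forall>n\<ge>K. sq_norm M (\<lambda>x. f m x - f n x) \<le> e / 2"
      using cauchy[of "e/2"] by auto
    from key[OF this] \<open>e > 0\<close> show "\<exists>no. \<forall>n\<ge>no. norm (sq_norm M (\<lambda>x. f n x - g x) - 0) < e"
      by (intro exI[of _ K]) force
  qed
  ultimately show thesis by (rule that)
qed

lemma sq_norm_tendsto:
  assumes "\<And>n. sq_integrable M (f n)" "sq_integrable M g"
    and "(\<lambda>n. sq_norm M (\<lambda>x. f n x - g x)) \<longlonglongrightarrow> 0"
  shows "(\<lambda>n. sq_norm M (f n)) \<longlonglongrightarrow> sq_norm M g"
proof -
  have "(\<lambda>n. sqrt (sq_norm M (f n))) \<longlonglongrightarrow> sqrt (sq_norm M g)"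
  proof (rule LIM_zero_cancel, rule tendsto_0_le[where K = 1])
    show "(\<lambda>n. sqrt (sq_norm M (\<lambda>x. f n x - g x))) \<longlonglongrightarrow> 0"
      using tendsto_real_sqrt[OF assms(3)] by simp
    have "\<bar>sqrt (sq_norm M (f n)) - sqrt (sq_norm M g)\<bar> \<le> sqrt (sq_norm M (\<lambda>x. f n x - g x))" for n
      using sq_norm_triangle[OF sq_integrable_diff[OF assms(1)[of n] assms(2)] assms(2)]
        sq_norm_triangle[OF sq_integrable_diff[OF assms(2) assms(1)[of n]] assms(1)[of n]]
        sq_norm_minus_commute[of M "f n" g] by simp
    then show "\<forall>\<^sub>F n in sequentially. norm (sqrt (sq_norm M (f n)) - sqrt (sq_norm M g))
        \<le> norm (sqrt (sq_norm M (\<lambda>x. f n x - g x))) * 1"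
      by (intro always_eventually) simp
  qed
  from tendsto_power[OF this, of 2] show ?thesis by simp
qed

text \<open>
  The convex set is parametrised by \<open>E\<close>, so that its midpoints and limits need to be attained
  only up to null sets.
\<close>

lemma min_sq_norm_exists:
  fixes E :: "'p \<Rightarrow> 'c \<Rightarrow> 'd::euclidean_space"
  assumes ne: "P \<noteq> {}"
    and si: "\<And>p. p \<in> P \<Longrightarrow> sq_integrable M (E p)"
    and mid: "\<And>p q. p \<in> P \<Longrightarrow> q \<in> P \<Longrightarrow> \<exists>r\<in>P. AE x in M. E r x = (1/2) *\<^sub>R (E p x + E q x)"
    and closed: "\<And>u g. (\<And>n::nat. u n \<in> P) \<Longrightarrow> sq_integrable M g \<Longrightarrow>
      (\<lambda>n. sq_norm M (\<lambda>x. E (u n) x - g x)) \<longlonglongrightarrow> 0 \<Longrightarrow> \<exists>p\<in>P. AE x in M. E p x = g x"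
  shows "\<exists>p\<in>P. \<forall>q\<in>P. sq_norm M (E p) \<le> sq_norm M (E q)"
proof -
  define m where "m = Inf ((\<lambda>p. sq_norm M (E p)) ` P)"
  have bdd: "bdd_below ((\<lambda>p. sq_norm M (E p)) ` P)" by (rule bdd_belowI[of _ 0]) auto
  have m_le: "m \<le> sq_norm M (E p)" if "p \<in> P" for p
    unfolding m_def using bdd that by (intro cInf_lower) auto
  have "\<exists>p\<in>P. sq_norm M (E p) < m + 1 / real (Suc n)" for n
  proof -
    have "Inf ((\<lambda>p. sq_norm M (E p)) ` P) < m + 1 / real (Suc n)" by (simp add: m_def)
    then show ?thesis using cInf_lessD[of "(\<lambda>p. sq_norm M (E p)) ` P"] ne by auto
  qed
  then obtain u where u: "\<And>n. u n \<in> P" "\<And>n. sq_norm M (E (u n)) < m + 1 / real (Suc n)"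
    by metis
  \<comment> \<open>The midpoint has squared norm at least \<open>m\<close>, so the parallelogram
    identity forces near-minimizers to be close to each other.\<close>
  have dist: "sq_norm M (\<lambda>x. E p x - E q x) \<le> 2 * sq_norm M (E p) + 2 * sq_norm M (E q) - 4 * m"
    if pq: "p \<in> P" "q \<in> P" for p q
  proof -
    obtain r where r: "r \<in> P" "AE x in M. E r x = (1/2) *\<^sub>R (E p x + E q x)" using mid[OF pq] by auto
    have "sq_norm M (E r) = sq_norm M (\<lambda>x. (1/2) *\<^sub>R (E p x + E q x))"
      by (rule sq_norm_cong_AE)
         (use r si pq in \<open>auto simp: sq_integrable_def intro!: borel_measurable_scaleR borel_measurable_add\<close>)
    then show ?thesis using sq_norm_parallelogram[OF si si, OF pq] m_le[OF r(1)] by simp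
  qed
  obtain g where g: "sq_integrable M g" "(\<lambda>n. sq_norm M (\<lambda>x. E (u n) x - g x)) \<longlonglongrightarrow> 0"
  proof (rule sq_integrable_complete[where f = "\<lambda>n. E (u n)" and M = M])
    show "sq_integrable M (E (u n))" for n by (rule si) (rule u)
    fix e :: real assume e: "e > 0"
    \<comment> \<open>For indices \<open>k\<close> and \<open>l\<close> from \<open>N\<close> on,
      the squared distance is at most \<open>2/(k+1) + 2/(l+1) \<le> 4/(N+1)\<close>.\<close>
    obtain N where N: "4 / e < real N" using reals_Archimedean2 by blast
    have "sq_norm M (\<lambda>x. E (u k) x - E (u l) x) \<le> e" if "k \<ge> N" "l \<ge> N" for k l
    proof -
      have "1 / real (Suc k) \<le> 1 / real (Suc N)" "1 / real (Suc l) \<le> 1 / real (Suc N)"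
        using that by (auto intro!: divide_left_mono)
      moreover have "4 / real (Suc N) \<le> e"
        using N e by (simp add: field_simps)
      ultimately show ?thesis
        using dist[OF u(1)[of k] u(1)[of l]] u(2)[of k] u(2)[of l] by simp
    qed
    then show "\<exists>N. \<forall>k\<ge>N. \<forall>l\<ge>N. sq_norm M (\<lambda>x. E (u k) x - E (u l) x) \<le> e" by blast
  qed
  obtain p where p: "p \<in> P" "AE x in M. E p x = g x" using closed[OF u(1) g] by auto
  have "sq_norm M (E p) = sq_norm M g"
    by (rule sq_norm_cong_AE) (use p si g in \<open>auto simp: sq_integrable_def\<close>)
  moreover have "(\<lambda>n. sq_norm M (E (u n))) \<longlonglongrightarrow> sq_norm M g"
    by (rule sq_norm_tendsto[OF si[OF u(1)] g])
  moreover have "(\<lambda>n. sq_norm M (E (u n))) \<longlonglongrightarrow> m"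
  proof (rule tendsto_sandwich[OF _ _ tendsto_const])
    show "(\<lambda>n. m + 1 / real (Suc n)) \<longlonglongrightarrow> m"
      using tendsto_add[OF tendsto_const LIMSEQ_inverse_real_of_nat, of m] by (simp add: inverse_eq_divide)
    show "\<forall>\<^sub>F n in sequentially. sq_norm M (E (u n)) \<le> m + 1 / real (Suc n)"
      using u(2) by (intro always_eventually allI less_imp_le)
  qed (use u m_le in \<open>auto intro!: always_eventually\<close>)
  ultimately have "sq_norm M (E p) = m" using LIMSEQ_unique by metis
  then show ?thesis using p m_le by auto
qed

section \<open>Continuity of translations\<close>

lemma integrable_lborel_translate:
  fixes f :: "'a::euclidean_space \<Rightarrow> 'b::{banach, second_countable_topology}"
  assumes "integrable lborel f"
  shows "integrable lborel (\<lambda>x. f (x + c))"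
proof -
  have "integrable (distr lborel borel ((+) c)) f" using assms by (simp add: lborel_distr_plus)
  then have "integrable lborel (\<lambda>x. f (c + x))" by (rule integrable_distr[rotated]) simp
  then show ?thesis by (simp add: add.commute)
qed

lemma integral_lborel_translate:
  fixes f :: "'a::euclidean_space \<Rightarrow> 'b::{banach, second_countable_topology}"
  assumes "f \<in> borel_measurable borel"
  shows "(\<integral>x. f (x + c) \<partial>lborel) = (\<integral>x. f x \<partial>lborel)"
proof -
  have "(\<integral>x. f (c + x) \<partial>lborel) = (\<integral>x. f x \<partial>distr lborel borel ((+) c))"
    by (rule integral_distr[symmetric]) (use assms in auto)
  then show ?thesis by (simp add: lborel_distr_plus add.commute)
qed

text \<open>The form needed for density arguments: the comparison sequence \<open>b\<close> may
  depend on the tolerance \<open>e\<close>.\<close>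

lemma tendsto_0_approx:
  fixes a :: "nat \<Rightarrow> real"
  assumes "\<And>n. 0 \<le> a n"
    and "\<And>e. e > 0 \<Longrightarrow> \<exists>b. b \<longlonglongrightarrow> 0 \<and> (\<forall>n. a n \<le> b n + e)"
  shows "a \<longlonglongrightarrow> 0"
proof (rule LIMSEQ_I)
  fix r :: real assume r: "r > 0"
  then obtain b where b: "b \<longlonglongrightarrow> 0" "\<And>n. a n \<le> b n + r/2" using assms(2)[of "r/2"] by auto
  obtain N where N: "\<And>n. n \<ge> N \<Longrightarrow> norm (b n - 0) < r/2" using LIMSEQ_D[OF b(1), of "r/2"] r by auto
  have "norm (a n - 0) < r" if "n \<ge> N" for n
    using N[OF that] b(2)[of n] assms(1)[of n] by simp
  then show "\<exists>N. \<forall>n\<ge>N. norm (a n - 0) < r" by blast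
qed

text \<open>
  For open sets \<open>1\<^sub>U\<close> is lower semicontinuous, so the positive part of \<open>1\<^sub>U - 1\<^sub>U(\<cdot> + c)\<close> tends to
  \<open>0\<close> pointwise; the negative part has the same integral.
\<close>

lemma translation_continuous_open:
  fixes U :: "'a::euclidean_space set"
  assumes U: "open U" "emeasure lborel U < \<infinity>" and c: "c \<longlonglongrightarrow> 0"
  shows "(\<lambda>n::nat. \<integral>x. \<bar>indicator U (x + c n) - indicator U x :: real\<bar> \<partial>lborel) \<longlonglongrightarrow> 0"
proof -
  have [measurable]: "U \<in> sets borel" using U by simp
  have iU: "integrable lborel (indicator U :: 'a \<Rightarrow> real)"
    using U by (intro integrable_real_indicator) auto
  note iUc = integrable_lborel_translate[OF iU]
  define P where "P n x = max 0 (indicator U x - indicator U (x + c n) :: real)" for n x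
  have P_int: "integrable lborel (P n)" for n
    unfolding P_def[abs_def] using iU iUc by auto
  have "(\<integral>x. \<bar>indicator U (x + c n) - indicator U x :: real\<bar> \<partial>lborel) = 2 * (\<integral>x. P n x \<partial>lborel)" for n
  proof -
    have "(\<integral>x. \<bar>indicator U (x + c n) - indicator U x :: real\<bar> \<partial>lborel)
        = (\<integral>x. (indicator U (x + c n) - indicator U x) + 2 * P n x \<partial>lborel)"
      by (rule Bochner_Integration.integral_cong) (auto simp: P_def indicator_def)
    also have "\<dots> = (\<integral>x. indicator U (x + c n) \<partial>lborel) - (\<integral>x. indicator U x \<partial>lborel) + 2 * (\<integral>x. P n x \<partial>lborel)"
      using iU iUc P_int by simp
    also have "(\<integral>x. indicator U (x + c n) \<partial>lborel) = (\<integral>x. (indicator U x :: real) \<partial>lborel)"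
      by (rule integral_lborel_translate) simp
    finally show ?thesis by simp
  qed
  moreover have "(\<lambda>n. \<integral>x. P n x \<partial>lborel) \<longlonglongrightarrow> (\<integral>x. 0 \<partial>(lborel :: 'a measure))"
  proof (rule integral_dominated_convergence[where w = "indicator U"])
    show "AE x in lborel. (\<lambda>n. P n x) \<longlonglongrightarrow> 0"
    proof (rule AE_I2)
      fix x :: 'a
      show "(\<lambda>n. P n x) \<longlonglongrightarrow> 0"
      proof (cases "x \<in> U")
        case True
        have "(\<lambda>n. x + c n) \<longlonglongrightarrow> x" using tendsto_add[OF tendsto_const c, of x] by simp
        then have "\<forall>\<^sub>F n in sequentially. x + c n \<in> U"
          using U(1) True by (rule topological_tendstoD)
        then have "\<forall>\<^sub>F n in sequentially. P n x = 0"
          by eventually_elim (simp add: P_def True)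
        then show ?thesis by (rule tendsto_eventually)
      qed (simp add: P_def)
    qed
  qed (use iU P_int in \<open>auto simp: P_def indicator_def\<close>)
  ultimately show ?thesis using tendsto_mult_right_zero[of "\<lambda>n. \<integral>x. P n x \<partial>lborel" sequentially 2] by simp
qed

text \<open>Outer regularity replaces \<open>A\<close> by an open \<open>U\<close>. The excess
  \<open>U - A\<close> enters twice, once translated, and translation preserves its measure, hence
  the tolerance \<open>e/2\<close>.\<close>

lemma translation_continuous_indicator:
  fixes A :: "'a::euclidean_space set"
  assumes A: "A \<in> sets borel" "emeasure lborel A < \<infinity>" and c: "c \<longlonglongrightarrow> 0"
  shows "(\<lambda>n::nat. \<integral>x. \<bar>indicator A (x + c n) - indicator A x :: real\<bar> \<partial>lborel) \<longlonglongrightarrow> 0"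
proof (rule tendsto_0_approx)
  fix e :: real assume e: "e > 0"
  obtain U where U: "open U" "A \<subseteq> U" "emeasure lborel (U - A) < ennreal (e/2)"
    using outer_regular_lborel[OF A(1), of "e/2"] e by auto
  have [measurable]: "U \<in> sets borel" "A \<in> sets borel" using U A by auto
  have fin: "emeasure lborel (U - A) < \<infinity>" using U(3) by (simp add: less_top[symmetric]) (metis top.extremum_strict)
  have "emeasure lborel U \<le> emeasure lborel A + emeasure lborel (U - A)"
    using emeasure_subadditive[of A lborel "U - A"] U(2) by (simp add: Un_absorb1)
  also have "\<dots> < \<infinity>" using fin A(2) by (simp add: ennreal_add_less_top)
  finally have fU: "emeasure lborel U < \<infinity>" .
  define b where "b n = (\<integral>x. \<bar>indicator U (x + c n) - indicator U x :: real\<bar> \<partial>lborel)" for n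
  have "b \<longlonglongrightarrow> 0" unfolding b_def by (rule translation_continuous_open[OF U(1) fU c])
  moreover have "(\<integral>x. \<bar>indicator A (x + c n) - indicator A x :: real\<bar> \<partial>lborel) \<le> b n + e" for n
  proof -
    have iA: "integrable lborel (indicator A :: 'a \<Rightarrow> real)"
      and iU: "integrable lborel (indicator U :: 'a \<Rightarrow> real)"
      and iD: "integrable lborel (indicator (U - A) :: 'a \<Rightarrow> real)"
      using A fU fin by (auto intro!: integrable_real_indicator)
    note tr = integrable_lborel_translate[OF iA, of "c n"] integrable_lborel_translate[OF iU, of "c n"]
      integrable_lborel_translate[OF iD, of "c n"]
    have "(\<integral>x. \<bar>indicator A (x + c n) - indicator A x :: real\<bar> \<partial>lborel) \<le>
      (\<integral>x. \<bar>indicator U (x + c n) - indicator U x\<bar> + (indicator (U - A) (x + c n) + indicator (U - A) x) \<partial>lborel)"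
    proof (rule integral_mono)
      fix x
      show "\<bar>indicator A (x + c n) - indicator A x :: real\<bar> \<le>
        \<bar>indicator U (x + c n) - indicator U x\<bar> + (indicator (U - A) (x + c n) + indicator (U - A) x)"
        using U(2) by (auto simp: indicator_def)
    qed (use iA iU iD tr in auto)
    also have "\<dots> = b n + ((\<integral>x. indicator (U - A) (x + c n) \<partial>lborel) + (\<integral>x. indicator (U - A) x \<partial>lborel))"
      unfolding b_def using iU iD tr by simp
    also have "(\<integral>x. indicator (U - A) (x + c n) \<partial>lborel) = (\<integral>x. (indicator (U - A) x :: real) \<partial>lborel)"
      by (rule integral_lborel_translate) simp
    also have "(\<integral>x. (indicator (U - A) x :: real) \<partial>lborel) = measure lborel (U - A)"
      by simp
    also have "measure lborel (U - A) \<le> e/2"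
      using U(3) fin e by (simp add: emeasure_eq_ennreal_measure less_top[symmetric] ennreal_less_iff less_imp_le)
    finally show ?thesis by simp
  qed
  ultimately show "\<exists>b. b \<longlonglongrightarrow> 0 \<and> (\<forall>n. (\<integral>x. \<bar>indicator A (x + c n) - indicator A x :: real\<bar> \<partial>lborel) \<le> b n + e)"
    by blast
qed simp

lemma translation_continuous_L1:
  fixes f :: "'a::euclidean_space \<Rightarrow> 'b::euclidean_space"
  assumes "integrable lborel f" and "c \<longlonglongrightarrow> 0"
  shows "(\<lambda>n::nat. \<integral>x. norm (f (x + c n) - f x) \<partial>lborel) \<longlonglongrightarrow> 0"
  using assms(1)
proof (induction rule: integrable_induct)
  case (base A v)
  have "(\<lambda>n::nat. (\<integral>x. \<bar>indicator A (x + c n) - indicator A x :: real\<bar> \<partial>lborel) * norm v) \<longlonglongrightarrow> 0"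
    by (rule tendsto_mult_left_zero, rule translation_continuous_indicator) (use base assms(2) in auto)
  then show ?case by (simp flip: scaleR_diff_left)
next
  case (add f g)
  note tr = add.hyps[THEN integrable_lborel_translate]
  show ?case
  proof (rule tendsto_sandwich[OF _ _ tendsto_const])
    show "(\<lambda>n. (\<integral>x. norm (f (x + c n) - f x) \<partial>lborel) + (\<integral>x. norm (g (x + c n) - g x) \<partial>lborel)) \<longlonglongrightarrow> 0"
      using tendsto_add[OF add.IH] by simp
    have "(\<integral>x. norm (f (x + c n) + g (x + c n) - (f x + g x)) \<partial>lborel)
      \<le> (\<integral>x. norm (f (x + c n) - f x) + norm (g (x + c n) - g x) \<partial>lborel)" for n
      by (rule integral_mono)
         (use add.hyps tr in \<open>auto simp: norm_diff_triangle_ineq\<close>)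
    then show "\<forall>\<^sub>F n in sequentially. (\<integral>x. norm (f (x + c n) + g (x + c n) - (f x + g x)) \<partial>lborel)
      \<le> (\<integral>x. norm (f (x + c n) - f x) \<partial>lborel) + (\<integral>x. norm (g (x + c n) - g x) \<partial>lborel)"
      using add.hyps tr by simp
  qed simp
next
  case (lim f s)
  note trf = lim.hyps(4)[THEN integrable_lborel_translate] and trs = lim.hyps(1)[THEN integrable_lborel_translate]
  \<comment> \<open>The approximants satisfy \<open>norm (s i x) \<le> 2 * norm (f x)\<close>,
    whence the factor 3 in the dominating function.\<close>
  have conv: "(\<lambda>i. \<integral>x. norm (f x - s i x) \<partial>lborel) \<longlonglongrightarrow> (\<integral>x. 0 \<partial>(lborel :: 'a measure))"
  proof (rule integral_dominated_convergence[where w = "\<lambda>x. 3 * norm (f x)"])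
    show "AE x in lborel. (\<lambda>i. norm (f x - s i x)) \<longlonglongrightarrow> 0"
    proof (rule AE_I2)
      fix x :: 'a
      have "(\<lambda>i. f x - s i x) \<longlonglongrightarrow> f x - f x" using lim.hyps(2)[of x] by (intro tendsto_intros) auto
      then show "(\<lambda>i. norm (f x - s i x)) \<longlonglongrightarrow> 0" by (simp add: tendsto_norm_zero)
    qed
    show "AE x in lborel. norm (norm (f x - s i x)) \<le> 3 * norm (f x)" for i
    proof (rule AE_I2)
      fix x :: 'a
      show "norm (norm (f x - s i x)) \<le> 3 * norm (f x)"
        using lim.hyps(3)[of x i] norm_triangle_ineq4[of "f x" "s i x"] by simp
    qed
  qed (use lim.hyps in auto)
  show ?case
  proof (rule tendsto_0_approx)
    fix e :: real assume e: "e > 0"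
    have "\<forall>\<^sub>F i in sequentially. (\<integral>x. norm (f x - s i x) \<partial>lborel) < e/2"
      by (rule order_tendstoD(2)[OF conv]) (use e in simp)
    then obtain i where i: "(\<integral>x. norm (f x - s i x) \<partial>lborel) < e/2"
      using eventually_happens'[OF sequentially_bot] by blast
    have split3: "norm (u + v - w) \<le> norm u + (norm v + norm w)" for u v w :: 'b
      using norm_triangle_ineq4[of "u + v" w] norm_triangle_ineq[of u v] by linarith
    have "(\<integral>x. norm (f (x + c n) - f x) \<partial>lborel) \<le> (\<integral>x. norm (s i (x + c n) - s i x) \<partial>lborel) + e" for n
    proof -
      have "(\<integral>x. norm (f (x + c n) - f x) \<partial>lborel) \<le>
        (\<integral>x. norm (s i (x + c n) - s i x) + (norm (f (x + c n) - s i (x + c n)) + norm (f x - s i x)) \<partial>lborel)"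
      proof (rule integral_mono)
        fix x
        show "norm (f (x + c n) - f x) \<le>
            norm (s i (x + c n) - s i x) + (norm (f (x + c n) - s i (x + c n)) + norm (f x - s i x))"
        proof -
          have "f (x + c n) - f x = (s i (x + c n) - s i x) + (f (x + c n) - s i (x + c n)) - (f x - s i x)"
            by simp
          then show ?thesis by (simp only: split3)
        qed
      qed (use lim.hyps(1,4) trf trs in auto)
      also have "\<dots> = (\<integral>x. norm (s i (x + c n) - s i x) \<partial>lborel) +
          ((\<integral>x. norm (f (x + c n) - s i (x + c n)) \<partial>lborel) + (\<integral>x. norm (f x - s i x) \<partial>lborel))"
        using lim.hyps(1,4) trf trs by simp
      also have "(\<integral>x. norm (f (x + c n) - s i (x + c n)) \<partial>lborel) = (\<integral>x. norm (f x - s i x) \<partial>lborel)"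
        by (rule integral_lborel_translate[of "\<lambda>x. norm (f x - s i x)"]) (use lim.hyps(1,4) in auto)
      finally show ?thesis using i by simp
    qed
    then show "\<exists>b. b \<longlonglongrightarrow> 0 \<and> (\<forall>n. (\<integral>x. norm (f (x + c n) - f x) \<partial>lborel) \<le> b n + e)"
      using lim.IH by blast
  qed simp
qed

text \<open>A quantitative monotonicity of the map u -> |u| u. With p = |u| and q = |v|, twice the
  inner product of p u - q v with u - v equals (p + q) (|u - v|^2 + (p - q)^2). Drop the last
  square, use |u - v| \<le> p + q and Cauchy-Schwarz, and cancel |u - v|.\<close>

lemma norm_diff_sq_le:
  fixes u v :: "'b::euclidean_space"
  shows "(norm (u - v))\<^sup>2 \<le> 2 * norm (norm u *\<^sub>R u - norm v *\<^sub>R v)"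
proof (cases "u = v")
  case False
  define p q where "p = norm u" and "q = norm v"
  have pq: "p \<ge> 0" "q \<ge> 0" "p\<^sup>2 = u \<bullet> u" "q\<^sup>2 = v \<bullet> v"
    by (simp_all add: p_def q_def power2_norm_eq_inner)
  have d: "(norm (u - v))\<^sup>2 = p\<^sup>2 + q\<^sup>2 - 2 * (u \<bullet> v)"
    by (simp add: power2_norm_eq_inner inner_simps inner_commute p_def q_def)
  have "(norm (u - v))\<^sup>2 * norm (u - v) \<le> (norm (u - v))\<^sup>2 * (p + q)"
    unfolding p_def q_def by (intro mult_left_mono norm_triangle_ineq4) simp
  also have "\<dots> \<le> (norm (u - v))\<^sup>2 * (p + q) + (p - q)\<^sup>2 * (p + q)"
    using pq by simp
  also have "\<dots> = 2 * ((p *\<^sub>R u - q *\<^sub>R v) \<bullet> (u - v))"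
    unfolding d by (simp add: inner_simps inner_commute flip: pq(3,4)) (simp add: algebra_simps power2_eq_square)
  also have "\<dots> \<le> 2 * (norm (p *\<^sub>R u - q *\<^sub>R v) * norm (u - v))"
    using norm_cauchy_schwarz[of "p *\<^sub>R u - q *\<^sub>R v" "u - v"] by simp
  finally have "(norm (u - v))\<^sup>2 * norm (u - v) \<le> (2 * norm (p *\<^sub>R u - q *\<^sub>R v)) * norm (u - v)"
    by simp
  then show ?thesis using False by (simp add: p_def q_def)
qed simp

lemma sq_integrable_translate:
  fixes f :: "'a::euclidean_space \<Rightarrow> 'b::euclidean_space"
  assumes "sq_integrable lborel f"
  shows "sq_integrable lborel (\<lambda>x. f (x + c))"
proof -
  have [measurable]: "f \<in> borel_measurable borel" using assms by (simp add: sq_integrable_def)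
  show ?thesis
    using assms integrable_lborel_translate[of "\<lambda>x. (norm (f x))\<^sup>2" c] by (simp add: sq_integrable_def)
qed

lemma sq_norm_translate:
  fixes f :: "'a::euclidean_space \<Rightarrow> 'b::euclidean_space"
  assumes "f \<in> borel_measurable borel"
  shows "sq_norm lborel (\<lambda>x. f (x + c)) = sq_norm lborel f"
  unfolding sq_norm_def by (rule integral_lborel_translate) (use assms in measurable)

text \<open>
  The \<open>L\<^sup>2\<close> statement follows from the \<open>L\<^sup>1\<close> one for the integrable function \<open>\<bar>f\<bar> f\<close>.
\<close>

lemma translation_continuous_L2:
  fixes f :: "'a::euclidean_space \<Rightarrow> 'b::euclidean_space"
  assumes f: "sq_integrable lborel f" and c: "c \<longlonglongrightarrow> 0"
  shows "(\<lambda>n::nat. sq_norm lborel (\<lambda>x. f (x + c n) - f x)) \<longlonglongrightarrow> 0"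
proof (rule tendsto_sandwich[OF _ _ tendsto_const])
  define g where "g x = norm (f x) *\<^sub>R f x" for x
  have [measurable]: "f \<in> borel_measurable borel" using f by (simp add: sq_integrable_def)
  have [measurable]: "g \<in> borel_measurable borel" unfolding g_def[abs_def] by measurable
  have g: "integrable lborel g"
    by (rule Bochner_Integration.integrable_bound[of _ "\<lambda>x. (norm (f x))\<^sup>2"])
       (use f in \<open>auto simp: sq_integrable_def g_def power2_eq_square\<close>)
  show "(\<lambda>n. 2 * (\<integral>x. norm (g (x + c n) - g x) \<partial>lborel)) \<longlonglongrightarrow> 0"
    by (rule tendsto_mult_right_zero, rule translation_continuous_L1[OF g c])
  have "sq_norm lborel (\<lambda>x. f (x + c n) - f x) \<le> (\<integral>x. 2 * norm (g (x + c n) - g x) \<partial>lborel)" for n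
    unfolding sq_norm_def
  proof (rule integral_mono)
    show "integrable lborel (\<lambda>x. (norm (f (x + c n) - f x))\<^sup>2)"
      using sq_integrable_diff[OF sq_integrable_translate[OF f] f] by (simp add: sq_integrable_def)
    show "integrable lborel (\<lambda>x. 2 * norm (g (x + c n) - g x))"
      using g integrable_lborel_translate[OF g] by auto
  qed (simp add: g_def norm_diff_sq_le)
  then show "\<forall>\<^sub>F n in sequentially. sq_norm lborel (\<lambda>x. f (x + c n) - f x)
      \<le> 2 * (\<integral>x. norm (g (x + c n) - g x) \<partial>lborel)"
    by simp
qed simp

text \<open>Later estimates have to hold for all lags in an interval at once, hence the
  epsilon-delta form; a counterexample for each \<open>1 / Suc n\<close> would contradict the
  sequential statement.\<close>

lemma translation_continuous_L2_eps:
  fixes f :: "'a::euclidean_space \<Rightarrow> 'b::euclidean_space"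
  assumes f: "sq_integrable lborel f" and e: "e > 0"
  shows "\<exists>d>0. \<forall>c. norm c < d \<longrightarrow> sqrt (sq_norm lborel (\<lambda>x. f (x + c) - f x)) < e"
proof (rule ccontr)
  assume neg: "\<not> ?thesis"
  have "\<exists>c. norm c < 1 / real (Suc n) \<and> \<not> sqrt (sq_norm lborel (\<lambda>x. f (x + c) - f x)) < e" for n
  proof -
    have "0 < 1 / real (Suc n)" by simp
    with neg show ?thesis by blast
  qed
  then obtain c where c: "\<And>n. norm (c n) < 1 / real (Suc n)"
    "\<And>n. \<not> sqrt (sq_norm lborel (\<lambda>x. f (x + c n) - f x)) < e" by metis
  have "c \<longlonglongrightarrow> 0"
    by (rule tendsto_0_le[OF LIMSEQ_inverse_real_of_nat, where K = 1])
       (use c(1) in \<open>auto intro!: always_eventually less_imp_le simp: inverse_eq_divide\<close>)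
  from tendsto_real_sqrt[OF translation_continuous_L2[OF f this]]
  have "\<forall>\<^sub>F n in sequentially. sqrt (sq_norm lborel (\<lambda>x. f (x + c n) - f x)) < e"
    by (intro order_tendstoD(2)[where y = 0]) (use e in auto)
  then show False using c(2) by simp
qed

section \<open>The weighted energy inequality\<close>

lemma sq_integrable_time_const:
  fixes w :: "'a::euclidean_space \<Rightarrow> 'e::euclidean_space"
  assumes w: "sq_integrable lborel w" and A: "A \<in> sets borel" "emeasure lborel A < \<infinity>"
  shows "sq_integrable lborel (\<lambda>z::'a \<times> real. indicator A (snd z) *\<^sub>R w (fst z))"
proof -
  note [measurable] = A(1)
  have [measurable]: "w \<in> borel_measurable borel" using w by (simp add: sq_integrable_def)
  have m: "(\<lambda>z::'a \<times> real. indicator A (snd z) *\<^sub>R w (fst z)) \<in> borel_measurable (lborel \<Otimes>\<^sub>M lborel)"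
    by measurable
  have iw: "integrable lborel (\<lambda>x. (norm (w x))\<^sup>2)" using w by (simp add: sq_integrable_def)
  have iA: "integrable lborel (indicator A :: real \<Rightarrow> real)"
    using A by (auto intro!: integrable_real_indicator)
  have "integrable (lborel \<Otimes>\<^sub>M lborel) (\<lambda>z::'a \<times> real. (norm (w (fst z)))\<^sup>2 * indicator A (snd z))"
  proof (rule lborel_pair.Fubini_integrable)
    show "integrable lborel (\<lambda>x. \<integral>y. norm ((norm (w (fst (x, y))))\<^sup>2 * indicator A (snd (x, y))) \<partial>lborel)"
      using iw by (simp add: abs_mult)
  qed (use iA in auto)
  moreover have "(norm (indicator A (snd z) *\<^sub>R w (fst z)))\<^sup>2 = (norm (w (fst z)))\<^sup>2 * indicator A (snd z)" for z :: "'a \<times> real"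
    by (auto simp: indicator_def)
  ultimately show ?thesis
    using m by (simp add: sq_integrable_def lborel_prod)
qed

lemma sq_integrable_slice:
  fixes W :: "'a::euclidean_space \<times> real \<Rightarrow> 'e::euclidean_space"
  assumes "sq_integrable lborel W"
  shows "AE t in lborel. sq_integrable lborel (\<lambda>x. W (x, t))"
    and "integrable lborel (\<lambda>t. sq_norm lborel (\<lambda>x. W (x, t)))"
    and "(\<integral>t. sq_norm lborel (\<lambda>x. W (x, t)) \<partial>lborel) = sq_norm lborel W"
proof -
  have [measurable]: "W \<in> borel_measurable borel" using assms by (simp add: sq_integrable_def)
  have i: "integrable (lborel \<Otimes>\<^sub>M lborel) (\<lambda>(x, t). (norm (W (x, t)))\<^sup>2)"
    using assms by (simp add: sq_integrable_def lborel_prod case_prod_beta')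
  show "AE t in lborel. sq_integrable lborel (\<lambda>x. W (x, t))"
    using lborel_pair.AE_integrable_snd[OF i] by eventually_elim (simp add: sq_integrable_def)
  show "integrable lborel (\<lambda>t. sq_norm lborel (\<lambda>x. W (x, t)))"
    using lborel_pair.integrable_snd[OF i] by (simp add: sq_norm_def)
  show "(\<integral>t. sq_norm lborel (\<lambda>x. W (x, t)) \<partial>lborel) = sq_norm lborel W"
    using lborel_pair.integral_snd[OF i] by (simp add: sq_norm_def lborel_prod case_prod_beta')
qed

text \<open>Substitution \<open>s = t - \<sigma>\<close>, with \<open>(x, s)\<close> and \<open>(x, t)\<close> the integration variables \<open>z\<close> and \<open>p\<close>.\<close>

lemma delayed_integral_swap:
  fixes \<Phi> W :: "'a::euclidean_space \<times> real \<Rightarrow> 'e::euclidean_space" and \<theta> :: "real \<Rightarrow> real"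
  assumes \<Phi>: "sq_integrable lborel \<Phi>" and W: "sq_integrable lborel W"
    and \<theta>: "\<theta> \<in> borel_measurable borel" "\<And>t. \<bar>\<theta> t\<bar> \<le> 1"
  shows "(\<integral>t. \<theta> t * (\<integral>z. indicator {t-h..<t} (snd z) * (\<Phi> z \<bullet> W (fst z, t)) \<partial>lborel) \<partial>lborel)
    = (\<integral>\<sigma>. indicator {0<..h} \<sigma> * (\<integral>p. \<theta> (snd p) * (\<Phi> (p - (0, \<sigma>)) \<bullet> W p) \<partial>lborel) \<partial>lborel)"
    (is "?L = ?R")
    and "(\<lambda>t. \<theta> t * (\<integral>z. indicator {t-h..<t} (snd z) * (\<Phi> z \<bullet> W (fst z, t)) \<partial>lborel)) \<in> borel_measurable lborel"
    and "integrable lborel (\<lambda>\<sigma>. indicator {0<..h} \<sigma> * (\<integral>p. \<theta> (snd p) * (\<Phi> (p - (0, \<sigma>)) \<bullet> W p) \<partial>lborel))"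
proof -
  note [measurable] = \<theta>(1)
  have [measurable]: "\<Phi> \<in> borel_measurable borel" "W \<in> borel_measurable borel"
    using \<Phi> W by (auto simp: sq_integrable_def)
  define K where "K \<sigma> p = indicator {0<..h} \<sigma> * (\<theta> (snd p) * (\<Phi> (p - (0, \<sigma>)) \<bullet> W p))" for \<sigma> :: real and p
  have fin: "emeasure lborel {a<..b} < \<infinity>" "emeasure lborel {a..<b} < \<infinity>" for a b :: real
  proof -
    have "bounded {a<..b}" "bounded {a..<b}"
      using bounded_subset[OF bounded_cbox[of a b]] by auto
    then show "emeasure lborel {a<..b} < \<infinity>" "emeasure lborel {a..<b} < \<infinity>"
      by (simp_all add: emeasure_bounded_finite[unfolded infinity_ennreal_def])
  qed
  have Km: "case_prod K \<in> borel_measurable (lborel \<Otimes>\<^sub>M lborel)"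
  proof -
    have [measurable]: "(\<lambda>x::real \<times> ('a \<times> real). snd x - (0, fst x)) \<in> borel_measurable (lborel \<Otimes>\<^sub>M lborel)"
      by (intro borel_measurable_diff borel_measurable_Pair) auto
    have [measurable]: "(\<lambda>x::real \<times> ('a \<times> real). \<Phi> (snd x - (0, fst x))) \<in> borel_measurable (lborel \<Otimes>\<^sub>M lborel)"
      by measurable
    have [measurable]: "(\<lambda>x::real \<times> ('a \<times> real). \<theta> (snd (snd x))) \<in> borel_measurable (lborel \<Otimes>\<^sub>M lborel)"
      by (rule measurable_compose[OF _ \<theta>(1)]) (auto intro!: borel_measurable_continuous_onI continuous_intros simp: lborel_prod)
    show ?thesis
      unfolding K_def[abs_def] case_prod_beta' by measurable
  qed
  have shift: "p - (0, \<sigma>) = p + (0, - \<sigma>)" for p :: "'a \<times> real" and \<sigma>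
    by (cases p) simp
  have \<Phi>s: "sq_integrable lborel (\<lambda>p. \<Phi> (p - (0, \<sigma>)))" for \<sigma>
    using sq_integrable_translate[OF \<Phi>, of "(0, - \<sigma>)"] by (simp only: shift)
  have \<theta>W: "sq_integrable lborel (\<lambda>p. \<theta> (snd p) *\<^sub>R W p)"
  proof (rule sq_integrable_bound[OF W, where C = 1])
    have [measurable]: "(\<lambda>p::'a \<times> real. \<theta> (snd p)) \<in> borel_measurable borel"
      by (rule measurable_compose[OF _ \<theta>(1)]) (auto intro!: borel_measurable_continuous_onI continuous_intros)
    show "(\<lambda>p. \<theta> (snd p) *\<^sub>R W p) \<in> borel_measurable lborel" by measurable
    show "AE p in lborel. norm (\<theta> (snd p) *\<^sub>R W p) \<le> 1 * norm (W p)"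
      using mult_right_mono[OF \<theta>(2) norm_ge_zero] by (intro AE_I2) simp
  qed
  have Ki: "integrable lborel (K \<sigma>)" for \<sigma>
    unfolding K_def using sq_integrable_inner[OF \<Phi>s[of \<sigma>] \<theta>W] by simp
  \<comment> \<open>Translation invariance makes the bound independent of \<sigma>, so it is
    integrable over the bounded set of lags and Fubini applies.\<close>
  have Kb: "(\<integral>p. norm (K \<sigma> p) \<partial>lborel) \<le> indicator {0<..h} \<sigma> * (sq_norm lborel \<Phi> + sq_norm lborel W)" for \<sigma>
  proof -
    have "(\<integral>p. norm (K \<sigma> p) \<partial>lborel) \<le>
        (\<integral>p. indicator {0<..h} \<sigma> * ((norm (\<Phi> (p - (0, \<sigma>))))\<^sup>2 + (norm (W p))\<^sup>2) \<partial>lborel)"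
    proof (rule integral_mono)
      fix p :: "'a \<times> real"
      have "\<bar>\<Phi> (p - (0, \<sigma>)) \<bullet> W p\<bar> \<le> norm (\<Phi> (p - (0, \<sigma>))) * norm (W p)"
        by (rule Cauchy_Schwarz_ineq2)
      also have "\<dots> \<le> (norm (\<Phi> (p - (0, \<sigma>))))\<^sup>2 + (norm (W p))\<^sup>2"
        using sum_squares_bound[of "norm (\<Phi> (p - (0, \<sigma>)))" "norm (W p)"]
          mult_nonneg_nonneg[OF norm_ge_zero norm_ge_zero, of "\<Phi> (p - (0, \<sigma>))" "W p"] by linarith
      finally have "\<bar>\<theta> (snd p)\<bar> * \<bar>\<Phi> (p - (0, \<sigma>)) \<bullet> W p\<bar> \<le> 1 * ((norm (\<Phi> (p - (0, \<sigma>))))\<^sup>2 + (norm (W p))\<^sup>2)"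
        by (intro mult_mono \<theta>(2)) auto
      then show "norm (K \<sigma> p) \<le> indicator {0<..h} \<sigma> * ((norm (\<Phi> (p - (0, \<sigma>))))\<^sup>2 + (norm (W p))\<^sup>2)"
        by (auto simp: K_def abs_mult indicator_def)
    qed (use Ki \<Phi>s W in \<open>auto simp: sq_integrable_def\<close>)
    also have "\<dots> = indicator {0<..h} \<sigma> * (sq_norm lborel (\<lambda>p. \<Phi> (p - (0, \<sigma>))) + sq_norm lborel W)"
      using \<Phi>s W by (simp add: sq_integrable_def sq_norm_def)
    also have "sq_norm lborel (\<lambda>p. \<Phi> (p - (0, \<sigma>))) = sq_norm lborel \<Phi>"
      using sq_norm_translate[of \<Phi> "(0, - \<sigma>)"] by (simp add: shift)
    finally show ?thesis .
  qed
  have int: "integrable (lborel \<Otimes>\<^sub>M lborel) (case_prod K)"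
  proof (rule lborel_pair.Fubini_integrable[OF Km])
    show "integrable lborel (\<lambda>\<sigma>. \<integral>p. norm (case_prod K (\<sigma>, p)) \<partial>lborel)"
    proof (rule Bochner_Integration.integrable_bound)
      show "integrable lborel (\<lambda>\<sigma>. indicator {0<..h} \<sigma> * (sq_norm lborel \<Phi> + sq_norm lborel W))"
        by (intro integrable_mult_left integrable_real_indicator) (use fin in auto)
      show "(\<lambda>\<sigma>. \<integral>p. norm (case_prod K (\<sigma>, p)) \<partial>lborel) \<in> borel_measurable lborel"
        using Km by measurable
    qed (use Kb in \<open>auto intro: order_trans\<close>)
  qed (use Ki in auto)
  show "integrable lborel (\<lambda>\<sigma>. indicator {0<..h} \<sigma> * (\<integral>p. \<theta> (snd p) * (\<Phi> (p - (0, \<sigma>)) \<bullet> W p) \<partial>lborel))"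
    using lborel_pair.integrable_fst[OF int] by (simp add: K_def)
  show mL: "(\<lambda>t. \<theta> t * (\<integral>z. indicator {t-h..<t} (snd z) * (\<Phi> z \<bullet> W (fst z, t)) \<partial>lborel)) \<in> borel_measurable lborel"
  proof -
    have "(\<lambda>(t, z). indicator {t-h..<t} (snd z) * (\<Phi> z \<bullet> W (fst z, t))) =
       (\<lambda>(t, z::'a \<times> real). (if t - h \<le> snd z \<and> snd z < t then 1 else 0) * (\<Phi> z \<bullet> W (fst z, t)))"
      by (auto simp: indicator_def)
    moreover have c: "f \<in> borel_measurable (lborel \<Otimes>\<^sub>M lborel)"
      if "continuous_on UNIV f" for f :: "real \<times> ('a \<times> real) \<Rightarrow> 'z::topological_space"
      using borel_measurable_continuous_onI[OF that] by (simp add: lborel_prod)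
    have [measurable]: "(\<lambda>x::real \<times> ('a \<times> real). snd (snd x)) \<in> borel_measurable (lborel \<Otimes>\<^sub>M lborel)"
      "(\<lambda>x::real \<times> ('a \<times> real). fst x) \<in> borel_measurable (lborel \<Otimes>\<^sub>M lborel)"
      by (intro c continuous_intros)+
    have [measurable]: "(\<lambda>x::real \<times> ('a \<times> real). \<Phi> (snd x)) \<in> borel_measurable (lborel \<Otimes>\<^sub>M lborel)"
      by (rule measurable_compose[of snd _ borel \<Phi> borel]) (auto intro!: c continuous_intros)
    have [measurable]: "(\<lambda>x::real \<times> ('a \<times> real). W (fst (snd x), fst x)) \<in> borel_measurable (lborel \<Otimes>\<^sub>M lborel)"
      by (rule measurable_compose[of "\<lambda>x. (fst (snd x), fst x)" _ borel W borel]) (auto intro!: c continuous_intros)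
    ultimately have [measurable]: "(\<lambda>(t, z). indicator {t-h..<t} (snd z) * (\<Phi> z \<bullet> W (fst z, t))) \<in> borel_measurable (lborel \<Otimes>\<^sub>M lborel)"
      by (simp add: case_prod_beta')
    show ?thesis by measurable
  qed
  have refl: "(\<integral>\<sigma>. K \<sigma> (x, t) \<partial>lborel) = (\<integral>s. \<theta> t * (indicator {t-h..<t} s * (\<Phi> (x, s) \<bullet> W (x, t))) \<partial>lborel)" for x t
  proof -
    have "(\<integral>\<sigma>. K \<sigma> (x, t) \<partial>lborel) = (\<integral>s. K (t + (-1) * s) (x, t) \<partial>lborel)"
      by (subst lborel_integral_real_affine[where c = "-1" and t = t]) simp_all
    also have "\<dots> = (\<integral>s. \<theta> t * (indicator {t-h..<t} s * (\<Phi> (x, s) \<bullet> W (x, t))) \<partial>lborel)"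
      by (rule Bochner_Integration.integral_cong) (auto simp: K_def indicator_def)
    finally show ?thesis .
  qed
  have int2: "integrable (lborel \<Otimes>\<^sub>M lborel) (\<lambda>(x, t). \<integral>\<sigma>. K \<sigma> (x, t) \<partial>lborel)"
    using lborel_pair.integrable_snd[OF int] by (simp add: lborel_prod case_prod_beta')
  have "?R = (\<integral>\<sigma>. \<integral>p. K \<sigma> p \<partial>lborel \<partial>lborel)" by (simp add: K_def)
  also have "\<dots> = (\<integral>p. \<integral>\<sigma>. K \<sigma> p \<partial>lborel \<partial>lborel)"
    by (rule lborel_pair.Fubini_integral[symmetric]) (rule int)
  also have "\<dots> = (\<integral>t. \<integral>x. \<integral>\<sigma>. K \<sigma> (x, t) \<partial>lborel \<partial>lborel \<partial>lborel)"
    using lborel_pair.integral_snd[OF int2] by (simp add: lborel_prod case_prod_beta')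
  also have "\<dots> = ?L"
  proof (rule integral_cong_AE)
    show "(\<lambda>t. \<integral>x. \<integral>\<sigma>. K \<sigma> (x, t) \<partial>lborel \<partial>lborel) \<in> borel_measurable lborel"
      using lborel_pair.integrable_snd[OF int2] by (rule borel_measurable_integrable)
    show "(\<lambda>t. \<theta> t * (\<integral>z. indicator {t-h..<t} (snd z) * (\<Phi> z \<bullet> W (fst z, t)) \<partial>lborel)) \<in> borel_measurable lborel"
      by (rule mL)
    \<comment> \<open>The iterated integral in x and s merges into one over \<open>z\<close> only
      when the slice of \<open>W\<close> at \<open>t\<close> is square integrable, that is, for
      almost every \<open>t\<close>.\<close>
    show "AE t in lborel. (\<integral>x. \<integral>\<sigma>. K \<sigma> (x, t) \<partial>lborel \<partial>lborel)
      = \<theta> t * (\<integral>z. indicator {t-h..<t} (snd z) * (\<Phi> z \<bullet> W (fst z, t)) \<partial>lborel)"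
      using sq_integrable_slice(1)[OF W]
    proof eventually_elim
      fix t assume "sq_integrable lborel (\<lambda>x. W (x, t))"
      from sq_integrable_inner[OF \<Phi> sq_integrable_time_const[OF this, of "{t-h..<t}"]] fin(2)
      have i: "integrable lborel (\<lambda>z. indicator {t-h..<t} (snd z) * (\<Phi> z \<bullet> W (fst z, t)))"
        by simp
      have "(\<integral>x. \<integral>\<sigma>. K \<sigma> (x, t) \<partial>lborel \<partial>lborel)
         = (\<integral>x. \<integral>s. \<theta> t * (indicator {t-h..<t} s * (\<Phi> (x, s) \<bullet> W (x, t))) \<partial>lborel \<partial>lborel)"
        by (simp only: refl)
      also have "\<dots> = (\<integral>z. \<theta> t * (indicator {t-h..<t} (snd z) * (\<Phi> z \<bullet> W (fst z, t))) \<partial>(lborel \<Otimes>\<^sub>M lborel))"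
        by (subst lborel_pair.integral_fst'[symmetric]) (use i in \<open>simp_all add: lborel_prod\<close>)
      finally show "(\<integral>x. \<integral>\<sigma>. K \<sigma> (x, t) \<partial>lborel \<partial>lborel)
        = \<theta> t * (\<integral>z. indicator {t-h..<t} (snd z) * (\<Phi> z \<bullet> W (fst z, t)) \<partial>lborel)"
        by (simp add: lborel_prod)
    qed
  qed
  finally show "?L = ?R" ..
qed

lemma sq_integrable_time_weight:
  fixes W :: "'a::euclidean_space \<times> real \<Rightarrow> 'e::euclidean_space" and \<theta> :: "real \<Rightarrow> real"
  assumes W: "sq_integrable lborel W"
    and \<theta>: "\<theta> \<in> borel_measurable borel" "\<And>t. \<bar>\<theta> t\<bar> \<le> 1"
  shows "sq_integrable lborel (\<lambda>p. \<theta> (snd p) *\<^sub>R W p)"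
    and "sq_norm lborel (\<lambda>p. \<theta> (snd p) *\<^sub>R W p) \<le> sq_norm lborel W"
proof -
  have [measurable]: "W \<in> borel_measurable borel" using W by (simp add: sq_integrable_def)
  have [measurable]: "(\<lambda>p::'a \<times> real. \<theta> (snd p)) \<in> borel_measurable borel"
    by (rule measurable_compose[OF _ \<theta>(1)]) (auto intro!: borel_measurable_continuous_onI continuous_intros)
  have le: "norm (\<theta> (snd p) *\<^sub>R W p) \<le> norm (W p)" for p
    using mult_right_mono[OF \<theta>(2) norm_ge_zero] by simp
  show i: "sq_integrable lborel (\<lambda>p. \<theta> (snd p) *\<^sub>R W p)"
    by (rule sq_integrable_bound[OF W, where C = 1]) (use le in auto)
  show "sq_norm lborel (\<lambda>p. \<theta> (snd p) *\<^sub>R W p) \<le> sq_norm lborel W"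
    unfolding sq_norm_def
    by (rule integral_mono) (use i W le in \<open>auto simp: sq_integrable_def intro!: power_mono simp del: norm_scaleR\<close>)
qed

text \<open>After \<open>delayed_integral_swap\<close> the left side is an integral over lags
  \<sigma> in (0, h] of weighted inner products in which \<Phi> is shifted by \<sigma> and one of
  the two copies of \<Psi> by \<open>h\<close>. Both shifts are small in L^2, so each inner product
  is close to twice the unshifted one, uniformly in \<sigma>, and integrating over the lags produces
  the factor \<open>h\<close>.\<close>

lemma delayed_inner_limit:
  fixes \<Phi> \<Psi> :: "'a::euclidean_space \<times> real \<Rightarrow> 'e::euclidean_space" and \<theta> :: "real \<Rightarrow> real"
  assumes \<Phi>: "sq_integrable lborel \<Phi>" and \<Psi>: "sq_integrable lborel \<Psi>"
    and \<theta>: "\<theta> \<in> borel_measurable borel" "\<And>t. \<bar>\<theta> t\<bar> \<le> 1" and e: "e > 0"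
  shows "\<exists>d>0. \<forall>h. 0 < h \<and> h < d \<longrightarrow>
    (\<integral>t. \<theta> t * (\<integral>z. indicator {t-h..<t} (snd z) * (\<Phi> z \<bullet> (\<Psi> (fst z, t) + \<Psi> (fst z, t - h))) \<partial>lborel) \<partial>lborel)
      \<le> h * (2 * (\<integral>p. \<theta> (snd p) * (\<Phi> p \<bullet> \<Psi> p) \<partial>lborel) + e)"
proof -
  define L where "L = 2 * (\<integral>p. \<theta> (snd p) * (\<Phi> p \<bullet> \<Psi> p) \<partial>lborel)"
  define F where "F = sqrt (sq_norm lborel \<Phi>)"
  define S where "S = sqrt (sq_norm lborel \<Psi>)"
  have FS: "F \<ge> 0" "S \<ge> 0" by (auto simp: F_def S_def)
  \<comment> \<open>Undoing the shift of \<Phi> costs at most \<open>e' * (2 * S)\<close>, because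
    \<open>W\<close> has norm at most \<open>2 * S\<close>; undoing that of \<Psi> costs at most
    \<open>F * e'\<close>. The \<open>+ 1\<close> keeps the denominator positive.\<close>
  define e' where "e' = e / (2 * S + F + 1)"
  have e': "e' > 0" "e' * (2 * S + F) \<le> e"
    using e FS by (auto simp: e'_def field_simps add_pos_nonneg)
  obtain d1 where d1: "d1 > 0" "\<And>c. norm c < d1 \<Longrightarrow> sqrt (sq_norm lborel (\<lambda>x. \<Phi> (x + c) - \<Phi> x)) < e'"
    using translation_continuous_L2_eps[OF \<Phi> e'(1)] by blast
  obtain d2 where d2: "d2 > 0" "\<And>c. norm c < d2 \<Longrightarrow> sqrt (sq_norm lborel (\<lambda>x. \<Psi> (x + c) - \<Psi> x)) < e'"
    using translation_continuous_L2_eps[OF \<Psi> e'(1)] by blast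
  have shift: "p - (0, \<sigma>) = p + (0, - \<sigma>)" for p :: "'a \<times> real" and \<sigma> by (cases p) simp
  have meas: "\<Psi> \<in> borel_measurable borel" using \<Psi> by (simp add: sq_integrable_def)
  have main: "(\<integral>t. \<theta> t * (\<integral>z. indicator {t-h..<t} (snd z) * (\<Phi> z \<bullet> (\<Psi> (fst z, t) + \<Psi> (fst z, t - h))) \<partial>lborel) \<partial>lborel)
      \<le> h * (L + e)" if h: "0 < h" "h < min d1 d2" for h
  proof -
    define \<Psi>h where "\<Psi>h p = \<Psi> (p + (0, - h))" for p
    have \<Psi>h: "sq_integrable lborel \<Psi>h" unfolding \<Psi>h_def[abs_def] by (rule sq_integrable_translate[OF \<Psi>])
    have n\<Psi>h: "sqrt (sq_norm lborel \<Psi>h) = S"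
      unfolding \<Psi>h_def[abs_def] S_def by (simp add: sq_norm_translate[OF meas])
    define W where "W p = \<Psi> p + \<Psi>h p" for p
    have W: "sq_integrable lborel W" unfolding W_def[abs_def] by (rule sq_integrable_add[OF \<Psi> \<Psi>h])
    have nW: "sqrt (sq_norm lborel W) \<le> 2 * S"
      using sq_norm_triangle[OF \<Psi> \<Psi>h] n\<Psi>h by (simp add: W_def[abs_def] S_def)
    define k where "k \<sigma> = (\<integral>p. \<theta> (snd p) * (\<Phi> (p - (0, \<sigma>)) \<bullet> W p) \<partial>lborel)" for \<sigma>
    have k: "k \<sigma> \<le> L + e" if \<sigma>: "0 < \<sigma>" "\<sigma> \<le> h" for \<sigma>
    proof -
      define \<Phi>s where "\<Phi>s p = \<Phi> (p + (0, - \<sigma>))" for p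
      have \<Phi>s: "sq_integrable lborel \<Phi>s" unfolding \<Phi>s_def[abs_def] by (rule sq_integrable_translate[OF \<Phi>])
      note wW = sq_integrable_time_weight[OF W \<theta>]
      note wD = sq_integrable_time_weight[OF sq_integrable_diff[OF \<Psi>h \<Psi>] \<theta>]
      have "k \<sigma> = (\<integral>p. \<Phi>s p \<bullet> (\<theta> (snd p) *\<^sub>R W p) \<partial>lborel)"
        by (simp add: k_def \<Phi>s_def shift)
      also have "\<dots> = (\<integral>p. (\<Phi>s p - \<Phi> p) \<bullet> (\<theta> (snd p) *\<^sub>R W p) + \<Phi> p \<bullet> (\<theta> (snd p) *\<^sub>R (\<Psi>h p - \<Psi> p))
            + 2 * (\<Phi> p \<bullet> (\<theta> (snd p) *\<^sub>R \<Psi> p)) \<partial>lborel)"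
        by (rule Bochner_Integration.integral_cong) (simp_all add: W_def inner_simps algebra_simps)
      also have "\<dots> = (\<integral>p. (\<Phi>s p - \<Phi> p) \<bullet> (\<theta> (snd p) *\<^sub>R W p) \<partial>lborel)
          + (\<integral>p. \<Phi> p \<bullet> (\<theta> (snd p) *\<^sub>R (\<Psi>h p - \<Psi> p)) \<partial>lborel)
          + (\<integral>p. 2 * (\<Phi> p \<bullet> (\<theta> (snd p) *\<^sub>R \<Psi> p)) \<partial>lborel)"
        using sq_integrable_inner[OF sq_integrable_diff[OF \<Phi>s \<Phi>] wW(1)]
          sq_integrable_inner[OF \<Phi> wD(1)] sq_integrable_inner[OF \<Phi> sq_integrable_time_weight(1)[OF \<Psi> \<theta>]]
        by (subst Bochner_Integration.integral_add integrable_add, auto)+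
      also have "(\<integral>p. 2 * (\<Phi> p \<bullet> (\<theta> (snd p) *\<^sub>R \<Psi> p)) \<partial>lborel) = L" by (simp add: L_def)
      also have "(\<integral>p. (\<Phi>s p - \<Phi> p) \<bullet> (\<theta> (snd p) *\<^sub>R W p) \<partial>lborel) \<le> e' * (2 * S)"
      proof -
        have "(\<integral>p. (\<Phi>s p - \<Phi> p) \<bullet> (\<theta> (snd p) *\<^sub>R W p) \<partial>lborel) \<le>
            sqrt (sq_norm lborel (\<lambda>p. \<Phi>s p - \<Phi> p)) * sqrt (sq_norm lborel (\<lambda>p. \<theta> (snd p) *\<^sub>R W p))"
          using sq_norm_Cauchy_Schwarz[OF sq_integrable_diff[OF \<Phi>s \<Phi>] wW(1)] by linarith
        also have "\<dots> \<le> e' * (2 * S)"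
        proof (rule mult_mono)
          show "sqrt (sq_norm lborel (\<lambda>p. \<Phi>s p - \<Phi> p)) \<le> e'"
            using d1(2)[of "(0, - \<sigma>)"] \<sigma> h by (simp add: \<Phi>s_def norm_Pair)
          show "sqrt (sq_norm lborel (\<lambda>p. \<theta> (snd p) *\<^sub>R W p)) \<le> 2 * S"
            using real_sqrt_le_mono[OF wW(2)] nW by linarith
        qed (use e' in auto)
        finally show ?thesis .
      qed
      also have "(\<integral>p. \<Phi> p \<bullet> (\<theta> (snd p) *\<^sub>R (\<Psi>h p - \<Psi> p)) \<partial>lborel) \<le> F * e'"
      proof -
        have "(\<integral>p. \<Phi> p \<bullet> (\<theta> (snd p) *\<^sub>R (\<Psi>h p - \<Psi> p)) \<partial>lborel) \<le>
            F * sqrt (sq_norm lborel (\<lambda>p. \<theta> (snd p) *\<^sub>R (\<Psi>h p - \<Psi> p)))"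
          unfolding F_def using sq_norm_Cauchy_Schwarz[OF \<Phi> wD(1)] by linarith
        also have "\<dots> \<le> F * e'"
        proof (rule mult_left_mono)
          show "sqrt (sq_norm lborel (\<lambda>p. \<theta> (snd p) *\<^sub>R (\<Psi>h p - \<Psi> p))) \<le> e'"
          proof -
            have "sqrt (sq_norm lborel (\<lambda>p. \<Psi>h p - \<Psi> p)) < e'"
              using d2(2)[of "(0, - h)"] h by (simp add: \<Psi>h_def norm_Pair)
            then show ?thesis using real_sqrt_le_mono[OF wD(2)] by linarith
          qed
        qed (use FS in auto)
        finally show ?thesis .
      qed
      finally have "k \<sigma> \<le> e' * (2 * S) + F * e' + L" by simp
      then show ?thesis using e'(2) by (simp add: algebra_simps)
    qed
    have "(\<integral>t. \<theta> t * (\<integral>z. indicator {t-h..<t} (snd z) * (\<Phi> z \<bullet> (\<Psi> (fst z, t) + \<Psi> (fst z, t - h))) \<partial>lborel) \<partial>lborel)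
      = (\<integral>\<sigma>. indicator {0<..h} \<sigma> * k \<sigma> \<partial>lborel)"
      using delayed_integral_swap(1)[OF \<Phi> W \<theta>, of h] by (simp add: k_def W_def \<Psi>h_def)
    also have "\<dots> \<le> (\<integral>\<sigma>. indicator {0<..h} \<sigma> * (L + e) \<partial>lborel)"
    proof (rule integral_mono)
      show "integrable lborel (\<lambda>\<sigma>. indicator {0<..h} \<sigma> * k \<sigma>)"
        using delayed_integral_swap(3)[OF \<Phi> W \<theta>, of h] by (simp add: k_def)
      show "integrable lborel (\<lambda>\<sigma>. indicator {0<..h} \<sigma> * (L + e))"
        using h by (intro integrable_mult_left integrable_real_indicator) auto
    qed (use k in \<open>auto simp: indicator_def\<close>)
    also have "\<dots> = h * (L + e)" using h by simp
    finally show ?thesis .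
  qed
  show ?thesis
    using main d1(1) d2(1) by (intro exI[of _ "min d1 d2"]) (auto simp: L_def)
qed

text \<open>Integration by parts in time through finite differences, as \<open>q\<close> is merely
  integrable. Moving the delay from \<open>q\<close> to the weight multiplies the weight by at most
  exp(- K h), so the increments of \<open>q\<close> contribute at least (1 - exp(- K h)) times its
  weighted integral, a term of order K h. Cutting the weight off at \<open>T\<close> has the
  favourable sign.\<close>

lemma energy_inequality:
  fixes \<Phi> \<Psi> :: "'a::euclidean_space \<times> real \<Rightarrow> 'e::euclidean_space" and q :: "real \<Rightarrow> real"
  assumes \<Phi>: "sq_integrable lborel \<Phi>" and \<Psi>: "sq_integrable lborel \<Psi>"
    and q: "integrable lborel q" "\<And>t. q t \<ge> 0" "\<And>t. t \<notin> {0<..<T} \<Longrightarrow> q t = 0"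
    and K: "K > 0"
    and incr: "\<And>h. h > 0 \<Longrightarrow> AE t\<in>{0<..<T} in lborel. q t - q (t - h) =
      (\<integral>z. indicator {t-h..<t} (snd z) * (\<Phi> z \<bullet> (\<Psi> (fst z, t) + \<Psi> (fst z, t - h))) \<partial>lborel)"
  shows "K * (\<integral>t. indicator {0<..<T} t * exp (- K * t) * q t \<partial>lborel)
     \<le> 2 * (\<integral>p. indicator {0<..<T} (snd p) * exp (- K * snd p) * (\<Phi> p \<bullet> \<Psi> p) \<partial>lborel)"
proof (rule field_le_epsilon)
  fix e :: real assume e: "e > 0"
  define \<theta> where "\<theta> t = indicator {0<..<T} t * exp (- K * t)" for t :: real
  have \<theta>m [measurable]: "\<theta> \<in> borel_measurable borel" unfolding \<theta>_def[abs_def] by measurable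
  have \<theta>b: "\<bar>\<theta> t\<bar> \<le> 1" and \<theta>0: "\<theta> t \<ge> 0" for t
    using K by (auto simp: \<theta>_def indicator_def)
  have [measurable]: "q \<in> borel_measurable borel" using q(1) by auto
  have \<theta>i: "integrable lborel (\<lambda>t. \<theta> (t + c) * g t)" if "integrable lborel g" for g :: "real \<Rightarrow> real" and c
  proof (rule Bochner_Integration.integrable_bound[OF that])
    show "AE t in lborel. norm (\<theta> (t + c) * g t) \<le> norm (g t)"
      using mult_right_mono[OF \<theta>b abs_ge_zero] by (simp add: abs_mult)
  qed (use that in measurable)
  define Q where "Q = (\<integral>t. \<theta> t * q t \<partial>lborel)"
  have Q0: "Q \<ge> 0" unfolding Q_def using \<theta>0 q(2) by (intro integral_nonneg_AE) auto
  define L where "L = 2 * (\<integral>p. \<theta> (snd p) * (\<Phi> p \<bullet> \<Psi> p) \<partial>lborel)"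
  obtain d where d: "d > 0" "\<And>h. 0 < h \<Longrightarrow> h < d \<Longrightarrow>
    (\<integral>t. \<theta> t * (\<integral>z. indicator {t-h..<t} (snd z) * (\<Phi> z \<bullet> (\<Psi> (fst z, t) + \<Psi> (fst z, t - h))) \<partial>lborel) \<partial>lborel)
      \<le> h * (L + e/2)"
    using delayed_inner_limit[OF \<Phi> \<Psi> \<theta>m \<theta>b, of "e/2"] e unfolding L_def by auto
  \<comment> \<open>\<open>d/2\<close> keeps \<open>h\<close> strictly below \<open>d\<close>; the
    other bound makes the second order term \<open>h * (K\<^sup>2 * Q)\<close> of the exponential at
    most \<open>e/2\<close>.\<close>
  define h where "h = min (d/2) (e / (2 * (K\<^sup>2 * Q + 1)))"
  have pos: "K\<^sup>2 * Q + 1 > 0" using Q0 by (simp add: add_nonneg_pos)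
  have "h \<le> d/2" unfolding h_def by (rule min.cobounded1)
  moreover have "0 < h" using d(1) e pos unfolding h_def by simp
  ultimately have h: "0 < h" "h < d" using d(1) by auto
  have "h \<le> e / (2 * (K\<^sup>2 * Q + 1))" by (simp add: h_def)
  then have "h * (K\<^sup>2 * Q + 1) \<le> e / 2" using pos by (simp add: field_simps)
  then have hK: "h * (K\<^sup>2 * Q) \<le> e / 2" using h by (simp add: algebra_simps)
  have shift: "(x, t) + (0, - h) = (x, t - h)" for x :: 'a and t by simp
  have "(\<integral>t. \<theta> t * q (t - h) \<partial>lborel) = (\<integral>t. \<theta> (t + h) * q t \<partial>lborel)"
    using integral_lborel_translate[of "\<lambda>t. \<theta> t * q (t - h)" h] by simp
  also have "\<dots> \<le> (\<integral>t. exp (- K * h) * (\<theta> t * q t) \<partial>lborel)"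
  proof (rule integral_mono)
    fix t
    show "\<theta> (t + h) * q t \<le> exp (- K * h) * (\<theta> t * q t)"
    proof (cases "t \<in> {0<..<T}")
      case True
      \<comment> \<open>Equality as long as \<open>t + h < T\<close>; afterwards the left side is
        0.\<close>
      have "\<theta> (t + h) \<le> exp (- K * h) * \<theta> t"
        using True h by (auto simp: \<theta>_def indicator_def algebra_simps simp flip: exp_add)
      from mult_right_mono[OF this q(2)[of t]] show ?thesis by (simp add: mult.assoc)
    qed (simp add: q(3))
  qed (use \<theta>i[OF q(1), of h] \<theta>i[OF q(1), of 0] in auto)
  also have "\<dots> = exp (- K * h) * Q" by (simp add: Q_def)
  finally have shifted: "(\<integral>t. \<theta> t * q (t - h) \<partial>lborel) \<le> exp (- K * h) * Q" .
  \<comment> \<open>From \<open>(1 - x + x\<^sup>2) * (1 + x) = 1 + x ^ 3\<close> and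
    \<open>1 + x \<le> exp x\<close>.\<close>
  have exp_le: "exp (- x) \<le> 1 - x + x\<^sup>2" if "x \<ge> 0" for x :: real
  proof -
    have "1 \<le> (1 - x + x\<^sup>2) * (1 + x)" using that by (simp add: algebra_simps power2_eq_square)
    also have "\<dots> \<le> (1 - x + x\<^sup>2) * exp x"
    proof (rule mult_left_mono[OF exp_ge_add_one_self])
      have "0 \<le> (x - 1/2)\<^sup>2 + 3/4" by simp
      also have "\<dots> = 1 - x + x\<^sup>2" by (simp add: power2_eq_square algebra_simps)
      finally show "0 \<le> 1 - x + x\<^sup>2" .
    qed
    finally show ?thesis by (simp add: exp_minus field_simps)
  qed
  have "Q - (1 - K * h + (K * h)\<^sup>2) * Q \<le> Q - exp (- (K * h)) * Q"
    using exp_le[of "K * h"] K h Q0 by (intro diff_left_mono mult_right_mono) auto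
  also have "\<dots> \<le> (\<integral>t. \<theta> t * q t \<partial>lborel) - (\<integral>t. \<theta> t * q (t - h) \<partial>lborel)"
    using shifted by (simp add: Q_def)
  also have "\<dots> = (\<integral>t. \<theta> t * q t - \<theta> t * q (t - h) \<partial>lborel)"
    using \<theta>i[OF q(1), of 0] \<theta>i[OF integrable_lborel_translate[OF q(1), of "-h"], of 0]
    by (intro Bochner_Integration.integral_diff[symmetric]) auto
  also have "\<dots> = (\<integral>t. \<theta> t * (\<integral>z. indicator {t-h..<t} (snd z) * (\<Phi> z \<bullet> (\<Psi> (fst z, t) + \<Psi> (fst z, t - h))) \<partial>lborel) \<partial>lborel)"
  proof (rule integral_cong_AE)
    show m1: "(\<lambda>t. \<theta> t * q t - \<theta> t * q (t - h)) \<in> borel_measurable lborel" by measurable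
    show ae: "AE t in lborel. \<theta> t * q t - \<theta> t * q (t - h) =
      \<theta> t * (\<integral>z. indicator {t-h..<t} (snd z) * (\<Phi> z \<bullet> (\<Psi> (fst z, t) + \<Psi> (fst z, t - h))) \<partial>lborel)"
      using incr[OF h(1)] by eventually_elim (auto simp: \<theta>_def indicator_def simp flip: right_diff_distrib)
    show "(\<lambda>t. \<theta> t * (\<integral>z. indicator {t-h..<t} (snd z) * (\<Phi> z \<bullet> (\<Psi> (fst z, t) + \<Psi> (fst z, t - h))) \<partial>lborel)) \<in> borel_measurable lborel"
      using delayed_integral_swap(2)[OF \<Phi> sq_integrable_add[OF \<Psi> sq_integrable_translate[OF \<Psi>, of "(0, - h)"]] \<theta>m \<theta>b, of h]
      by (simp only: shift)
  qed
  also have "\<dots> \<le> h * (L + e/2)" by (rule d(2)[OF h])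
  finally have "h * (K * Q) \<le> h * (L + e/2 + h * (K\<^sup>2 * Q))"
    by (simp add: algebra_simps power2_eq_square)
  then have "K * Q \<le> L + e/2 + h * (K\<^sup>2 * Q)" using h by simp
  then have "K * Q \<le> L + e" using hK by simp
  then show "K * (\<integral>t. indicator {0<..<T} t * exp (- K * t) * q t \<partial>lborel)
     \<le> 2 * (\<integral>p. indicator {0<..<T} (snd p) * exp (- K * snd p) * (\<Phi> p \<bullet> \<Psi> p) \<partial>lborel) + e"
    by (simp add: Q_def L_def \<theta>_def)
qed

section \<open>The energy estimate for functions extended by zero\<close>

lemma L2_iff: "f \<in> L2 S \<longleftrightarrow> sq_integrable lborel (\<lambda>x. indicator S x *\<^sub>R f x)"
proof -
  have "(norm (indicator S x *\<^sub>R f x))\<^sup>2 = indicator S x *\<^sub>R (norm (f x))\<^sup>2" for x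
    by (simp add: indicator_def)
  then show ?thesis
    by (simp add: L2_def sq_integrable_def set_borel_measurable_def set_integrable_def)
qed

text \<open>Carries what holds at almost every time over to the delayed times
  \<open>t - h\<close>.\<close>

lemma AE_lborel_translate:
  fixes c :: "'a::euclidean_space"
  assumes "AE x in lborel. P x"
  shows "AE x in lborel. P (x - c)"
proof -
  obtain N where N: "N \<in> null_sets lborel" "{x \<in> space lborel. \<not> P x} \<subseteq> N"
    using assms by (auto elim: AE_E simp: null_sets_def)
  have "{x. x - c \<in> N} \<in> null_sets lborel" by (rule null_sets_translation[OF N(1)])
  then show ?thesis by (rule AE_I') (use N(2) in auto)
qed

lemma mult_le_half_sum_squares: "u * v \<le> (u\<^sup>2 + v\<^sup>2) / 2" for u v :: real
  using sum_squares_bound[of u v] by simp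

text \<open>\<Psi> stands for the state paired with its gradient, \<Phi> for the force minus the
  zeroth order term paired with the negative flux. The extension by zero turns integration from 0 to
  \<open>t\<close> into integration over all earlier times, so \<open>tested\<close> is the
  integrated equation with the slice at \<tau> as test function, and \<open>low\<close> expresses
  the sign of the elliptic part.\<close>

lemma energy_estimate_lborel:
  fixes \<Phi> \<Psi> :: "'a::euclidean_space \<times> real \<Rightarrow> real \<times> 'a" and f :: "'a \<times> real \<Rightarrow> real"
  assumes T: "T > 0" and B: "B \<ge> 0"
    and si: "sq_integrable lborel \<Phi>" "sq_integrable lborel \<Psi>" "sq_integrable lborel f"
    and supp: "\<And>x t. t \<notin> {0<..<T} \<Longrightarrow> \<Phi> (x, t) = 0 \<and> \<Psi> (x, t) = 0"
    and low: "AE p in lborel. \<Phi> p \<bullet> \<Psi> p \<le> f p * fst (\<Psi> p) + B * (fst (\<Psi> p))\<^sup>2"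
    and tested: "AE \<tau>\<in>{0<..<T} in lborel. sq_integrable lborel (\<lambda>x. \<Psi> (x, \<tau>)) \<and>
      (\<forall>t\<in>{0<..<T}. (\<integral>x. fst (\<Psi> (x, t)) * fst (\<Psi> (x, \<tau>)) \<partial>lborel)
        = (\<integral>z. indicator {..<t} (snd z) * (\<Phi> z \<bullet> \<Psi> (fst z, \<tau>)) \<partial>lborel))"
  shows "sq_norm lborel (\<lambda>p. fst (\<Psi> p)) \<le> exp ((2 * B + 2) * T) * sq_norm lborel f"
proof -
  \<comment> \<open>Young's inequality bounds \<open>K * E\<close>, with \<open>E\<close> the
    weighted squared norm of the state, by that of the force plus \<open>(2 * B + 1) * E\<close>.
    This \<open>K\<close> leaves exactly one \<open>E\<close> on the left.\<close>
  define K where "K = 2 * B + 2"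
  have K: "K > 0" using B by (simp add: K_def)
  have [measurable]: "\<Psi> \<in> borel_measurable borel" "\<Phi> \<in> borel_measurable borel" "f \<in> borel_measurable borel"
    using si by (auto simp: sq_integrable_def)
  define Z where "Z p = fst (\<Psi> p)" for p
  have Z: "sq_integrable lborel Z"
    unfolding Z_def[abs_def]
  proof (rule sq_integrable_bound[OF si(2), where C = 1])
    show "(\<lambda>p. fst (\<Psi> p)) \<in> borel_measurable lborel"
      by (rule borel_measurable_continuous_on[where f = fst]) (auto intro!: continuous_intros)
    show "AE p in lborel. norm (fst (\<Psi> p)) \<le> 1 * norm (\<Psi> p)"
      using norm_fst_le[of "fst (\<Psi> p)" "snd (\<Psi> p)" for p] by (intro AE_I2) simp
  qed
  have [measurable]: "Z \<in> borel_measurable borel" using Z by (simp add: sq_integrable_def)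
  define q where "q t = sq_norm lborel (\<lambda>x. Z (x, t))" for t
  \<comment> \<open>The delayed time \<open>t - h\<close> may be negative, so the identity is wanted
    for \<open>t \<le> 0\<close> and for \<tau> outside the interval as well; there both sides
    vanish.\<close>
  define good where "good \<tau> \<longleftrightarrow> sq_integrable lborel (\<lambda>x. \<Psi> (x, \<tau>)) \<and>
      (\<forall>t<T. (\<integral>x. Z (x, t) * Z (x, \<tau>) \<partial>lborel)
        = (\<integral>z. indicator {..<t} (snd z) * (\<Phi> z \<bullet> \<Psi> (fst z, \<tau>)) \<partial>lborel))" for \<tau>
  have "AE \<tau> in lborel. good \<tau>"
    using tested
  proof eventually_elim
    case (elim \<tau>)
    show "good \<tau>"
    proof (cases "\<tau> \<in> {0<..<T}")
      case True
      have "(\<integral>x. Z (x, t) * Z (x, \<tau>) \<partial>lborel)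
        = (\<integral>z. indicator {..<t} (snd z) * (\<Phi> z \<bullet> \<Psi> (fst z, \<tau>)) \<partial>lborel)" if "t < T" for t
      proof (cases "t > 0")
        case False
        then have "indicator {..<t} (snd z) * (\<Phi> z \<bullet> \<Psi> (fst z, \<tau>)) = 0" for z
          using supp[of "snd z" "fst z"] by (auto simp: indicator_def)
        moreover have "Z (x, t) = 0" for x using False supp[of t x] by (simp add: Z_def)
        ultimately show ?thesis by (simp only: mult_zero_left Bochner_Integration.integral_zero)
      qed (use elim True that in \<open>simp add: Z_def\<close>)
      then show ?thesis using elim True by (simp add: good_def)
    next
      case False
      then have "\<Psi> (x, \<tau>) = 0" for x using supp by blast
      then show ?thesis by (simp add: good_def Z_def sq_integrable_def)
    qed
  qed
  note good = this AE_lborel_translate[OF this]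
  have incr: "AE t\<in>{0<..<T} in lborel. q t - q (t - h) =
      (\<integral>z. indicator {t-h..<t} (snd z) * (\<Phi> z \<bullet> (\<Psi> (fst z, t) + \<Psi> (fst z, t - h))) \<partial>lborel)"
    if h: "h > 0" for h
    using good(1) good(2)[of h]
  proof eventually_elim
    case (elim t)
    show ?case
    proof
      assume t: "t \<in> {0<..<T}"
      define \<Psi>1 where "\<Psi>1 x = \<Psi> (x, t) + \<Psi> (x, t - h)" for x
      have int: "integrable lborel (\<lambda>z. indicator {..<r} (snd z) * (\<Phi> z \<bullet> \<Psi> (fst z, s)))"
        if "s \<in> {t, t - h}" for r s
      proof -
        have s: "sq_integrable lborel (\<lambda>x. \<Psi> (x, s))" using elim that by (auto simp: good_def)
        \<comment> \<open>The half-line \<open>{..<r}\<close> has infinite measure. Intersecting it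
          with (0, T), outside of which \<Phi> vanishes, makes the time-constant slice square
          integrable.\<close>
        have fin: "emeasure lborel ({0<..<T} \<inter> {..<r}) < \<infinity>"
          by (rule order.strict_trans1[OF emeasure_mono[of _ "{0<..<T}"]]) (use T in auto)
        have "integrable lborel (\<lambda>z. \<Phi> z \<bullet> (indicator ({0<..<T} \<inter> {..<r}) (snd z) *\<^sub>R \<Psi> (fst z, s)))"
          by (rule sq_integrable_inner[OF si(1) sq_integrable_time_const[OF s _ fin]]) simp
        also have "(\<lambda>z. \<Phi> z \<bullet> (indicator ({0<..<T} \<inter> {..<r}) (snd z) *\<^sub>R \<Psi> (fst z, s)))
           = (\<lambda>z. indicator {..<r} (snd z) * (\<Phi> z \<bullet> \<Psi> (fst z, s)))"
        proof
          fix z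
          show "\<Phi> z \<bullet> (indicator ({0<..<T} \<inter> {..<r}) (snd z) *\<^sub>R \<Psi> (fst z, s))
            = indicator {..<r} (snd z) * (\<Phi> z \<bullet> \<Psi> (fst z, s))"
            using supp[of "snd z" "fst z"] by (cases "snd z \<in> {0<..<T}") (auto simp: indicator_def)
        qed
        finally show ?thesis .
      qed
      define A where "A r s = (\<integral>z. indicator {..<r} (snd z) * (\<Phi> z \<bullet> \<Psi> (fst z, s)) \<partial>lborel)" for r s
      have BA: "(\<integral>x. Z (x, r) * Z (x, s) \<partial>lborel) = A r s" if "s \<in> {t, t - h}" "r \<in> {t, t - h}" for r s
        using elim that t h by (auto simp: good_def A_def)
      \<comment> \<open>Both terms are the inner product of the slices at \<open>t\<close> and
        \<open>t - h\<close>. Exchanging them splits the difference of squared norms into two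
        differences over the same window from \<open>t - h\<close> to \<open>t\<close>.\<close>
      have sym: "A t (t - h) = A (t - h) t"
        using BA[of "t - h" t] BA[of t "t - h"] by (simp add: mult.commute)
      have qA: "q r = A r r" if "r \<in> {t, t - h}" for r
        using BA[OF that that] by (simp add: q_def sq_norm_def power2_eq_square)
      have "q t - q (t - h) = (A t t - A (t - h) t) + (A t (t - h) - A (t - h) (t - h))"
        using qA sym by simp
      also have "\<dots> = (\<integral>z. (indicator {..<t} (snd z) * (\<Phi> z \<bullet> \<Psi> (fst z, t)) - indicator {..<t-h} (snd z) * (\<Phi> z \<bullet> \<Psi> (fst z, t)))
          + (indicator {..<t} (snd z) * (\<Phi> z \<bullet> \<Psi> (fst z, t-h)) - indicator {..<t-h} (snd z) * (\<Phi> z \<bullet> \<Psi> (fst z, t-h))) \<partial>lborel)"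
        unfolding A_def using int by simp
      also have "\<dots> = (\<integral>z. indicator {t-h..<t} (snd z) * (\<Phi> z \<bullet> (\<Psi> (fst z, t) + \<Psi> (fst z, t - h))) \<partial>lborel)"
        by (rule Bochner_Integration.integral_cong) (use h in \<open>auto simp: indicator_def inner_simps\<close>)
      finally show "q t - q (t - h) =
        (\<integral>z. indicator {t-h..<t} (snd z) * (\<Phi> z \<bullet> (\<Psi> (fst z, t) + \<Psi> (fst z, t - h))) \<partial>lborel)" .
    qed
  qed
  have q_int: "integrable lborel q" unfolding q_def by (rule sq_integrable_slice(2)[OF Z])
  have Z0: "Z (x, t) = 0" if "t \<notin> {0<..<T}" for x t using supp[OF that, of x] by (simp add: Z_def)
  have q0: "q t = 0" if "t \<notin> {0<..<T}" for t using Z0[OF that] by (simp add: q_def sq_norm_def)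
  define \<theta> where "\<theta> t = indicator {0<..<T} t * exp (- K * t)" for t :: real
  have \<theta>m [measurable]: "\<theta> \<in> borel_measurable borel" unfolding \<theta>_def[abs_def] by measurable
  have \<theta>b: "\<bar>\<theta> t\<bar> \<le> 1" and \<theta>0: "\<theta> t \<ge> 0" for t
    using K by (auto simp: \<theta>_def indicator_def)
  have \<theta>sm [measurable]: "(\<lambda>p::'a \<times> real. \<theta> (snd p)) \<in> borel_measurable borel"
    by (rule measurable_compose[OF _ \<theta>m]) (auto intro!: borel_measurable_continuous_onI continuous_intros)
  have \<theta>i: "integrable lborel (\<lambda>p::'a \<times> real. \<theta> (snd p) * g p)" if "integrable lborel g" for g
  proof (rule Bochner_Integration.integrable_bound[OF that])
    have [measurable]: "g \<in> borel_measurable borel" using that by auto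
    show "(\<lambda>p::'a \<times> real. \<theta> (snd p) * g p) \<in> borel_measurable lborel" by measurable
    show "AE p in lborel. norm (\<theta> (snd p) * g p) \<le> norm (g p)"
      using mult_right_mono[OF \<theta>b abs_ge_zero] by (simp add: abs_mult)
  qed
  have iZ: "integrable lborel (\<lambda>p. (Z p)\<^sup>2)" and i_f: "integrable lborel (\<lambda>p. (f p)\<^sup>2)"
    using Z si(3) by (auto simp: sq_integrable_def)
  have ii: "integrable lborel (\<lambda>p. \<Phi> p \<bullet> \<Psi> p)" by (rule sq_integrable_inner[OF si(1,2)])
  define E where "E = (\<integral>p. \<theta> (snd p) * (Z p)\<^sup>2 \<partial>lborel)"
  have "integrable (lborel \<Otimes>\<^sub>M lborel) (\<lambda>(x, t). \<theta> t * (Z (x, t))\<^sup>2)"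
    using \<theta>i[OF iZ] by (simp add: lborel_prod case_prod_beta')
  from lborel_pair.integral_snd[OF this] have qE: "(\<integral>t. \<theta> t * q t \<partial>lborel) = E"
    by (simp add: q_def sq_norm_def E_def lborel_prod case_prod_beta')
  have "K * E \<le> 2 * (\<integral>p. \<theta> (snd p) * (\<Phi> p \<bullet> \<Psi> p) \<partial>lborel)"
    using energy_inequality[OF si(1,2) q_int _ q0 K incr] by (simp add: \<theta>_def q_def flip: qE)
  also have "(\<integral>p. \<theta> (snd p) * (\<Phi> p \<bullet> \<Psi> p) \<partial>lborel) \<le>
      (\<integral>p. (1/2) * (\<theta> (snd p) * (f p)\<^sup>2) + (B + 1/2) * (\<theta> (snd p) * (Z p)\<^sup>2) \<partial>lborel)"
  proof (rule integral_mono_AE)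
    show "AE p in lborel. \<theta> (snd p) * (\<Phi> p \<bullet> \<Psi> p) \<le>
        (1/2) * (\<theta> (snd p) * (f p)\<^sup>2) + (B + 1/2) * (\<theta> (snd p) * (Z p)\<^sup>2)"
      using low
    proof eventually_elim
      fix p assume "\<Phi> p \<bullet> \<Psi> p \<le> f p * fst (\<Psi> p) + B * (fst (\<Psi> p))\<^sup>2"
      then have "\<Phi> p \<bullet> \<Psi> p \<le> (1/2) * (f p)\<^sup>2 + (B + 1/2) * (Z p)\<^sup>2"
        using mult_le_half_sum_squares[of "f p" "Z p"] by (simp add: Z_def algebra_simps)
      from mult_left_mono[OF this \<theta>0[of "snd p"]]
      show "\<theta> (snd p) * (\<Phi> p \<bullet> \<Psi> p) \<le>
        (1/2) * (\<theta> (snd p) * (f p)\<^sup>2) + (B + 1/2) * (\<theta> (snd p) * (Z p)\<^sup>2)"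
        by (simp add: algebra_simps)
    qed
  qed (use \<theta>i[OF iZ] \<theta>i[OF i_f] \<theta>i[OF ii] in auto)
  also have "\<dots> = (1/2) * (\<integral>p. \<theta> (snd p) * (f p)\<^sup>2 \<partial>lborel) + (B + 1/2) * E"
    using \<theta>i[OF iZ] \<theta>i[OF i_f] by (simp add: E_def)
  finally have "E \<le> (\<integral>p. \<theta> (snd p) * (f p)\<^sup>2 \<partial>lborel)"
    by (simp add: K_def algebra_simps)
  also have "\<dots> \<le> (\<integral>p. (f p)\<^sup>2 \<partial>lborel)"
  proof (rule integral_mono)
    show "\<theta> (snd p) * (f p)\<^sup>2 \<le> (f p)\<^sup>2" for p
      using mult_right_mono[OF order_trans[OF abs_ge_self \<theta>b[of "snd p"]], of "(f p)\<^sup>2"] by simp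
  qed (use \<theta>i[OF i_f] i_f in auto)
  finally have E_le: "E \<le> sq_norm lborel f" by (simp add: sq_norm_def)
  \<comment> \<open>On (0, T) the weight is at least \<open>exp (- K * T)\<close>, and elsewhere
    \<open>Z\<close> vanishes.\<close>
  have "exp (- K * T) * sq_norm lborel Z = (\<integral>p. exp (- K * T) * (Z p)\<^sup>2 \<partial>lborel)"
    by (simp add: sq_norm_def)
  also have "\<dots> \<le> E"
    unfolding E_def
  proof (rule integral_mono)
    fix p :: "'a \<times> real"
    show "exp (- K * T) * (Z p)\<^sup>2 \<le> \<theta> (snd p) * (Z p)\<^sup>2"
    proof (cases "snd p \<in> {0<..<T}")
      case True
      then show ?thesis using K by (intro mult_right_mono) (auto simp: \<theta>_def)
    next
      case False
      then show ?thesis using Z0[OF False, of "fst p"] by simp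
    qed
  qed (use iZ \<theta>i[OF iZ] in auto)
  finally have "exp (- K * T) * sq_norm lborel Z \<le> sq_norm lborel f" using E_le by simp
  then have "exp (K * T) * (exp (- K * T) * sq_norm lborel Z) \<le> exp (K * T) * sq_norm lborel f"
    by (intro mult_left_mono) auto
  moreover have "exp (K * T) * (exp (- K * T) * sq_norm lborel Z) = sq_norm lborel Z"
    by (simp flip: mult.assoc exp_add)
  ultimately have "sq_norm lborel Z \<le> exp (K * T) * sq_norm lborel f" by (simp only:)
  then show ?thesis by (simp add: K_def Z_def[abs_def])
qed

section \<open>Weak solutions with zero initial datum\<close>

lemma cylinder_indicator:
  "indicator (cylinder \<Omega> t) p = (indicator \<Omega> (fst p) * indicator {0<..<t} (snd p) :: real)"
  by (cases p) (auto simp: cylinder_def indicator_def)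

lemma cylinder_measurable [measurable]:
  assumes "\<Omega> \<in> sets (borel :: 'a::euclidean_space measure)"
  shows "cylinder \<Omega> t \<in> sets (borel :: ('a \<times> real) measure)"
  unfolding cylinder_def using assms by (auto simp: borel_prod[symmetric])

lemma L2_Linfty_scaleR:
  assumes a: "a \<in> Linfty S" and u: "u \<in> L2 S"
  shows "(\<lambda>x. a x *\<^sub>R u x) \<in> L2 S"
proof -
  obtain C where C: "AE x\<in>S in lborel. norm (a x) \<le> C" using a by (auto simp: Linfty_def)
  have [measurable]: "(\<lambda>x. indicator S x *\<^sub>R a x) \<in> borel_measurable borel"
    "(\<lambda>x. indicator S x *\<^sub>R u x) \<in> borel_measurable borel"
    using a u by (auto simp: Linfty_def L2_def set_borel_measurable_def)
  have "sq_integrable lborel (\<lambda>x. indicator S x *\<^sub>R (a x *\<^sub>R u x))"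
  proof (rule sq_integrable_bound[where C = C])
    show "sq_integrable lborel (\<lambda>x. indicator S x *\<^sub>R u x)" using u by (simp add: L2_iff)
    have "(\<lambda>x. (indicator S x *\<^sub>R a x) *\<^sub>R (indicator S x *\<^sub>R u x)) \<in> borel_measurable lborel" by measurable
    also have "(\<lambda>x. (indicator S x *\<^sub>R a x) *\<^sub>R (indicator S x *\<^sub>R u x)) = (\<lambda>x. indicator S x *\<^sub>R (a x *\<^sub>R u x))"
      by (auto simp: indicator_def)
    finally show "(\<lambda>x. indicator S x *\<^sub>R (a x *\<^sub>R u x)) \<in> borel_measurable lborel" .
    show "AE x in lborel. norm (indicator S x *\<^sub>R (a x *\<^sub>R u x)) \<le> C * norm (indicator S x *\<^sub>R u x)"
      using C by eventually_elim (auto simp: indicator_def mult_right_mono)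
  qed
  then show ?thesis by (simp add: L2_iff)
qed

lemma L2_add: "f \<in> L2 S \<Longrightarrow> g \<in> L2 S \<Longrightarrow> (\<lambda>x. f x + g x) \<in> L2 S"
  using sq_integrable_add[of lborel "\<lambda>x. indicator S x *\<^sub>R f x" "\<lambda>x. indicator S x *\<^sub>R g x"]
  by (simp add: L2_iff scaleR_add_right)

lemma L2_scaleR: "f \<in> L2 S \<Longrightarrow> (\<lambda>x. c *\<^sub>R f x) \<in> L2 S"
  using sq_integrable_scaleR[of lborel "\<lambda>x. indicator S x *\<^sub>R f x" c]
  by (simp add: L2_iff mult.commute)

lemma L2_inner_integrable:
  assumes "f \<in> L2 S" "g \<in> L2 S"
  shows "set_integrable lborel S (\<lambda>x. f x \<bullet> g x)"
proof -
  have "(\<lambda>x. (indicator S x *\<^sub>R f x) \<bullet> (indicator S x *\<^sub>R g x)) = (\<lambda>x. indicator S x *\<^sub>R (f x \<bullet> g x))"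
    by (auto simp: indicator_def)
  then show ?thesis
    using sq_integrable_inner[of lborel "\<lambda>x. indicator S x *\<^sub>R f x" "\<lambda>x. indicator S x *\<^sub>R g x"] assms
    by (simp add: L2_iff set_integrable_def)
qed

lemma L2_time_const:
  assumes "w \<in> L2 \<Omega>"
  shows "(\<lambda>p. w (fst p)) \<in> L2 (cylinder \<Omega> T)"
proof -
  have "bounded {0<..<T}" by simp
  then have fin: "emeasure lborel {0<..<T} < \<infinity>" by (rule emeasure_bounded_finite)
  have "(\<lambda>p. indicator (cylinder \<Omega> T) p *\<^sub>R w (fst p)) =
      (\<lambda>p. indicator {0<..<T} (snd p) *\<^sub>R (indicator \<Omega> (fst p) *\<^sub>R w (fst p)))"
    by (auto simp: cylinder_indicator mult.commute)
  then show ?thesis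
    using sq_integrable_time_const[of "\<lambda>x. indicator \<Omega> x *\<^sub>R w x" "{0<..<T}"] assms fin
    by (simp add: L2_iff)
qed

lemma cylinder_inner_integrable:
  assumes \<Omega>: "\<Omega> \<in> sets borel" and u: "u \<in> L2 (cylinder \<Omega> T)" and w: "w \<in> L2 \<Omega>" and t: "t \<le> T"
  shows "set_integrable lborel (cylinder \<Omega> t) (\<lambda>p. u p \<bullet> w (fst p))"
  by (rule set_integrable_subset[OF L2_inner_integrable[OF u L2_time_const[OF w]]])
     (use \<Omega> t in \<open>auto simp: cylinder_def intro!: cylinder_measurable[unfolded cylinder_def]\<close>)

text \<open>
  With the linear span in place of \<open>H10\<close>, linear combinations of solutions can be tested with
  themselves without showing that \<open>H10\<close> is a linear space.
\<close>

inductive H10_span :: "'a::euclidean_space set \<Rightarrow> ('a \<Rightarrow> real) \<Rightarrow> ('a \<Rightarrow> 'a) \<Rightarrow> bool" for S where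
  base: "H10 S u Du \<Longrightarrow> H10_span S u Du"
| lin: "H10_span S u Du \<Longrightarrow> H10_span S v Dv \<Longrightarrow>
    H10_span S (\<lambda>x. u x + c *\<^sub>R v x) (\<lambda>x. Du x + c *\<^sub>R Dv x)"

lemma H10_span_L2: "H10_span S u Du \<Longrightarrow> u \<in> L2 S \<and> Du \<in> L2 S"
  by (induction rule: H10_span.induct) (auto simp: H10_def intro!: L2_add L2_scaleR simp del: real_scaleR_def)

text \<open>The integrated equation with zero initial datum, brought to one side: \<open>F\<close>
  is the flux and \<open>g\<close> the zeroth order term minus the force. Writing all three terms as
  inner products, also between reals, lets the same integrability and linearity facts serve each of
  them.\<close>

definition weak_residual ::
    "'a::euclidean_space set \<Rightarrow> ('a \<times> real \<Rightarrow> real) \<Rightarrow> ('a \<times> real \<Rightarrow> 'a) \<Rightarrow> ('a \<times> real \<Rightarrow> real) \<Rightarrow>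
     ('a \<Rightarrow> real) \<Rightarrow> ('a \<Rightarrow> 'a) \<Rightarrow> real \<Rightarrow> real" where
  "weak_residual \<Omega> z F g w Dw t = (LINT x:\<Omega>|lborel. z (x, t) \<bullet> w x)
     + (LINT p:cylinder \<Omega> t|lborel. F p \<bullet> Dw (fst p)) + (LINT p:cylinder \<Omega> t|lborel. g p \<bullet> w (fst p))"

lemma weak_residual_test_linear:
  assumes \<Omega>: "\<Omega> \<in> sets borel" and t: "t \<le> T"
    and L2: "(\<lambda>x. z (x, t)) \<in> L2 \<Omega>" "F \<in> L2 (cylinder \<Omega> T)" "g \<in> L2 (cylinder \<Omega> T)"
    "u \<in> L2 \<Omega>" "Du \<in> L2 \<Omega>" "v \<in> L2 \<Omega>" "Dv \<in> L2 \<Omega>"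
  shows "weak_residual \<Omega> z F g (\<lambda>x. u x + c *\<^sub>R v x) (\<lambda>x. Du x + c *\<^sub>R Dv x) t
    = weak_residual \<Omega> z F g u Du t + c * weak_residual \<Omega> z F g v Dv t"
proof -
  note ci = cylinder_inner_integrable[OF \<Omega> _ _ t]
  have "(LINT x:\<Omega>|lborel. z (x, t) \<bullet> (u x + c *\<^sub>R v x)) =
      (LINT x:\<Omega>|lborel. z (x, t) \<bullet> u x) + c * (LINT x:\<Omega>|lborel. z (x, t) \<bullet> v x)"
    unfolding inner_add_right inner_scaleR_right
    using L2_inner_integrable[OF L2(1,4)] L2_inner_integrable[OF L2(1,6)] by simp
  moreover have "(LINT p:cylinder \<Omega> t|lborel. F p \<bullet> (Du (fst p) + c *\<^sub>R Dv (fst p))) =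
      (LINT p:cylinder \<Omega> t|lborel. F p \<bullet> Du (fst p)) + c * (LINT p:cylinder \<Omega> t|lborel. F p \<bullet> Dv (fst p))"
    unfolding inner_add_right inner_scaleR_right
    using ci[OF L2(2,5)] ci[OF L2(2,7)] by simp
  moreover have "(LINT p:cylinder \<Omega> t|lborel. g p \<bullet> (u (fst p) + c *\<^sub>R v (fst p))) =
      (LINT p:cylinder \<Omega> t|lborel. g p \<bullet> u (fst p)) + c * (LINT p:cylinder \<Omega> t|lborel. g p \<bullet> v (fst p))"
    unfolding inner_add_right inner_scaleR_right
    using ci[OF L2(3,4)] ci[OF L2(3,6)] by simp
  ultimately show ?thesis unfolding weak_residual_def by (simp add: algebra_simps)
qed

lemma weak_residual_linear:
  assumes \<Omega>: "\<Omega> \<in> sets borel" and t: "t \<le> T"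
    and L2: "(\<lambda>x. z (x, t)) \<in> L2 \<Omega>" "F \<in> L2 (cylinder \<Omega> T)" "g \<in> L2 (cylinder \<Omega> T)"
    "(\<lambda>x. z' (x, t)) \<in> L2 \<Omega>" "F' \<in> L2 (cylinder \<Omega> T)" "g' \<in> L2 (cylinder \<Omega> T)"
    "u \<in> L2 \<Omega>" "Du \<in> L2 \<Omega>"
  shows "weak_residual \<Omega> (\<lambda>p. z p + c *\<^sub>R z' p) (\<lambda>p. F p + c *\<^sub>R F' p) (\<lambda>p. g p + c *\<^sub>R g' p) u Du t
    = weak_residual \<Omega> z F g u Du t + c * weak_residual \<Omega> z' F' g' u Du t"
proof -
  note ci = cylinder_inner_integrable[OF \<Omega> _ _ t]
  have "(LINT x:\<Omega>|lborel. (z (x, t) + c *\<^sub>R z' (x, t)) \<bullet> u x) =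
      (LINT x:\<Omega>|lborel. z (x, t) \<bullet> u x) + c * (LINT x:\<Omega>|lborel. z' (x, t) \<bullet> u x)"
    unfolding inner_add_left inner_scaleR_left
    using L2_inner_integrable[OF L2(1,7)] L2_inner_integrable[OF L2(4,7)] by simp
  moreover have "(LINT p:cylinder \<Omega> t|lborel. (F p + c *\<^sub>R F' p) \<bullet> Du (fst p)) =
      (LINT p:cylinder \<Omega> t|lborel. F p \<bullet> Du (fst p)) + c * (LINT p:cylinder \<Omega> t|lborel. F' p \<bullet> Du (fst p))"
    unfolding inner_add_left inner_scaleR_left
    using ci[OF L2(2,8)] ci[OF L2(5,8)] by simp
  moreover have "(LINT p:cylinder \<Omega> t|lborel. (g p + c *\<^sub>R g' p) \<bullet> u (fst p)) =
      (LINT p:cylinder \<Omega> t|lborel. g p \<bullet> u (fst p)) + c * (LINT p:cylinder \<Omega> t|lborel. g' p \<bullet> u (fst p))"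
    unfolding inner_add_left inner_scaleR_left
    using ci[OF L2(3,7)] ci[OF L2(6,7)] by simp
  ultimately show ?thesis unfolding weak_residual_def by (simp add: algebra_simps)
qed

text \<open>A class closed under joint linear combinations of force and state, so that differences
  and midpoints of states fall under the estimate below. The zero initial datum is built into
  \<open>weak_residual\<close>.\<close>

definition forced_solution ::
    "'a::euclidean_space set \<Rightarrow> real \<Rightarrow> ('a \<times> real \<Rightarrow> real) \<Rightarrow> ('a \<times> real \<Rightarrow> real) \<Rightarrow>
     ('a \<times> real \<Rightarrow> real) \<Rightarrow> ('a \<times> real \<Rightarrow> real) \<Rightarrow> bool" where
  "forced_solution \<Omega> T a b f z \<longleftrightarrow> z \<in> L2 (cylinder \<Omega> T) \<and> f \<in> L2 (cylinder \<Omega> T) \<and>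
     (\<forall>t\<in>{0..T}. (\<lambda>x. z (x, t)) \<in> L2 \<Omega>) \<and>
     (\<exists>G. G \<in> L2 (cylinder \<Omega> T) \<and>
        (AE t\<in>{0<..<T} in lborel. H10_span \<Omega> (\<lambda>x. z (x, t)) (\<lambda>x. G (x, t))) \<and>
        (\<forall>w Dw. H10_span \<Omega> w Dw \<longrightarrow> (\<forall>t\<in>{0..T}.
           weak_residual \<Omega> z (\<lambda>p. a p *\<^sub>R G p) (\<lambda>p. b p *\<^sub>R z p - f p) w Dw t = 0)))"

lemma L2_diff: "f \<in> L2 S \<Longrightarrow> g \<in> L2 S \<Longrightarrow> (\<lambda>x. f x - g x) \<in> L2 S"
  using L2_add[OF _ L2_scaleR[of g S "-1"], of f] by simp

lemma weak_solution_forced: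
  assumes \<Omega>: "\<Omega> \<in> sets borel" and a: "a \<in> Linfty (cylinder \<Omega> T)" and b: "b \<in> Linfty (cylinder \<Omega> T)"
    and f: "f \<in> L2 (cylinder \<Omega> T)" and sol: "weak_solution \<Omega> T a b f (\<lambda>_. 0) z"
  shows "forced_solution \<Omega> T a b f z"
proof -
  have z: "z \<in> L2 (cylinder \<Omega> T)" and zt: "\<And>t. t \<in> {0..T} \<Longrightarrow> (\<lambda>x. z (x, t)) \<in> L2 \<Omega>"
    using sol by (auto simp: weak_solution_def)
  obtain G where G: "G \<in> L2 (cylinder \<Omega> T)"
    and GH: "AE t\<in>{0<..<T} in lborel. H10 \<Omega> (\<lambda>x. z (x, t)) (\<lambda>x. G (x, t))"
    and eq: "\<And>w Dw t. H10 \<Omega> w Dw \<Longrightarrow> t \<in> {0..T} \<Longrightarrow>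
       (LINT x:\<Omega>|lborel. z (x, t) * w x) - (LINT x:\<Omega>|lborel. 0 * w x)
           + (LINT (x, s):cylinder \<Omega> t|lborel.
                a (x, s) * (G (x, s) \<bullet> Dw x) + b (x, s) * z (x, s) * w x)
           = (LINT (x, s):cylinder \<Omega> t|lborel. f (x, s) * w x)"
    using sol unfolding weak_solution_def by blast
  have aG: "(\<lambda>p. a p *\<^sub>R G p) \<in> L2 (cylinder \<Omega> T)" by (rule L2_Linfty_scaleR[OF a G])
  have bz: "(\<lambda>p. b p *\<^sub>R z p) \<in> L2 (cylinder \<Omega> T)" by (rule L2_Linfty_scaleR[OF b z])
  have g: "(\<lambda>p. b p *\<^sub>R z p - f p) \<in> L2 (cylinder \<Omega> T)" by (rule L2_diff[OF bz f])
  have res: "weak_residual \<Omega> z (\<lambda>p. a p *\<^sub>R G p) (\<lambda>p. b p *\<^sub>R z p - f p) w Dw t = 0"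
    if "H10_span \<Omega> w Dw" and t: "t \<in> {0..T}" for w Dw t
    using that(1)
  proof induction
    case (base w Dw)
    have w: "w \<in> L2 \<Omega>" "Dw \<in> L2 \<Omega>" using base by (auto simp: H10_def)
    have tT: "t \<le> T" using t by simp
    note ci = cylinder_inner_integrable[OF \<Omega> _ _ tT]
    have "(LINT (x, s):cylinder \<Omega> t|lborel. a (x, s) * (G (x, s) \<bullet> Dw x) + b (x, s) * z (x, s) * w x)
      = (LINT p:cylinder \<Omega> t|lborel. (a p *\<^sub>R G p) \<bullet> Dw (fst p) + (b p *\<^sub>R z p) \<bullet> w (fst p))"
      by (simp add: case_prod_beta')
    also have "\<dots> = (LINT p:cylinder \<Omega> t|lborel. (a p *\<^sub>R G p) \<bullet> Dw (fst p)) + (LINT p:cylinder \<Omega> t|lborel. (b p *\<^sub>R z p) \<bullet> w (fst p))"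
      by (rule set_integral_add(2)[OF ci[OF aG w(2)] ci[OF bz w(1)]])
    finally have 1: "(LINT (x, s):cylinder \<Omega> t|lborel. a (x, s) * (G (x, s) \<bullet> Dw x) + b (x, s) * z (x, s) * w x)
       = (LINT p:cylinder \<Omega> t|lborel. (a p *\<^sub>R G p) \<bullet> Dw (fst p)) + (LINT p:cylinder \<Omega> t|lborel. (b p *\<^sub>R z p) \<bullet> w (fst p))" .
    have 2: "(LINT (x, s):cylinder \<Omega> t|lborel. f (x, s) * w x) = (LINT p:cylinder \<Omega> t|lborel. f p \<bullet> w (fst p))"
      by (simp add: case_prod_beta')
    have 3: "(LINT p:cylinder \<Omega> t|lborel. (b p *\<^sub>R z p - f p) \<bullet> w (fst p)) =
        (LINT p:cylinder \<Omega> t|lborel. (b p *\<^sub>R z p) \<bullet> w (fst p)) - (LINT p:cylinder \<Omega> t|lborel. f p \<bullet> w (fst p))"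
      unfolding inner_diff_left by (rule set_integral_diff(2)[OF ci[OF bz w(1)] ci[OF f w(1)]])
    have 4: "(LINT x:\<Omega>|lborel. z (x, t) * w x) = (LINT x:\<Omega>|lborel. z (x, t) \<bullet> w x)" by simp
    show ?case using eq[OF base t] 1 2 unfolding weak_residual_def 3 4 by simp
  next
    case (lin u Du v Dv c)
    have tT: "t \<le> T" using t by simp
    show ?case
      using weak_residual_test_linear[OF \<Omega> tT zt[OF t] aG g, of u Du v Dv c] H10_span_L2[OF lin(1)] H10_span_L2[OF lin(2)] lin.IH
      by simp
  qed
  have "AE t\<in>{0<..<T} in lborel. H10_span \<Omega> (\<lambda>x. z (x, t)) (\<lambda>x. G (x, t))"
    using GH by eventually_elim (auto intro: H10_span.base)
  with z f zt G res show ?thesis unfolding forced_solution_def by blast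
qed

lemma forced_solution_linear:
  assumes \<Omega>: "\<Omega> \<in> sets borel" and a: "a \<in> Linfty (cylinder \<Omega> T)" and b: "b \<in> Linfty (cylinder \<Omega> T)"
    and sol: "forced_solution \<Omega> T a b f z" "forced_solution \<Omega> T a b f' z'"
  shows "forced_solution \<Omega> T a b (\<lambda>p. f p + c *\<^sub>R f' p) (\<lambda>p. z p + c *\<^sub>R z' p)"
proof -
  note d = sol[unfolded forced_solution_def]
  obtain G where G: "G \<in> L2 (cylinder \<Omega> T)"
    "AE t\<in>{0<..<T} in lborel. H10_span \<Omega> (\<lambda>x. z (x, t)) (\<lambda>x. G (x, t))"
    "\<And>w Dw t. H10_span \<Omega> w Dw \<Longrightarrow> t \<in> {0..T} \<Longrightarrow>
      weak_residual \<Omega> z (\<lambda>p. a p *\<^sub>R G p) (\<lambda>p. b p *\<^sub>R z p - f p) w Dw t = 0"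
    using d(1) by blast
  obtain G' where G': "G' \<in> L2 (cylinder \<Omega> T)"
    "AE t\<in>{0<..<T} in lborel. H10_span \<Omega> (\<lambda>x. z' (x, t)) (\<lambda>x. G' (x, t))"
    "\<And>w Dw t. H10_span \<Omega> w Dw \<Longrightarrow> t \<in> {0..T} \<Longrightarrow>
      weak_residual \<Omega> z' (\<lambda>p. a p *\<^sub>R G' p) (\<lambda>p. b p *\<^sub>R z' p - f' p) w Dw t = 0"
    using d(2) by blast
  note lL = L2_Linfty_scaleR[OF a G(1)] L2_diff[OF L2_Linfty_scaleR[OF b], of z f]
    L2_Linfty_scaleR[OF a G'(1)] L2_diff[OF L2_Linfty_scaleR[OF b], of z' f']
  have "weak_residual \<Omega> (\<lambda>p. z p + c *\<^sub>R z' p) (\<lambda>p. a p *\<^sub>R (G p + c *\<^sub>R G' p))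
      (\<lambda>p. b p *\<^sub>R (z p + c *\<^sub>R z' p) - (f p + c *\<^sub>R f' p)) w Dw t = 0"
    if w: "H10_span \<Omega> w Dw" and t: "t \<in> {0..T}" for w Dw t
  proof -
    have tT: "t \<le> T" using t by simp
    have "weak_residual \<Omega> (\<lambda>p. z p + c *\<^sub>R z' p) (\<lambda>p. a p *\<^sub>R G p + c *\<^sub>R (a p *\<^sub>R G' p))
       (\<lambda>p. (b p *\<^sub>R z p - f p) + c *\<^sub>R (b p *\<^sub>R z' p - f' p)) w Dw t = 0"
      using weak_residual_linear[OF \<Omega> tT _ lL(1) lL(2) _ lL(3) lL(4), of z z' w Dw c] d H10_span_L2[OF w] t G(3)[OF w t] G'(3)[OF w t]
      by simp
    then show ?thesis by (simp add: algebra_simps)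
  qed
  moreover have "AE t\<in>{0<..<T} in lborel. H10_span \<Omega> (\<lambda>x. z (x, t) + c *\<^sub>R z' (x, t)) (\<lambda>x. G (x, t) + c *\<^sub>R G' (x, t))"
    using G(2) G'(2) by eventually_elim (auto intro: H10_span.lin simp del: real_scaleR_def)
  moreover have "(\<lambda>p. G p + c *\<^sub>R G' p) \<in> L2 (cylinder \<Omega> T)" by (intro L2_add L2_scaleR G G')
  moreover have "(\<lambda>p. z p + c *\<^sub>R z' p) \<in> L2 (cylinder \<Omega> T)" "(\<lambda>p. f p + c *\<^sub>R f' p) \<in> L2 (cylinder \<Omega> T)"
    using d by (auto intro!: L2_add L2_scaleR simp del: real_scaleR_def)
  moreover have "\<forall>t\<in>{0..T}. (\<lambda>x. z (x, t) + c *\<^sub>R z' (x, t)) \<in> L2 \<Omega>"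
    using d by (auto intro!: L2_add L2_scaleR simp del: real_scaleR_def)
  ultimately show ?thesis unfolding forced_solution_def by blast
qed

text \<open>Take \<Psi> = (z, G) and \<Phi> = (f - b z, - a G). A vanishing residual then says that
  the inner product of z(t) with w is the integral of \<Phi> against (w, Dw) up to time t. Since a
  \<ge> 0, the inner product of \<Phi> and \<Psi> is f z - b z^2 - a |G|^2 \<le> f z + B
  z^2.\<close>

lemma forced_solution_estimate:
  assumes \<Omega>: "\<Omega> \<in> sets borel" and T: "T > 0"
    and a: "a \<in> Linfty (cylinder \<Omega> T)" "AE p\<in>cylinder \<Omega> T in lborel. a p \<ge> 0"
    and b: "b \<in> Linfty (cylinder \<Omega> T)" "AE p\<in>cylinder \<Omega> T in lborel. norm (b p) \<le> B" and B: "B \<ge> 0"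
    and sol: "forced_solution \<Omega> T a b f z"
  shows "sq_norm lborel (\<lambda>p. indicator (cylinder \<Omega> T) p *\<^sub>R z p)
    \<le> exp ((2 * B + 2) * T) * sq_norm lborel (\<lambda>p. indicator (cylinder \<Omega> T) p *\<^sub>R f p)"
proof -
  define Q where "Q = cylinder \<Omega> T"
  note d = sol[unfolded forced_solution_def]
  obtain G where G: "G \<in> L2 Q"
    "AE t\<in>{0<..<T} in lborel. H10_span \<Omega> (\<lambda>x. z (x, t)) (\<lambda>x. G (x, t))"
    "\<And>w Dw t. H10_span \<Omega> w Dw \<Longrightarrow> t \<in> {0..T} \<Longrightarrow>
      weak_residual \<Omega> z (\<lambda>p. a p *\<^sub>R G p) (\<lambda>p. b p *\<^sub>R z p - f p) w Dw t = 0"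
    using d unfolding Q_def by blast
  have z: "z \<in> L2 Q" and f: "f \<in> L2 Q" using d by (auto simp: Q_def)
  have aG: "(\<lambda>p. a p *\<^sub>R G p) \<in> L2 Q" using L2_Linfty_scaleR[OF a(1)] G(1) by (simp add: Q_def)
  have bz: "(\<lambda>p. b p *\<^sub>R z p) \<in> L2 Q" using z unfolding Q_def by (rule L2_Linfty_scaleR[OF b(1)])
  have g: "(\<lambda>p. b p *\<^sub>R z p - f p) \<in> L2 Q" by (rule L2_diff[OF bz f])
  have pair: "(\<lambda>p. (u p, v p)) \<in> L2 S" if "u \<in> L2 S" "v \<in> L2 S"
    for u :: "'z::euclidean_space \<Rightarrow> real" and v :: "'z \<Rightarrow> 'a" and S
  proof -
    have "sq_integrable lborel (\<lambda>p. (indicator S p *\<^sub>R u p, 0 :: 'a))"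
      by (rule sq_integrable_bound[of _ "\<lambda>p. indicator S p *\<^sub>R u p" _ 1])
         (use that in \<open>auto simp: L2_iff sq_integrable_def norm_Pair intro!: borel_measurable_Pair\<close>)
    moreover have "sq_integrable lborel (\<lambda>p. (0 :: real, indicator S p *\<^sub>R v p))"
      by (rule sq_integrable_bound[of _ "\<lambda>p. indicator S p *\<^sub>R v p" _ 1])
         (use that in \<open>auto simp: L2_iff sq_integrable_def norm_Pair intro!: borel_measurable_Pair\<close>)
    ultimately have "sq_integrable lborel (\<lambda>p. (indicator S p *\<^sub>R u p, 0 :: 'a) + (0, indicator S p *\<^sub>R v p))"
      by (rule sq_integrable_add)
    then show ?thesis by (simp add: L2_iff)
  qed
  define \<Psi> where "\<Psi> p = indicator Q p *\<^sub>R (z p, G p)" for p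
  define \<Phi> where "\<Phi> p = indicator Q p *\<^sub>R (- (b p *\<^sub>R z p - f p), - (a p *\<^sub>R G p))" for p
  have \<Psi>: "sq_integrable lborel \<Psi>"
    using pair[OF z G(1)] by (simp add: \<Psi>_def[abs_def] L2_iff)
  have \<Phi>: "sq_integrable lborel \<Phi>"
    using pair[OF L2_scaleR[OF g, of "-1"] L2_scaleR[OF aG, of "-1"]] by (simp add: \<Phi>_def[abs_def] L2_iff)
  define f1 where "f1 p = indicator Q p *\<^sub>R f p" for p
  have f1: "sq_integrable lborel f1" using f by (simp add: f1_def[abs_def] L2_iff)
  have supp: "\<Phi> (x, t) = 0 \<and> \<Psi> (x, t) = 0" if "t \<notin> {0<..<T}" for x t
    using that by (auto simp: \<Phi>_def \<Psi>_def Q_def cylinder_def indicator_def zero_prod_def)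
  have low: "AE p in lborel. \<Phi> p \<bullet> \<Psi> p \<le> f1 p * fst (\<Psi> p) + B * (fst (\<Psi> p))\<^sup>2"
    using a(2) b(2)
  proof eventually_elim
    case (elim p)
    show ?case
    proof (cases "p \<in> Q")
      case True
      then have ab: "a p \<ge> 0" "- b p \<le> B" using elim by (auto simp: Q_def)
      have "a p * (G p \<bullet> G p) \<ge> 0" using ab by simp
      moreover have "- b p * (z p)\<^sup>2 \<le> B * (z p)\<^sup>2" using ab by (intro mult_right_mono) auto
      ultimately show ?thesis using True
        by (simp add: \<Phi>_def \<Psi>_def f1_def power2_eq_square algebra_simps)
    qed (simp add: \<Phi>_def \<Psi>_def)
  qed
  have tested: "AE \<tau>\<in>{0<..<T} in lborel. sq_integrable lborel (\<lambda>x. \<Psi> (x, \<tau>)) \<and>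
      (\<forall>t\<in>{0<..<T}. (\<integral>x. fst (\<Psi> (x, t)) * fst (\<Psi> (x, \<tau>)) \<partial>lborel)
        = (\<integral>p. indicator {..<t} (snd p) * (\<Phi> p \<bullet> \<Psi> (fst p, \<tau>)) \<partial>lborel))"
    using G(2)
  proof eventually_elim
    case (elim \<tau>)
    show ?case
    proof (intro impI conjI ballI)
      assume \<tau>: "\<tau> \<in> {0<..<T}"
      \<comment> \<open>Freezing the time at \<tau> gives a test pair depending on \<open>x\<close>
        alone.\<close>
      define w Dw where "w x = z (x, \<tau>)" and "Dw x = G (x, \<tau>)" for x
      have H: "H10_span \<Omega> w Dw" using elim \<tau> by (simp add: w_def[abs_def] Dw_def[abs_def])
      then have w: "w \<in> L2 \<Omega>" "Dw \<in> L2 \<Omega>" using H10_span_L2 by auto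
      have \<Psi>\<tau>: "\<Psi> (x, s) = indicator \<Omega> x *\<^sub>R (z (x, s), G (x, s))" if "s \<in> {0<..<T}" for x s
        using that by (auto simp: \<Psi>_def Q_def cylinder_def indicator_def)
      show "sq_integrable lborel (\<lambda>x. \<Psi> (x, \<tau>))"
        using pair[OF w] \<tau> by (simp add: \<Psi>\<tau> L2_iff w_def Dw_def)
      fix t assume t: "t \<in> {0<..<T}"
      then have tT: "t \<le> T" by simp
      note ci = cylinder_inner_integrable[OF \<Omega> _ _ tT, folded Q_def]
      have "(\<integral>p. indicator {..<t} (snd p) * (\<Phi> p \<bullet> \<Psi> (fst p, \<tau>)) \<partial>lborel)
        = (LINT p:cylinder \<Omega> t|lborel. - ((a p *\<^sub>R G p) \<bullet> Dw (fst p) + (b p *\<^sub>R z p - f p) \<bullet> w (fst p)))"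
        unfolding set_lebesgue_integral_def
        by (rule Bochner_Integration.integral_cong)
           (use t \<tau> in \<open>auto simp: \<Phi>_def \<Psi>\<tau> cylinder_def Q_def w_def Dw_def indicator_def algebra_simps\<close>)
      also have "\<dots> = - (LINT p:cylinder \<Omega> t|lborel. (a p *\<^sub>R G p) \<bullet> Dw (fst p) + (b p *\<^sub>R z p - f p) \<bullet> w (fst p))"
        by (rule set_integral_uminus, rule set_integral_add(1)[OF ci[OF aG w(2)] ci[OF g w(1)]])
      also have "\<dots> = - ((LINT p:cylinder \<Omega> t|lborel. (a p *\<^sub>R G p) \<bullet> Dw (fst p))
          + (LINT p:cylinder \<Omega> t|lborel. (b p *\<^sub>R z p - f p) \<bullet> w (fst p)))"
        by (subst set_integral_add(2)[OF ci[OF aG w(2)] ci[OF g w(1)]]) (rule refl)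
      also have "\<dots> = (LINT x:\<Omega>|lborel. z (x, t) \<bullet> w x)"
        using G(3)[OF H, of t] t by (simp add: weak_residual_def)
      also have "\<dots> = (\<integral>x. fst (\<Psi> (x, t)) * fst (\<Psi> (x, \<tau>)) \<partial>lborel)"
        unfolding set_lebesgue_integral_def
        by (rule Bochner_Integration.integral_cong) (use t \<tau> in \<open>auto simp: \<Psi>\<tau> w_def indicator_def\<close>)
      finally show "(\<integral>x. fst (\<Psi> (x, t)) * fst (\<Psi> (x, \<tau>)) \<partial>lborel)
        = (\<integral>p. indicator {..<t} (snd p) * (\<Phi> p \<bullet> \<Psi> (fst p, \<tau>)) \<partial>lborel)" ..
    qed
  qed
  from energy_estimate_lborel[OF T B \<Phi> \<Psi> f1 supp low tested]
  show ?thesis by (simp add: \<Psi>_def f1_def[abs_def] Q_def)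
qed

section \<open>The penalized problems\<close>

lemma sq_integrable_Pair:
  fixes u v :: "'c \<Rightarrow> real"
  assumes "sq_integrable M u" "sq_integrable M v"
  shows "sq_integrable M (\<lambda>p. (u p, v p))" "sq_norm M (\<lambda>p. (u p, v p)) = sq_norm M u + sq_norm M v"
proof -
  have "(norm (u p, v p))\<^sup>2 = (norm (u p))\<^sup>2 + (norm (v p))\<^sup>2" for p
    by (simp add: norm_Pair)
  then show "sq_integrable M (\<lambda>p. (u p, v p))" "sq_norm M (\<lambda>p. (u p, v p)) = sq_norm M u + sq_norm M v"
    using assms by (auto simp: sq_integrable_def sq_norm_def intro!: borel_measurable_Pair)
qed

lemma sq_norm_mono:
  assumes "sq_integrable M f" "g \<in> borel_measurable M" "\<And>x. norm (g x) \<le> C * norm (f x)"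
  shows "sq_norm M g \<le> C\<^sup>2 * sq_norm M f"
proof -
  have "sq_norm M g \<le> (\<integral>x. C\<^sup>2 * (norm (f x))\<^sup>2 \<partial>M)"
    unfolding sq_norm_def
  proof (rule integral_mono)
    show "integrable M (\<lambda>x. (norm (g x))\<^sup>2)"
      using sq_integrable_bound[OF assms(1,2), of C] assms(3) by (simp add: sq_integrable_def)
    show "(norm (g x))\<^sup>2 \<le> C\<^sup>2 * (norm (f x))\<^sup>2" for x
      using power_mono[OF assms(3)[of x] norm_ge_zero, of 2] by (simp add: power_mult_distrib)
  qed (use assms(1) in \<open>simp add: sq_integrable_def\<close>)
  then show ?thesis by (simp add: sq_norm_def)
qed

lemma set_borel_measurable_mult_lborel:
  fixes f g :: "'c::euclidean_space \<Rightarrow> real"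
  assumes "set_borel_measurable lborel S f" "set_borel_measurable lborel S g"
  shows "(\<lambda>x. indicator S x *\<^sub>R (f x * g x)) \<in> borel_measurable lborel"
proof -
  have "(\<lambda>x. (indicator S x *\<^sub>R f x) * (indicator S x *\<^sub>R g x)) \<in> borel_measurable lborel"
    using assms unfolding set_borel_measurable_def by (rule borel_measurable_times)
  also have "(\<lambda>x. (indicator S x *\<^sub>R f x) * (indicator S x *\<^sub>R g x)) = (\<lambda>x. indicator S x *\<^sub>R (f x * g x))"
    by (auto simp: indicator_def)
  finally show ?thesis .
qed

text \<open>\<open>M_mid\<close> and \<open>M_bound\<close> are what remains of linearity and
  boundedness. The parallelogram identity needs midpoints only, and the bound is stated for
  differences of states because \<open>M v - M w\<close> agrees with the state of
  \<open>v - w\<close> only almost everywhere. The lower bound \<open>r0\<close> lets the norm of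
  the control space dominate that of L^2.\<close>

locale penalized_control =
  fixes Q Qw :: "('a::euclidean_space \<times> real) set"
    and \<rho> \<rho>0 ybar :: "'a \<times> real \<Rightarrow> real"
    and M :: "('a \<times> real \<Rightarrow> real) \<Rightarrow> 'a \<times> real \<Rightarrow> real"
    and r0 D :: real
  assumes Q_sets: "Q \<in> sets borel" "Qw \<in> sets borel"
    and \<rho>_meas: "set_borel_measurable lborel Q \<rho>"
    and \<rho>0_meas: "set_borel_measurable lborel Qw \<rho>0"
    and \<rho>_pos: "\<And>p. p \<in> Q \<Longrightarrow> 0 < \<rho> p"
    and r0: "r0 > 0" "\<And>p. p \<in> Qw \<Longrightarrow> r0 \<le> \<rho>0 p"
    and ybar_L2: "ybar \<in> L2 Q"
    and M_L2: "\<And>v. v \<in> L2 Qw \<Longrightarrow> M v \<in> L2 Q"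
    and M_mid: "\<And>v w. v \<in> L2 Qw \<Longrightarrow> w \<in> L2 Qw \<Longrightarrow>
      AE p\<in>Q in lborel. M (\<lambda>z. (1/2) *\<^sub>R (v z + w z)) p = (1/2) *\<^sub>R (M v p + M w p)"
    and M_bound: "\<And>v w. v \<in> L2 Qw \<Longrightarrow> w \<in> L2 Qw \<Longrightarrow>
      sq_norm lborel (\<lambda>p. indicator Q p *\<^sub>R (M v p - M w p))
        \<le> D * sq_norm lborel (\<lambda>p. indicator Qw p *\<^sub>R (v p - w p))"
begin

abbreviation "U \<equiv> weighted_L2 Qw \<rho>0"
abbreviation "I \<equiv> cost_I Q Qw \<rho> \<rho>0 M ybar"
abbreviation "J \<equiv> cost_J Q Qw \<rho> \<rho>0"
abbreviation "pairs \<equiv> controlled_pairs Q Qw \<rho> \<rho>0 M ybar"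
abbreviation "state v \<equiv> (\<lambda>z. M v z + ybar z)"

section \<open>The truncated cost as a squared norm\<close>

definition obs :: "real \<Rightarrow> ('a \<times> real \<Rightarrow> real) \<Rightarrow> 'a \<times> real \<Rightarrow> real" where
  "obs R y p = indicator Q p *\<^sub>R (min R (\<rho> p) * y p)"

definition ctl :: "('a \<times> real \<Rightarrow> real) \<Rightarrow> 'a \<times> real \<Rightarrow> real" where
  "ctl v p = indicator Qw p *\<^sub>R (\<rho>0 p * v p)"

text \<open>I_R is half the squared L^2 norm of \<open>E R v\<close>, so its minimization is a
  search for the element of least norm in a midpoint-closed family in L^2. The second component
  alone carries the norm of the control space.\<close>

definition E :: "real \<Rightarrow> ('a \<times> real \<Rightarrow> real) \<Rightarrow> 'a \<times> real \<Rightarrow> real \<times> real" where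
  "E R v p = (obs R (state v) p, ctl v p)"

lemma U_L2: "v \<in> U \<Longrightarrow> v \<in> L2 Qw" by (simp add: weighted_L2_def)

lemma state_L2: "v \<in> L2 Qw \<Longrightarrow> state v \<in> L2 Q"
  by (intro L2_add M_L2 ybar_L2)

lemma ctl_sq: "v \<in> U \<Longrightarrow> sq_integrable lborel (ctl v)"
  unfolding ctl_def[abs_def] by (simp add: weighted_L2_def L2_iff)

lemma min_rho_meas: "set_borel_measurable lborel Q (\<lambda>p. min R (\<rho> p))"
proof -
  have [measurable]: "Q \<in> sets borel" "(\<lambda>p. indicator Q p *\<^sub>R \<rho> p) \<in> borel_measurable borel"
    using Q_sets \<rho>_meas by (auto simp: set_borel_measurable_def)
  have "(\<lambda>p. indicator Q p *\<^sub>R min R (indicator Q p *\<^sub>R \<rho> p)) \<in> borel_measurable lborel" by measurable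
  also have "(\<lambda>p. indicator Q p *\<^sub>R min R (indicator Q p *\<^sub>R \<rho> p)) = (\<lambda>p. indicator Q p *\<^sub>R min R (\<rho> p))"
    by (auto simp: indicator_def)
  finally show ?thesis by (simp add: set_borel_measurable_def)
qed

lemma obs_le:
  assumes "R > 0"
  shows "norm (obs R y p) \<le> R * norm (indicator Q p *\<^sub>R y p)"
  using \<rho>_pos[of p] assms by (cases "p \<in> Q") (auto simp: obs_def abs_mult intro!: mult_right_mono)

lemma obs_meas: "y \<in> L2 Q \<Longrightarrow> obs R y \<in> borel_measurable lborel"
  unfolding obs_def[abs_def]
  by (rule set_borel_measurable_mult_lborel[OF min_rho_meas]) (simp add: L2_def)

lemma obs_sq: "R > 0 \<Longrightarrow> y \<in> L2 Q \<Longrightarrow> sq_integrable lborel (obs R y)"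
  by (rule sq_integrable_bound[of _ "\<lambda>p. indicator Q p *\<^sub>R y p" _ R], erule L2_iff[THEN iffD1],
      erule obs_meas, rule AE_I2, erule obs_le)

lemma E_sq: "R > 0 \<Longrightarrow> v \<in> U \<Longrightarrow> sq_integrable lborel (E R v)"
  unfolding E_def[abs_def] by (intro sq_integrable_Pair obs_sq ctl_sq state_L2 U_L2)

lemma sq_norm_E: "R > 0 \<Longrightarrow> v \<in> U \<Longrightarrow>
    sq_norm lborel (E R v) = sq_norm lborel (obs R (state v)) + sq_norm lborel (ctl v)"
  unfolding E_def[abs_def] by (intro sq_integrable_Pair obs_sq ctl_sq state_L2 U_L2)

lemma set_integral_sq: "(LINT z:S|lborel. (f z)\<^sup>2 * (g z)\<^sup>2) = sq_norm lborel (\<lambda>z. indicator S z *\<^sub>R (f z * g z))"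
  for f g :: "'a \<times> real \<Rightarrow> real"
  unfolding set_lebesgue_integral_def sq_norm_def
  by (rule Bochner_Integration.integral_cong) (auto simp: indicator_def power_mult_distrib)

lemma I_eq: "I R v = 1/2 * sq_norm lborel (obs R (state v)) + 1/2 * sq_norm lborel (ctl v)"
  by (simp add: cost_I_def set_integral_sq obs_def[abs_def] ctl_def[abs_def])

lemma I_E: "R > 0 \<Longrightarrow> v \<in> U \<Longrightarrow> I R v = 1/2 * sq_norm lborel (E R v)"
  by (simp add: I_eq sq_norm_E)

lemma J_eq: "J (y, v) = 1/2 * sq_norm lborel (\<lambda>p. indicator Q p *\<^sub>R (\<rho> p * y p)) + 1/2 * sq_norm lborel (ctl v)"
  by (simp add: cost_J_def set_integral_sq ctl_def[abs_def])

lemma mid_U: "v \<in> U \<Longrightarrow> w \<in> U \<Longrightarrow> (\<lambda>z. (1/2) *\<^sub>R (v z + w z)) \<in> U"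
  unfolding weighted_L2_def
proof (safe, goal_cases)
  case 1
  show ?case by (intro L2_scaleR L2_add 1)
next
  case 2
  have "(\<lambda>z. (1/2) *\<^sub>R (\<rho>0 z * v z + \<rho>0 z * w z)) \<in> L2 Qw" by (intro L2_scaleR L2_add 2)
  also have "(\<lambda>z. (1/2) *\<^sub>R (\<rho>0 z * v z + \<rho>0 z * w z)) = (\<lambda>z. \<rho>0 z * ((1/2) *\<^sub>R (v z + w z)))"
    by (simp add: fun_eq_iff field_simps)
  finally show ?case .
qed

lemma E_mid:
  assumes "v \<in> U" "w \<in> U"
  shows "AE p in lborel. E R (\<lambda>z. (1/2) *\<^sub>R (v z + w z)) p = (1/2) *\<^sub>R (E R v p + E R w p)"
  using M_mid[OF U_L2[OF assms(1)] U_L2[OF assms(2)]]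
proof eventually_elim
  case (elim p)
  show ?case
    using elim by (cases "p \<in> Q") (auto simp: E_def obs_def ctl_def algebra_simps)
qed

lemma I_gap:
  assumes R: "R > 0" and v: "v \<in> U" and w: "w \<in> U" and min: "\<And>u. u \<in> U \<Longrightarrow> I R w \<le> I R u"
  shows "sq_norm lborel (\<lambda>p. ctl v p - ctl w p) \<le> 4 * (I R v - I R w)"
proof -
  let ?m = "\<lambda>z. (1/2) *\<^sub>R (v z + w z)"
  note s = E_sq[OF R v] E_sq[OF R w]
  have "sq_norm lborel (\<lambda>p. ctl v p - ctl w p) \<le> 1\<^sup>2 * sq_norm lborel (\<lambda>p. E R v p - E R w p)"
    by (rule sq_norm_mono[OF sq_integrable_diff[OF s]])
       (use ctl_sq[OF v] ctl_sq[OF w] in \<open>auto simp: sq_integrable_def E_def norm_Pair real_le_rsqrt\<close>)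
  also have "\<dots> = 2 * sq_norm lborel (E R v) + 2 * sq_norm lborel (E R w)
      - 4 * sq_norm lborel (\<lambda>p. (1/2) *\<^sub>R (E R v p + E R w p))"
    using sq_norm_parallelogram[OF s] by simp
  also have "sq_norm lborel (\<lambda>p. (1/2) *\<^sub>R (E R v p + E R w p)) = sq_norm lborel (E R ?m)"
    by (rule sq_norm_cong_AE)
       (use E_mid[OF v w, of R] s E_sq[OF R mid_U[OF v w]] in
         \<open>auto simp: sq_integrable_def intro!: borel_measurable_scaleR borel_measurable_add\<close>)
  \<comment> \<open>In terms of the cost, the right side is 4 I_R(v) + 4 I_R(w) - 8 I_R(?m), and the
    midpoint costs at least I_R(w).\<close>
  finally show ?thesis
    using min[OF mid_U[OF v w]] I_E[OF R v] I_E[OF R w] I_E[OF R mid_U[OF v w]] by simp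
qed

lemma ctl_L2_dist:
  assumes "v \<in> U" "w \<in> U"
  shows "sq_norm lborel (\<lambda>p. indicator Qw p *\<^sub>R (v p - w p)) \<le> (1/r0)\<^sup>2 * sq_norm lborel (\<lambda>p. ctl v p - ctl w p)"
proof (rule sq_norm_mono[OF sq_integrable_diff[OF ctl_sq[OF assms(1)] ctl_sq[OF assms(2)]]])
  show "(\<lambda>p. indicator Qw p *\<^sub>R (v p - w p)) \<in> borel_measurable lborel"
    using L2_diff[OF U_L2[OF assms(1)] U_L2[OF assms(2)]] by (simp add: L2_def set_borel_measurable_def)
  fix p
  show "norm (indicator Qw p *\<^sub>R (v p - w p)) \<le> 1 / r0 * norm (ctl v p - ctl w p)"
  proof (cases "p \<in> Qw")
    case True
    have "r0 * \<bar>v p - w p\<bar> \<le> \<rho>0 p * \<bar>v p - w p\<bar>" by (intro mult_right_mono r0(2)[OF True]) simp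
    also have "\<dots> = \<bar>\<rho>0 p * v p - \<rho>0 p * w p\<bar>"
      using r0(1) r0(2)[OF True] by (simp add: abs_mult flip: right_diff_distrib)
    finally show ?thesis using True r0(1) by (simp add: ctl_def field_simps)
  qed (simp add: ctl_def)
qed

lemma state_dist:
  assumes v: "v \<in> U" and w: "w \<in> U"
  shows "sq_norm lborel (\<lambda>p. indicator Q p *\<^sub>R (M v p - M w p))
    \<le> \<bar>D\<bar> * (1/r0)\<^sup>2 * sq_norm lborel (\<lambda>p. ctl v p - ctl w p)"
proof -
  have "sq_norm lborel (\<lambda>p. indicator Q p *\<^sub>R (M v p - M w p))
      \<le> D * sq_norm lborel (\<lambda>p. indicator Qw p *\<^sub>R (v p - w p))"
    by (rule M_bound[OF U_L2[OF v] U_L2[OF w]])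
  also have "\<dots> \<le> \<bar>D\<bar> * sq_norm lborel (\<lambda>p. indicator Qw p *\<^sub>R (v p - w p))"
    by (intro mult_right_mono) auto
  also have "\<dots> \<le> \<bar>D\<bar> * ((1/r0)\<^sup>2 * sq_norm lborel (\<lambda>p. ctl v p - ctl w p))"
    by (intro mult_left_mono ctl_L2_dist[OF v w]) auto
  finally show ?thesis by simp
qed

text \<open>The truncated weight is at most \<open>R\<close>, so the state term is controlled by the
  control term. The constant grows with \<open>R\<close>: this is continuity of \<open>E R\<close>
  for each fixed \<open>R\<close>, not uniformly.\<close>

lemma E_dist:
  assumes R: "R > 0" and v: "v \<in> U" and w: "w \<in> U"
  shows "sq_norm lborel (\<lambda>p. E R v p - E R w p)
    \<le> (R\<^sup>2 * (\<bar>D\<bar> * (1/r0)\<^sup>2) + 1) * sq_norm lborel (\<lambda>p. ctl v p - ctl w p)"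
proof -
  note o = obs_sq[OF R state_L2[OF U_L2[OF v]]] obs_sq[OF R state_L2[OF U_L2[OF w]]]
  note d = sq_integrable_diff[OF o] sq_integrable_diff[OF ctl_sq[OF v] ctl_sq[OF w]]
  have "sq_norm lborel (\<lambda>p. E R v p - E R w p)
     = sq_norm lborel (\<lambda>p. obs R (state v) p - obs R (state w) p) + sq_norm lborel (\<lambda>p. ctl v p - ctl w p)"
    unfolding E_def using sq_integrable_Pair(2)[OF d] by simp
  also have "sq_norm lborel (\<lambda>p. obs R (state v) p - obs R (state w) p)
      \<le> R\<^sup>2 * sq_norm lborel (\<lambda>p. indicator Q p *\<^sub>R (M v p - M w p))"
  proof (rule sq_norm_mono)
    show "sq_integrable lborel (\<lambda>p. indicator Q p *\<^sub>R (M v p - M w p))"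
      using L2_diff[OF M_L2[OF U_L2[OF v]] M_L2[OF U_L2[OF w]]] by (simp add: L2_iff)
    show "(\<lambda>p. obs R (state v) p - obs R (state w) p) \<in> borel_measurable lborel"
      using d(1) by (simp add: sq_integrable_def)
    have "obs R (state v) p - obs R (state w) p = obs R (\<lambda>p. M v p - M w p) p" for p
      by (simp add: obs_def algebra_simps)
    then show "norm (obs R (state v) p - obs R (state w) p) \<le> R * norm (indicator Q p *\<^sub>R (M v p - M w p))" for p
      using obs_le[OF R] by simp
  qed
  also have "R\<^sup>2 * sq_norm lborel (\<lambda>p. indicator Q p *\<^sub>R (M v p - M w p))
      \<le> R\<^sup>2 * (\<bar>D\<bar> * (1/r0)\<^sup>2 * sq_norm lborel (\<lambda>p. ctl v p - ctl w p))"
    by (intro mult_left_mono state_dist[OF v w]) auto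
  finally show ?thesis by (simp add: algebra_simps)
qed

text \<open>The limit in L^2 can be divided by \<rho>0, which is bounded below on \<open>Qw\<close>,
  and the quotient remains in L^2.\<close>

lemma U_complete:
  assumes u: "\<And>n::nat. u n \<in> U"
    and cauchy: "\<And>e. e > 0 \<Longrightarrow> \<exists>N. \<forall>m\<ge>N. \<forall>n\<ge>N. sq_norm lborel (\<lambda>p. ctl (u m) p - ctl (u n) p) \<le> e"
  obtains v where "v \<in> U" "(\<lambda>n. sq_norm lborel (\<lambda>p. ctl (u n) p - ctl v p)) \<longlonglongrightarrow> 0"
proof -
  obtain g where g: "sq_integrable lborel g" "(\<lambda>n. sq_norm lborel (\<lambda>p. ctl (u n) p - g p)) \<longlonglongrightarrow> 0"
    using sq_integrable_complete[of lborel "\<lambda>n. ctl (u n)", OF ctl_sq[OF u] cauchy] by blast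
  have [measurable]: "g \<in> borel_measurable borel" "Qw \<in> sets borel"
    "(\<lambda>p. indicator Qw p *\<^sub>R \<rho>0 p) \<in> borel_measurable borel"
    using g(1) Q_sets \<rho>0_meas by (auto simp: sq_integrable_def set_borel_measurable_def)
  define v where "v p = g p / \<rho>0 p" for p
  have ctl_v: "ctl v p = indicator Qw p *\<^sub>R g p" for p
    using r0(1) r0(2)[of p] by (auto simp: ctl_def v_def indicator_def)
  have gQ: "sq_integrable lborel (\<lambda>p. indicator Qw p *\<^sub>R g p)"
  proof (rule sq_integrable_bound[OF g(1), where C = 1])
    show "(\<lambda>p. indicator Qw p *\<^sub>R g p) \<in> borel_measurable lborel" by measurable
  qed (auto simp: indicator_def)
  have "sq_integrable lborel (\<lambda>p. indicator Qw p *\<^sub>R v p)"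
  proof (rule sq_integrable_bound[OF gQ, where C = "1 / r0"])
    \<comment> \<open>Off \<open>Qw\<close> the quotient is 0/0 = 0, so it coincides everywhere with
      \<open>v\<close> cut off to \<open>Qw\<close>.\<close>
    have "(\<lambda>p. (indicator Qw p *\<^sub>R g p) / (indicator Qw p *\<^sub>R \<rho>0 p)) \<in> borel_measurable lborel" by measurable
    also have "(\<lambda>p. (indicator Qw p *\<^sub>R g p) / (indicator Qw p *\<^sub>R \<rho>0 p)) = (\<lambda>p. indicator Qw p *\<^sub>R v p)"
      by (auto simp: indicator_def v_def)
    finally show "(\<lambda>p. indicator Qw p *\<^sub>R v p) \<in> borel_measurable lborel" .
    have "norm (indicator Qw p *\<^sub>R v p) \<le> 1 / r0 * norm (indicator Qw p *\<^sub>R g p)" for p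
    proof (cases "p \<in> Qw")
      case True
      then have "\<bar>g p\<bar> / \<rho>0 p \<le> \<bar>g p\<bar> / r0" using r0(1) r0(2)[OF True] by (intro divide_left_mono) auto
      then show ?thesis using True r0(1) r0(2)[OF True] by (simp add: v_def abs_divide)
    qed simp
    then show "AE p in lborel. norm (indicator Qw p *\<^sub>R v p) \<le> 1 / r0 * norm (indicator Qw p *\<^sub>R g p)" by simp
  qed
  moreover have "sq_integrable lborel (\<lambda>p. indicator Qw p *\<^sub>R (\<rho>0 p * v p))"
    using gQ unfolding ctl_v[symmetric] ctl_def .
  ultimately have v: "v \<in> U" by (simp add: weighted_L2_def L2_iff)
  \<comment> \<open>\<open>ctl v\<close> is \<open>g\<close> restricted to \<open>Qw\<close>, off
    which each \<open>ctl (u n)\<close> vanishes; the restriction does not increase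
    distances.\<close>
  have "(\<lambda>n. sq_norm lborel (\<lambda>p. ctl (u n) p - ctl v p)) \<longlonglongrightarrow> 0"
  proof (rule tendsto_sandwich[OF _ _ tendsto_const g(2)])
    have "sq_norm lborel (\<lambda>p. ctl (u n) p - ctl v p) \<le> 1\<^sup>2 * sq_norm lborel (\<lambda>p. ctl (u n) p - g p)" for n
    proof (rule sq_norm_mono[OF sq_integrable_diff[OF ctl_sq[OF u] g(1)]])
      show "(\<lambda>p. ctl (u n) p - ctl v p) \<in> borel_measurable lborel"
        using sq_integrable_diff[OF ctl_sq[OF u] ctl_sq[OF v]] by (simp add: sq_integrable_def)
      show "norm (ctl (u n) p - ctl v p) \<le> 1 * norm (ctl (u n) p - g p)" for p
        unfolding ctl_v by (auto simp: ctl_def indicator_def)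
    qed
    then show "\<forall>\<^sub>F n in sequentially. sq_norm lborel (\<lambda>p. ctl (u n) p - ctl v p) \<le> sq_norm lborel (\<lambda>p. ctl (u n) p - g p)"
      by simp
  qed simp
  with v show thesis by (rule that)
qed

lemma E_tendsto:
  assumes R: "R > 0" and u: "\<And>n::nat. u n \<in> U" and v: "v \<in> U"
    and lim: "(\<lambda>n. sq_norm lborel (\<lambda>p. ctl (u n) p - ctl v p)) \<longlonglongrightarrow> 0"
  shows "(\<lambda>n. sq_norm lborel (\<lambda>p. E R (u n) p - E R v p)) \<longlonglongrightarrow> 0"
  by (rule tendsto_sandwich[OF _ _ tendsto_const tendsto_mult_right_zero[OF lim]])
     (auto intro!: always_eventually E_dist[OF R u v])

text \<open>The point is closedness of the image of \<open>E R\<close>. Convergence to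
  \<open>g\<close> makes the second components Cauchy, completeness of the control space yields
  \<open>v\<close>, and continuity of \<open>E R\<close> identifies \<open>E R v\<close> with
  \<open>g\<close> almost everywhere.\<close>

lemma I_minimizer_exists:
  assumes R: "R > 0"
  shows "\<exists>v\<in>U. \<forall>w\<in>U. I R v \<le> I R w"
proof -
  have "\<exists>v\<in>U. \<forall>w\<in>U. sq_norm lborel (E R v) \<le> sq_norm lborel (E R w)"
  proof (rule min_sq_norm_exists)
    have "(\<lambda>_. 0) \<in> U" by (simp add: weighted_L2_def L2_iff sq_integrable_def)
    then show "U \<noteq> {}" by blast
    show "sq_integrable lborel (E R v)" if "v \<in> U" for v by (rule E_sq[OF R that])
    show "\<exists>r\<in>U. AE x in lborel. E R r x = (1/2) *\<^sub>R (E R p x + E R q x)" if "p \<in> U" "q \<in> U" for p q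
      using E_mid[OF that] mid_U[OF that] by blast
    fix u g assume u: "\<And>n::nat. u n \<in> U" and g: "sq_integrable lborel g"
      and lim: "(\<lambda>n. sq_norm lborel (\<lambda>x. E R (u n) x - g x)) \<longlonglongrightarrow> 0"
    obtain v where v: "v \<in> U" "(\<lambda>n. sq_norm lborel (\<lambda>p. ctl (u n) p - ctl v p)) \<longlonglongrightarrow> 0"
    proof (rule U_complete[OF u])
      fix e :: real assume e: "e > 0"
      obtain N where N: "\<And>n. n \<ge> N \<Longrightarrow> sq_norm lborel (\<lambda>x. E R (u n) x - g x) < e/4"
        using LIMSEQ_D[OF lim, of "e/4"] e by auto
      have "sq_norm lborel (\<lambda>p. ctl (u m) p - ctl (u n) p) \<le> e" if "m \<ge> N" "n \<ge> N" for m n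
      proof -
        note s = E_sq[OF R u]
        have "sq_norm lborel (\<lambda>p. ctl (u m) p - ctl (u n) p) \<le> 1\<^sup>2 * sq_norm lborel (\<lambda>p. E R (u m) p - E R (u n) p)"
          by (rule sq_norm_mono[OF sq_integrable_diff[OF s s]])
             (use sq_integrable_diff[OF ctl_sq[OF u] ctl_sq[OF u]] in
               \<open>auto simp: sq_integrable_def E_def norm_Pair real_le_rsqrt\<close>)
        also have "\<dots> \<le> 2 * sq_norm lborel (\<lambda>p. E R (u m) p - g p) + 2 * sq_norm lborel (\<lambda>p. g p - E R (u n) p)"
          using sq_norm_diff_le[OF s g s] by simp
        also have "\<dots> \<le> e"
          using N[OF that(1)] N[OF that(2)] sq_norm_minus_commute[of lborel g "E R (u n)"] by simp
        finally show ?thesis .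
      qed
      then show "\<exists>N. \<forall>m\<ge>N. \<forall>n\<ge>N. sq_norm lborel (\<lambda>p. ctl (u m) p - ctl (u n) p) \<le> e" by blast
    qed
    have "sq_norm lborel (\<lambda>p. E R v p - g p) \<le> 0"
    proof (rule tendsto_lowerbound)
      show "(\<lambda>n. 2 * sq_norm lborel (\<lambda>p. E R (u n) p - E R v p) + 2 * sq_norm lborel (\<lambda>x. E R (u n) x - g x)) \<longlonglongrightarrow> 0"
        using tendsto_add[OF tendsto_mult_right_zero[OF E_tendsto[OF R u v], of 2] tendsto_mult_right_zero[OF lim, of 2]]
        by simp
      show "\<forall>\<^sub>F n in sequentially. sq_norm lborel (\<lambda>p. E R v p - g p)
          \<le> 2 * sq_norm lborel (\<lambda>p. E R (u n) p - E R v p) + 2 * sq_norm lborel (\<lambda>x. E R (u n) x - g x)"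
        using sq_norm_diff_le[OF E_sq[OF R v(1)] E_sq[OF R u] g] sq_norm_minus_commute[of lborel "E R v"]
        by (intro always_eventually) simp
    qed simp
    then have "sq_norm lborel (\<lambda>p. E R v p - g p) = 0" using sq_norm_nonneg[of lborel "\<lambda>p. E R v p - g p"] by linarith
    then have "AE p in lborel. E R v p = g p"
      using sq_norm_eq_0_iff[OF sq_integrable_diff[OF E_sq[OF R v(1)] g]] by simp
    then show "\<exists>p\<in>U. AE x in lborel. E R p x = g x" using v(1) by blast
  qed
  then show ?thesis by (auto simp: I_E[OF R])
qed

lemma ctl_eq_AE:
  assumes v: "v \<in> U" and w: "w \<in> U" and "sq_norm lborel (\<lambda>p. ctl v p - ctl w p) \<le> 0"
  shows "AE p\<in>Qw in lborel. v p = w p" "AE p\<in>Q in lborel. M v p = M w p"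
proof -
  have 0: "sq_norm lborel (\<lambda>p. ctl v p - ctl w p) = 0"
    using assms(3) sq_norm_nonneg[of lborel "\<lambda>p. ctl v p - ctl w p"] by linarith
  then have "AE p in lborel. ctl v p - ctl w p = 0"
    using sq_norm_eq_0_iff[OF sq_integrable_diff[OF ctl_sq[OF v] ctl_sq[OF w]]] by simp
  then show "AE p\<in>Qw in lborel. v p = w p"
  proof eventually_elim
    case (elim p)
    show ?case
    proof
      assume "p \<in> Qw"
      then show "v p = w p" using elim r0(1) r0(2)[of p] by (simp add: ctl_def flip: right_diff_distrib)
    qed
  qed
  have "sq_norm lborel (\<lambda>p. indicator Q p *\<^sub>R (M v p - M w p)) = 0"
  proof (rule antisym[OF _ sq_norm_nonneg])
    show "sq_norm lborel (\<lambda>p. indicator Q p *\<^sub>R (M v p - M w p)) \<le> 0"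
      using state_dist[OF v w] unfolding 0 by simp
  qed
  moreover have "sq_integrable lborel (\<lambda>p. indicator Q p *\<^sub>R (M v p - M w p))"
    using L2_diff[OF M_L2[OF U_L2[OF v]] M_L2[OF U_L2[OF w]]] by (simp add: L2_iff)
  ultimately have "AE p in lborel. indicator Q p *\<^sub>R (M v p - M w p) = 0"
    using sq_norm_eq_0_iff by blast
  then show "AE p\<in>Q in lborel. M v p = M w p"
    by eventually_elim (auto simp: indicator_def)
qed

section \<open>Comparison of the truncated costs with \<open>J\<close>\<close>

lemma I_mono:
  assumes R: "0 < R" "R \<le> R'" and v: "v \<in> U"
  shows "I R v \<le> I R' v"
proof -
  note y = state_L2[OF U_L2[OF v]]
  have "sq_norm lborel (obs R (state v)) \<le> 1\<^sup>2 * sq_norm lborel (obs R' (state v))"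
  proof (rule sq_norm_mono[OF obs_sq[OF _ y] obs_meas[OF y]])
    show "norm (obs R (state v) p) \<le> 1 * norm (obs R' (state v) p)" for p
      using R \<rho>_pos[of p] by (cases "p \<in> Q") (auto simp: obs_def abs_mult intro!: mult_right_mono)
  qed (use R in simp)
  then show ?thesis by (simp add: I_eq)
qed

lemma I_le_J:
  assumes R: "R > 0" and yv: "(y, v) \<in> pairs"
  shows "I R v \<le> J (y, v)"
proof -
  have v: "v \<in> U" and y: "y \<in> L2 Q" "sq_integrable lborel (\<lambda>p. indicator Q p *\<^sub>R (\<rho> p * y p))"
    and ae: "AE p\<in>Q in lborel. y p = state v p"
    using yv by (auto simp: controlled_pairs_def weighted_L2_def L2_iff)
  have "sq_norm lborel (obs R (state v)) = sq_norm lborel (obs R y)"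
  proof (rule sq_norm_cong_AE[OF obs_meas[OF state_L2[OF U_L2[OF v]]] obs_meas[OF y(1)]])
    show "AE p in lborel. obs R (state v) p = obs R y p"
      using ae by eventually_elim (auto simp: obs_def indicator_def)
  qed
  also have "\<dots> \<le> 1\<^sup>2 * sq_norm lborel (\<lambda>p. indicator Q p *\<^sub>R (\<rho> p * y p))"
  proof (rule sq_norm_mono[OF y(2) obs_meas[OF y(1)]])
    show "norm (obs R y p) \<le> 1 * norm (indicator Q p *\<^sub>R (\<rho> p * y p))" for p
      using R \<rho>_pos[of p] by (cases "p \<in> Q") (auto simp: obs_def abs_mult intro!: mult_right_mono)
  qed
  finally show ?thesis by (simp add: I_eq J_eq)
qed

text \<open>Converse to \<open>I_le_J\<close>: a bound on I_R(v) uniform in R forces the state into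
  the space weighted by \<rho>. At each point the truncation is inactive once R exceeds the finite
  value of \<rho> there, so Fatou applies along the integers.\<close>

lemma state_pair:
  assumes v: "v \<in> U" and bd: "\<And>R. R > 0 \<Longrightarrow> I R v \<le> m"
  shows "(state v, v) \<in> pairs" "J (state v, v) \<le> m"
proof -
  note y = state_L2[OF U_L2[OF v]]
  let ?g = "\<lambda>p. indicator Q p *\<^sub>R (\<rho> p * state v p)"
  have g: "?g \<in> borel_measurable lborel"
    by (rule set_borel_measurable_mult_lborel[OF \<rho>_meas]) (use y in \<open>simp add: L2_def\<close>)
  have lim: "AE p in lborel. (\<lambda>n. obs (real (Suc n)) (state v) p) \<longlonglongrightarrow> ?g p"
  proof (rule AE_I2)
    fix p
    obtain N where N: "\<rho> p \<le> real N" using real_arch_simple by blast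
    have "\<forall>\<^sub>F n in sequentially. obs (real (Suc n)) (state v) p = ?g p"
      using eventually_ge_at_top[of N]
    proof eventually_elim
      case (elim n)
      then have "\<rho> p \<le> real (Suc n)" using N by simp
      then show ?case by (simp add: obs_def min_absorb2)
    qed
    then show "(\<lambda>n. obs (real (Suc n)) (state v) p) \<longlonglongrightarrow> ?g p" by (rule tendsto_eventually)
  qed
  have "\<forall>\<^sub>F n in sequentially. sq_norm lborel (obs (real (Suc n)) (state v)) \<le> 2 * m - sq_norm lborel (ctl v)"
  proof (intro always_eventually allI)
    fix n
    show "sq_norm lborel (obs (real (Suc n)) (state v)) \<le> 2 * m - sq_norm lborel (ctl v)"
      using bd[of "real (Suc n)"] by (simp add: I_eq)
  qed
  note F = sq_integrable_Fatou[OF obs_sq[OF _ y] g lim this]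
  show "(state v, v) \<in> pairs"
    using v y F(1) by (simp add: controlled_pairs_def weighted_L2_def L2_iff)
  show "J (state v, v) \<le> m" using F(2) by (simp add: J_eq)
qed

lemma I_minimizer_unique:
  assumes R: "R > 0" and v: "v \<in> U" "\<And>u. u \<in> U \<Longrightarrow> I R v \<le> I R u"
    and w: "w \<in> U" "\<And>u. u \<in> U \<Longrightarrow> I R w \<le> I R u"
  shows "AE p\<in>Qw in lborel. v p = w p"
  by (rule ctl_eq_AE(1)[OF v(1) w(1)])
     (use I_gap[OF R v(1) w] v(2)[OF w(1)] w(2)[OF v(1)] in simp)

text \<open>\<open>vh\<close> is built from one selection of minimizers. The last clause covers
  every other selection, because the gap estimate sees a minimizer only through its minimal value. A
  controlled pair supplies the upper bound that makes the minimal values converge.\<close>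

theorem penalized_convergence:
  assumes ne: "pairs \<noteq> {}"
  obtains vh where "vh \<in> U" "(state vh, vh) \<in> pairs" "\<And>p. p \<in> pairs \<Longrightarrow> J (state vh, vh) \<le> J p"
    and "\<And>y v. (y, v) \<in> pairs \<Longrightarrow> J (y, v) \<le> J (state vh, vh) \<Longrightarrow>
      (AE p\<in>Q in lborel. y p = state vh p) \<and> (AE p\<in>Qw in lborel. v p = vh p)"
    and "\<And>vR. (\<And>R. R > 0 \<Longrightarrow> vR R \<in> U \<and> (\<forall>u\<in>U. I R (vR R) \<le> I R u)) \<Longrightarrow>
      ((\<lambda>R. sq_norm lborel (\<lambda>p. ctl (vR R) p - ctl vh p)) \<longlongrightarrow> 0) at_top"
proof -
  have "\<exists>v. R > 0 \<longrightarrow> v \<in> U \<and> (\<forall>w\<in>U. I R v \<le> I R w)" for R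
    using I_minimizer_exists by blast
  then obtain vm where vm: "\<And>R. R > 0 \<Longrightarrow> vm R \<in> U" "\<And>R u. R > 0 \<Longrightarrow> u \<in> U \<Longrightarrow> I R (vm R) \<le> I R u"
    by metis
  define m where "m R = I R (vm R)" for R
  have m_le_J: "m R \<le> J p" if "R > 0" "p \<in> pairs" for R p
  proof -
    obtain y v where p: "p = (y, v)" by force
    then have "v \<in> U" using that by (simp add: controlled_pairs_def)
    then have "m R \<le> I R v" unfolding m_def by (rule vm(2)[OF that(1)])
    also have "\<dots> \<le> J p" using I_le_J[OF that(1)] that(2) p by simp
    finally show ?thesis .
  qed
  have m_mono: "I R (vm R') \<le> m R'" "m R \<le> m R'" if "0 < R" "R \<le> R'" for R R'
  proof -
    have R': "R' > 0" using that by simp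
    show le: "I R (vm R') \<le> m R'" unfolding m_def by (rule I_mono[OF that vm(1)[OF R']])
    have "m R \<le> I R (vm R')" unfolding m_def by (rule vm(2)[OF that(1) vm(1)[OF R']])
    with le show "m R \<le> m R'" by simp
  qed
  \<comment> \<open>Integer parameters suffice because \<open>m\<close> is monotone; the successor
    keeps them positive.\<close>
  define u where "u n = vm (real (Suc n))" for n
  have u: "u n \<in> U" for n unfolding u_def by (rule vm(1)) simp
  define mm where "mm n = m (real (Suc n))" for n
  have inc: "incseq mm" unfolding mm_def by (rule incseq_SucI) (rule m_mono(2), auto)
  obtain p0 where p0: "p0 \<in> pairs" using ne by blast
  obtain ms where ms: "mm \<longlonglongrightarrow> ms" "\<And>n. mm n \<le> ms"
    using incseq_convergent[OF inc, of "J p0"] m_le_J[OF _ p0] unfolding mm_def by (metis of_nat_0_less_iff zero_less_Suc)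
  have ms_le: "ms \<le> J p" if "p \<in> pairs" for p
    by (rule LIMSEQ_le_const2[OF ms(1)]) (use m_le_J[OF _ that] in \<open>auto simp: mm_def\<close>)
  have gap: "sq_norm lborel (\<lambda>p. ctl v p - ctl (vm R) p) \<le> 4 * (I R v - m R)" if "R > 0" "v \<in> U" for R v
    unfolding m_def by (rule I_gap[OF that vm(1)[OF that(1)] vm(2)[OF that(1)]])
  have gap_u: "sq_norm lborel (\<lambda>p. ctl (u k) p - ctl (u n) p) \<le> 4 * (ms - mm n)" if "n \<le> k" for n k
  proof -
    have "I (real (Suc n)) (u k) \<le> mm k"
      unfolding u_def mm_def by (rule m_mono(1)) (use that in auto)
    then show ?thesis
      using gap[of "real (Suc n)" "u k"] u ms(2)[of k] by (simp add: u_def mm_def)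
  qed
  have mm_close: "\<exists>N. \<forall>n\<ge>N. 4 * (ms - mm n) < e" if "e > 0" for e
  proof -
    have "e/4 > 0" using that by simp
    from LIMSEQ_D[OF ms(1) this] obtain N where N: "\<forall>n\<ge>N. norm (mm n - ms) < e/4" by blast
    have "4 * (ms - mm n) < e" if "n \<ge> N" for n
      using N that ms(2)[of n] by (simp add: abs_real_def split: if_splits) fastforce
    then show ?thesis by blast
  qed
  obtain vh where vh: "vh \<in> U" "(\<lambda>n. sq_norm lborel (\<lambda>p. ctl (u n) p - ctl vh p)) \<longlonglongrightarrow> 0"
  proof (rule U_complete[OF u])
    fix e :: real assume "e > 0"
    then obtain N where N: "\<And>n. n \<ge> N \<Longrightarrow> 4 * (ms - mm n) < e" using mm_close by blast
    have "sq_norm lborel (\<lambda>p. ctl (u k) p - ctl (u n) p) \<le> e" if "k \<ge> N" "n \<ge> N" for k n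
    proof (cases "n \<le> k")
      case True
      then show ?thesis using gap_u[OF True] N[OF that(2)] by simp
    next
      case False
      then show ?thesis using gap_u[of k n] N[OF that(1)] sq_norm_minus_commute[of lborel "ctl (u k)"] by simp
    qed
    then show "\<exists>N. \<forall>k\<ge>N. \<forall>n\<ge>N. sq_norm lborel (\<lambda>p. ctl (u k) p - ctl (u n) p) \<le> e" by blast
  qed
  \<comment> \<open>For fixed \<open>R\<close> the continuity of I_R allows the passage to the limit
    in \<open>n\<close>; once \<open>n + 1 \<ge> R\<close>, the cost I_R(u n) is at most
    \<open>mm n\<close>.\<close>
  have I_vh: "I R vh \<le> ms" if R: "R > 0" for R
  proof (rule LIMSEQ_le_const2)
    have "(\<lambda>n. sq_norm lborel (E R (u n))) \<longlonglongrightarrow> sq_norm lborel (E R vh)"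
      by (rule sq_norm_tendsto[OF E_sq[OF R u] E_sq[OF R vh(1)] E_tendsto[OF R u vh]])
    from tendsto_mult[OF tendsto_const this, of "1/2"]
    show "(\<lambda>n. I R (u n)) \<longlonglongrightarrow> I R vh" by (simp add: I_E[OF R] u vh(1))
    obtain N where N: "R \<le> real N" using real_arch_simple by blast
    have "I R (u n) \<le> ms" if "n \<ge> N" for n
    proof -
      have "R \<le> real (Suc n)" using N that by simp
      from m_mono(1)[OF R this] have "I R (u n) \<le> mm n" by (simp add: u_def mm_def)
      then show ?thesis using ms(2)[of n] by simp
    qed
    then show "\<exists>N. \<forall>n\<ge>N. I R (u n) \<le> ms" by blast
  qed
  note sp = state_pair[OF vh(1) I_vh]
  have Jh: "J (state vh, vh) = ms" using sp(2) ms_le[OF sp(1)] by simp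
  show thesis
  proof (rule that[of vh])
    show "vh \<in> U" by (fact vh(1))
    show "(state vh, vh) \<in> pairs" using sp(1) by simp
    show "J (state vh, vh) \<le> J p" if "p \<in> pairs" for p using ms_le[OF that] Jh by simp
  next
    fix y v assume yv: "(y, v) \<in> pairs" "J (y, v) \<le> J (state vh, vh)"
    then have v: "v \<in> U" and y: "AE p\<in>Q in lborel. y p = state v p"
      by (auto simp: controlled_pairs_def)
    have close: "sq_norm lborel (\<lambda>p. ctl w p - ctl (u n) p) \<le> 4 * (ms - mm n)"
      if "w \<in> U" "I (real (Suc n)) w \<le> ms" for w n
      using gap[of "real (Suc n)" w] that by (simp add: u_def mm_def)
    \<comment> \<open>For every R both \<open>v\<close> and \<open>vh\<close> have I_R at most
      \<open>ms\<close>, so both lie within squared distance \<open>4 * (ms - mm n)\<close> of the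
      same \<open>u n\<close>.\<close>
    have "sq_norm lborel (\<lambda>p. ctl v p - ctl vh p) \<le> 0"
    proof (rule field_le_epsilon)
      fix e :: real assume "e > 0"
      then obtain N where N: "\<And>n. n \<ge> N \<Longrightarrow> 4 * (ms - mm n) < e/4" using mm_close[of "e/4"] by auto
      have "I (real (Suc N)) v \<le> ms" using I_le_J[OF _ yv(1), of "real (Suc N)"] yv(2) Jh by simp
      from close[OF v this] close[OF vh(1) I_vh, of N]
      have "2 * sq_norm lborel (\<lambda>p. ctl v p - ctl (u N) p) + 2 * sq_norm lborel (\<lambda>p. ctl (u N) p - ctl vh p) \<le> e"
        using N[of N] sq_norm_minus_commute[of lborel "ctl vh"] by simp
      then show "sq_norm lborel (\<lambda>p. ctl v p - ctl vh p) \<le> 0 + e"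
        using sq_norm_diff_le[OF ctl_sq[OF v] ctl_sq[OF u] ctl_sq[OF vh(1)], of N] by linarith
    qed
    note ae = ctl_eq_AE[OF v vh(1) this]
    show "(AE p\<in>Q in lborel. y p = state vh p) \<and> (AE p\<in>Qw in lborel. v p = vh p)"
    proof
      show "AE p\<in>Q in lborel. y p = state vh p" using y ae(2) by eventually_elim auto
    qed (rule ae(1))
  next
    fix vR assume vR: "\<And>R. R > 0 \<Longrightarrow> vR R \<in> U \<and> (\<forall>u\<in>U. I R (vR R) \<le> I R u)"
    have I_vR: "I R (vR R) = m R" if "R > 0" for R
      using vR[OF that] vm[OF that] by (auto simp: m_def intro!: antisym)
    show "((\<lambda>R. sq_norm lborel (\<lambda>p. ctl (vR R) p - ctl vh p)) \<longlongrightarrow> 0) at_top"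
    proof (rule tendstoI)
      fix e :: real assume "e > 0"
      then obtain N where N: "\<And>n. n \<ge> N \<Longrightarrow> 4 * (ms - mm n) < e" using mm_close by blast
      show "\<forall>\<^sub>F R in at_top. dist (sq_norm lborel (\<lambda>p. ctl (vR R) p - ctl vh p)) 0 < e"
        using eventually_ge_at_top[of "real (Suc N)"]
      proof eventually_elim
        fix R assume R: "R \<ge> real (Suc N)"
        then have R0: "R > 0" by simp
        \<comment> \<open>Here \<open>vh\<close> is the competitor in the problem with real
          parameter \<open>R\<close>, which gives the convergence along all of \<open>at_top\<close>
          rather than along the integers.\<close>
        have "sq_norm lborel (\<lambda>p. ctl vh p - ctl (vR R) p) \<le> 4 * (I R vh - I R (vR R))"
          by (rule I_gap[OF R0 vh(1)]) (use vR[OF R0] in auto)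
        also have "\<dots> \<le> 4 * (ms - mm N)"
          using I_vh[OF R0] I_vR[OF R0] m_mono(2)[of "real (Suc N)" R] R by (simp add: mm_def)
        also have "\<dots> < e" by (rule N) simp
        finally show "dist (sq_norm lborel (\<lambda>p. ctl (vR R) p - ctl vh p)) 0 < e"
          using sq_norm_minus_commute[of lborel "ctl vh"] by simp
      qed
    qed
  qed
qed

end

section \<open>The Carleman weights and the control-to-state map\<close>

lemma extend_control_indicator:
  assumes "\<omega> \<subseteq> \<Omega>"
  shows "indicator (cylinder \<Omega> T) p *\<^sub>R extend_control \<omega> v p = indicator (cylinder \<omega> T) p *\<^sub>R v p"
  using assms by (cases p) (auto simp: extend_control_def cylinder_def indicator_def)

lemma extend_control_L2:
  "\<omega> \<subseteq> \<Omega> \<Longrightarrow> v \<in> L2 (cylinder \<omega> T) \<Longrightarrow> extend_control \<omega> v \<in> L2 (cylinder \<Omega> T)"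
  by (simp add: L2_iff extend_control_indicator del: real_scaleR_def)

text \<open>\<eta>0 attains its maximum on the compact closure, so the pointwise condition on
  \<open>K2\<close> becomes a uniform gap. It keeps the exponent of the weights above a positive
  multiple of 1 / (T - t).\<close>

lemma carleman_exponent_lower_bound:
  fixes \<Omega> :: "'a::euclidean_space set" and \<eta>0 :: "'a \<Rightarrow> real" and K2 :: real
  assumes \<Omega>: "bounded \<Omega>" "\<Omega> \<noteq> {}" and \<eta>: "continuous_on (closure \<Omega>) \<eta>0"
    and K2: "\<And>x. x \<in> closure \<Omega> \<Longrightarrow> \<eta>0 x < K2"
  obtains c where "c > 0" "\<And>x. x \<in> \<Omega> \<Longrightarrow> c \<le> exp K2 - exp (\<eta>0 x)"
proof -
  have "compact (closure \<Omega>)" "closure \<Omega> \<noteq> {}" using \<Omega> by auto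
  then obtain x0 where x0: "x0 \<in> closure \<Omega>" "\<And>x. x \<in> closure \<Omega> \<Longrightarrow> \<eta>0 x \<le> \<eta>0 x0"
    using continuous_attains_sup[OF _ _ \<eta>] by blast
  show thesis
  proof (rule that[of "exp K2 - exp (\<eta>0 x0)"])
    show "0 < exp K2 - exp (\<eta>0 x0)" using K2[OF x0(1)] by simp
    show "exp K2 - exp (\<eta>0 x0) \<le> exp K2 - exp (\<eta>0 x)" if "x \<in> \<Omega>" for x
      using x0(2)[of x] closure_subset[of \<Omega>] that by auto
  qed
qed

text \<open>The exponential beats the vanishing factor \<open>(T - t)\<^bsup>3/2\<^esup>\<close>, via \<open>exp x \<ge> x\<^sup>2 / 2\<close>.\<close>

lemma carleman_rho0_lower_bound:
  assumes K1: "K1 > 0" and c: "c > 0" "\<And>x. x \<in> \<Omega> \<Longrightarrow> c \<le> exp K2 - exp (\<eta>0 x)"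
    and T: "T > 0" and p: "p \<in> cylinder \<Omega> T"
  shows "(K1 * c)\<^sup>2 / 2 * T powr (-1/2) \<le> carleman_rho0 K1 K2 T \<eta>0 p"
proof -
  obtain x t where p': "p = (x, t)" "x \<in> \<Omega>" "0 < t" "t < T" using p by (auto simp: cylinder_def)
  define s where "s = T - t"
  have s: "0 < s" "s \<le> T" using p' by (auto simp: s_def)
  have "K1 * c / s \<le> carleman_alpha K1 K2 T \<eta>0 p"
    using c(2)[OF p'(2)] K1 s by (simp add: carleman_alpha_def p' flip: s_def) (simp add: divide_right_mono)
  moreover have "(K1 * c / s)\<^sup>2 / 2 \<le> exp (K1 * c / s)"
  proof -
    have "0 \<le> K1 * c / s" using K1 c(1) s by simp
    then show ?thesis using exp_lower_Taylor_quadratic[of "K1 * c / s"] by linarith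
  qed
  ultimately have e: "(K1 * c / s)\<^sup>2 / 2 \<le> carleman_rho K1 K2 T \<eta>0 p"
    unfolding carleman_rho_def by (meson exp_le_cancel_iff order_trans)
  \<comment> \<open>The quadratic bound on the exponential leaves s^(3/2) / s^2 = s^(-1/2), which
    decreases in s and is therefore smallest at s = T.\<close>
  have "T powr (-1/2) \<le> s powr (-1/2)" using s by (intro powr_mono2') auto
  then have "(K1 * c)\<^sup>2 / 2 * T powr (-1/2) \<le> (K1 * c)\<^sup>2 / 2 * s powr (-1/2)"
    by (intro mult_left_mono) auto
  also have "s powr (-1/2) = s powr (3/2) / s\<^sup>2"
    using s by (simp add: powr_diff[symmetric] flip: powr_numeral)
  also have "(K1 * c)\<^sup>2 / 2 * (s powr (3/2) / s\<^sup>2) = s powr (3/2) * ((K1 * c / s)\<^sup>2 / 2)"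
    by (simp add: power_divide mult_ac)
  also have "\<dots> \<le> s powr (3/2) * carleman_rho K1 K2 T \<eta>0 p"
    by (intro mult_left_mono e) simp
  finally show ?thesis by (simp add: carleman_rho0_def p' s_def)
qed

lemma carleman_rho_continuous:
  assumes "continuous_on \<Omega> \<eta>0"
  shows "continuous_on (cylinder \<Omega> T) (carleman_rho K1 K2 T \<eta>0)"
    and "continuous_on (cylinder \<Omega> T) (carleman_rho0 K1 K2 T \<eta>0)"
proof -
  have \<eta>: "continuous_on (cylinder \<Omega> T) (\<lambda>p. \<eta>0 (fst p))"
    by (rule continuous_on_compose2[OF assms]) (auto intro!: continuous_intros simp: cylinder_def)
  have "continuous_on (cylinder \<Omega> T) (\<lambda>p. exp (K1 * ((exp K2 - exp (\<eta>0 (fst p))) / (T - snd p))))"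
    by (intro continuous_intros \<eta>) (auto simp: cylinder_def)
  then show 1: "continuous_on (cylinder \<Omega> T) (carleman_rho K1 K2 T \<eta>0)"
    by (simp add: carleman_rho_def[abs_def] carleman_alpha_def case_prod_beta')
  show "continuous_on (cylinder \<Omega> T) (carleman_rho0 K1 K2 T \<eta>0)"
    unfolding carleman_rho0_def[abs_def]
    by (intro continuous_intros 1) (auto simp: cylinder_def)
qed

text \<open>Each value of \<open>M\<close> is just some weak solution. The bound is the energy
  estimate for a difference of two of them; the midpoint rule is uniqueness, since the defect
  \<open>d\<close> solves the equation with zero force and so vanishes almost everywhere.\<close>

lemma control_to_state:
  fixes \<Omega> \<omega> :: "'a::euclidean_space set" and M :: "('a \<times> real \<Rightarrow> real) \<Rightarrow> 'a \<times> real \<Rightarrow> real"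
  assumes \<Omega>: "\<Omega> \<in> sets borel" and T: "T > 0" and \<omega>: "\<omega> \<subseteq> \<Omega>"
    and a: "a \<in> Linfty (cylinder \<Omega> T)" "AE p\<in>cylinder \<Omega> T in lborel. a p \<ge> 0"
    and b: "b \<in> Linfty (cylinder \<Omega> T)"
    and M: "\<And>v. v \<in> L2 (cylinder \<omega> T) \<Longrightarrow> weak_solution \<Omega> T a b (extend_control \<omega> v) (\<lambda>_. 0) (M v)"
  obtains D where
    "\<And>v w. v \<in> L2 (cylinder \<omega> T) \<Longrightarrow> w \<in> L2 (cylinder \<omega> T) \<Longrightarrow>
      sq_norm lborel (\<lambda>p. indicator (cylinder \<Omega> T) p *\<^sub>R (M v p - M w p))
        \<le> D * sq_norm lborel (\<lambda>p. indicator (cylinder \<omega> T) p *\<^sub>R (v p - w p))"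
    "\<And>v w. v \<in> L2 (cylinder \<omega> T) \<Longrightarrow> w \<in> L2 (cylinder \<omega> T) \<Longrightarrow>
      AE p\<in>cylinder \<Omega> T in lborel. M (\<lambda>z. (1/2) *\<^sub>R (v z + w z)) p = (1/2) *\<^sub>R (M v p + M w p)"
proof -
  obtain B0 where B0: "AE p\<in>cylinder \<Omega> T in lborel. norm (b p) \<le> B0" using b by (auto simp: Linfty_def)
  define B where "B = max 0 B0"
  have B: "B \<ge> 0" "AE p\<in>cylinder \<Omega> T in lborel. norm (b p) \<le> B"
    using B0 by (auto simp: B_def elim!: eventually_mono)
  note estimate = forced_solution_estimate[OF \<Omega> T a b B(2,1)]
  note lin = forced_solution_linear[OF \<Omega> a(1) b]
  have sol: "forced_solution \<Omega> T a b (extend_control \<omega> v) (M v)" if "v \<in> L2 (cylinder \<omega> T)"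
    for v :: "'a \<times> real \<Rightarrow> real"
    by (rule weak_solution_forced[OF \<Omega> a(1) b extend_control_L2[OF \<omega> that] M[OF that]])
  show thesis
  proof (rule that)
    fix v w :: "'a \<times> real \<Rightarrow> real"
    assume v: "v \<in> L2 (cylinder \<omega> T)" and w: "w \<in> L2 (cylinder \<omega> T)"
    have "sq_norm lborel (\<lambda>p. indicator (cylinder \<Omega> T) p *\<^sub>R (M v p + (-1) *\<^sub>R M w p))
      \<le> exp ((2 * B + 2) * T) * sq_norm lborel
          (\<lambda>p. indicator (cylinder \<Omega> T) p *\<^sub>R (extend_control \<omega> v p + (-1) *\<^sub>R extend_control \<omega> w p))"
      by (rule estimate[OF lin[OF sol[OF v] sol[OF w]]])
    moreover have "indicator (cylinder \<Omega> T) p *\<^sub>R (extend_control \<omega> v p + (-1) *\<^sub>R extend_control \<omega> w p)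
        = indicator (cylinder \<omega> T) p *\<^sub>R (v p - w p)" for p
      using extend_control_indicator[OF \<omega>, of T p v] extend_control_indicator[OF \<omega>, of T p w]
      by (simp add: algebra_simps)
    ultimately show "sq_norm lborel (\<lambda>p. indicator (cylinder \<Omega> T) p *\<^sub>R (M v p - M w p))
        \<le> exp ((2 * B + 2) * T) * sq_norm lborel (\<lambda>p. indicator (cylinder \<omega> T) p *\<^sub>R (v p - w p))"
      by simp
    define m where "m = (\<lambda>z. (1/2) *\<^sub>R (v z + w z))"
    have m: "m \<in> L2 (cylinder \<omega> T)" unfolding m_def by (intro L2_scaleR L2_add v w)
    define f where "f p = extend_control \<omega> m p + (-1/2) *\<^sub>R extend_control \<omega> v p + (-1/2) *\<^sub>R extend_control \<omega> w p" for p
    define d where "d p = M m p + (-1/2) *\<^sub>R M v p + (-1/2) *\<^sub>R M w p" for p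
    have fs: "forced_solution \<Omega> T a b f d"
      unfolding f_def[abs_def] d_def[abs_def] by (intro lin sol m v w)
    have "f p = 0" for p
      by (cases p) (auto simp: f_def m_def extend_control_def field_simps)
    then have "sq_norm lborel (\<lambda>p. indicator (cylinder \<Omega> T) p *\<^sub>R d p) \<le> 0"
      using estimate[OF fs] by (simp add: sq_norm_def)
    then have "sq_norm lborel (\<lambda>p. indicator (cylinder \<Omega> T) p *\<^sub>R d p) = 0"
      by (rule antisym[OF _ sq_norm_nonneg])
    moreover have "d \<in> L2 (cylinder \<Omega> T)" using fs by (simp add: forced_solution_def)
    ultimately have "AE p in lborel. indicator (cylinder \<Omega> T) p *\<^sub>R d p = 0"
      using sq_norm_eq_0_iff[of lborel "\<lambda>p. indicator (cylinder \<Omega> T) p *\<^sub>R d p"] by (simp add: L2_iff)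
    then show "AE p\<in>cylinder \<Omega> T in lborel. M (\<lambda>z. (1/2) *\<^sub>R (v z + w z)) p = (1/2) *\<^sub>R (M v p + M w p)"
      unfolding m_def[symmetric] by eventually_elim (auto simp: d_def algebra_simps)
  qed
qed

text \<open>Carleman controllability enters as \<open>C \<noteq> {}\<close>; existence and
  uniqueness of the minimizers are conclusions. Functions represent classes, so uniqueness is up to
  null sets and convergence is claimed for every selection \<open>v_R\<close> of minimizers.\<close>

theorem proposition2p5:
  fixes \<Omega> \<omega> :: "'a::euclidean_space set"
    and T a0 K1 K2 :: real
    and a b ybar \<rho> \<rho>0 :: "'a \<times> real \<Rightarrow> real"
    and y0 \<eta>0 :: "'a \<Rightarrow> real"
    and M :: "('a \<times> real \<Rightarrow> real) \<Rightarrow> 'a \<times> real \<Rightarrow> real"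
    and Q Q\<omega> :: "('a \<times> real) set"
    and U :: "('a \<times> real \<Rightarrow> real) set"
    and I :: "real \<Rightarrow> ('a \<times> real \<Rightarrow> real) \<Rightarrow> real"
    and J :: "('a \<times> real \<Rightarrow> real) \<times> ('a \<times> real \<Rightarrow> real) \<Rightarrow> real"
    and C :: "(('a \<times> real \<Rightarrow> real) \<times> ('a \<times> real \<Rightarrow> real)) set"
  defines "Q \<equiv> cylinder \<Omega> T"
    and "Q\<omega> \<equiv> cylinder \<omega> T"
    and "\<rho> \<equiv> carleman_rho K1 K2 T \<eta>0"
    and "\<rho>0 \<equiv> carleman_rho0 K1 K2 T \<eta>0"
    and "U \<equiv> weighted_L2 Q\<omega> \<rho>0"
    and "I \<equiv> cost_I Q Q\<omega> \<rho> \<rho>0 M ybar"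
    and "J \<equiv> cost_J Q Q\<omega> \<rho> \<rho>0"
    and "C \<equiv> controlled_pairs Q Q\<omega> \<rho> \<rho>0 M ybar"
  assumes domain: "bounded_C2_domain \<Omega>"
    and T: "T > 0"
    and omega: "open \<omega>" "\<omega> \<noteq> {}" "\<omega> \<subseteq> \<Omega>"
    and a: "a \<in> W1infty Q" "a0 > 0" "AE z\<in>Q in lborel. a z \<ge> a0"
    and b: "b \<in> Linfty Q"
    and y0: "y0 \<in> L2 \<Omega>"
    and M: "\<And>v. v \<in> L2 Q\<omega> \<Longrightarrow> weak_solution \<Omega> T a b (extend_control \<omega> v) (\<lambda>_. 0) (M v)"
    and ybar: "weak_solution \<Omega> T a b (\<lambda>_. 0) y0 ybar"
    and eta0: "weight_generator \<Omega> \<omega> \<eta>0"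
    and K1: "K1 > 0"
    and K2: "K2 > 0" "\<And>x. x \<in> closure \<Omega> \<Longrightarrow> \<eta>0 x < K2"
    and controllable: "C \<noteq> {}"
  shows "(\<forall>R>0. (\<exists>v. is_arg_min (I R) (\<lambda>v. v \<in> U) v) \<and>
            (\<forall>v v'. is_arg_min (I R) (\<lambda>v. v \<in> U) v \<and> is_arg_min (I R) (\<lambda>v. v \<in> U) v' \<longrightarrow>
               (AE z\<in>Q\<omega> in lborel. v z = v' z))) \<and>
         (\<exists>v_hat y_hat. y_hat = (\<lambda>z. M v_hat z + ybar z) \<and>
            is_arg_min J (\<lambda>p. p \<in> C) (y_hat, v_hat) \<and>
            (\<forall>y v. is_arg_min J (\<lambda>p. p \<in> C) (y, v) \<longrightarrow>
               (AE z\<in>Q in lborel. y z = y_hat z) \<and> (AE z\<in>Q\<omega> in lborel. v z = v_hat z)) \<and>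
            (\<forall>v_R. (\<forall>R>0. is_arg_min (I R) (\<lambda>v. v \<in> U) (v_R R)) \<longrightarrow>
               ((\<lambda>R. weighted_L2_norm Q\<omega> \<rho>0 (\<lambda>z. v_R R z - v_hat z)) \<longlongrightarrow> 0) at_top))"
proof -
  have \<Omega>: "open \<Omega>" "\<Omega> \<noteq> {}" "bounded \<Omega>" using domain by (auto simp: bounded_C2_domain_def)
  have \<Omega>s: "\<Omega> \<in> sets borel" and \<omega>s: "\<omega> \<in> sets borel" using \<Omega>(1) omega(1) by auto
  have a0: "a \<in> Linfty (cylinder \<Omega> T)" "AE p\<in>cylinder \<Omega> T in lborel. a p \<ge> 0"
    using a by (auto simp: W1infty_def Q_def elim!: eventually_mono)
  have b0: "b \<in> Linfty (cylinder \<Omega> T)" using b by (simp add: Q_def)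
  obtain D where D:
    "\<And>v w. v \<in> L2 Q\<omega> \<Longrightarrow> w \<in> L2 Q\<omega> \<Longrightarrow>
      sq_norm lborel (\<lambda>p. indicator Q p *\<^sub>R (M v p - M w p))
        \<le> D * sq_norm lborel (\<lambda>p. indicator Q\<omega> p *\<^sub>R (v p - w p))"
    "\<And>v w. v \<in> L2 Q\<omega> \<Longrightarrow> w \<in> L2 Q\<omega> \<Longrightarrow>
      AE p\<in>Q in lborel. M (\<lambda>z. (1/2) *\<^sub>R (v z + w z)) p = (1/2) *\<^sub>R (M v p + M w p)"
    using control_to_state[OF \<Omega>s T omega(3) a0 b0 M[unfolded Q\<omega>_def]] unfolding Q_def Q\<omega>_def by blast
  have \<eta>: "continuous_on (closure \<Omega>) \<eta>0" using eta0 by (auto simp: weight_generator_def C2_closure_def)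
  obtain c where c: "c > 0" "\<And>x. x \<in> \<Omega> \<Longrightarrow> c \<le> exp K2 - exp (\<eta>0 x)"
    using carleman_exponent_lower_bound[OF \<Omega>(3,2) \<eta> K2(2)] by blast
  have \<eta>\<Omega>: "continuous_on \<Omega> \<eta>0" by (rule continuous_on_subset[OF \<eta> closure_subset])
  \<comment> \<open>The constant in the place of \<open>r0\<close> comes from
    \<open>carleman_rho0_lower_bound\<close>. The weights are continuous on the cylinders, where T -
    t > 0, hence Borel there.\<close>
  interpret penalized_control Q Q\<omega> \<rho> \<rho>0 ybar M "(K1 * c)\<^sup>2 / 2 * T powr (-1/2)" D
  proof
    show sQ: "Q \<in> sets borel" "Q\<omega> \<in> sets borel"
      using \<Omega>s \<omega>s by (auto simp: Q_def Q\<omega>_def intro: cylinder_measurable)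
    show "set_borel_measurable lborel Q \<rho>"
      unfolding set_borel_measurable_def \<rho>_def measurable_lborel2
      by (rule borel_measurable_continuous_on_indicator[OF sQ(1)])
         (unfold Q_def, rule carleman_rho_continuous(1)[OF \<eta>\<Omega>])
    show "set_borel_measurable lborel Q\<omega> \<rho>0"
      unfolding set_borel_measurable_def \<rho>0_def measurable_lborel2
      by (rule borel_measurable_continuous_on_indicator[OF sQ(2)])
         (unfold Q\<omega>_def, rule carleman_rho_continuous(2)[OF continuous_on_subset[OF \<eta>\<Omega> omega(3)]])
    show "0 < \<rho> p" for p by (simp add: \<rho>_def carleman_rho_def)
    show "0 < (K1 * c)\<^sup>2 / 2 * T powr (-1/2)" using K1 c(1) T by simp
    show "(K1 * c)\<^sup>2 / 2 * T powr (-1/2) \<le> \<rho>0 p" if "p \<in> Q\<omega>" for p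
      unfolding \<rho>0_def
      by (rule carleman_rho0_lower_bound[OF K1 c T]) (use that omega(3) in \<open>auto simp: Q\<omega>_def cylinder_def\<close>)
    show "ybar \<in> L2 Q" using ybar by (simp add: weak_solution_def Q_def)
    show "M v \<in> L2 Q" if "v \<in> L2 Q\<omega>" for v using M[OF that] by (simp add: weak_solution_def Q_def)
  qed (fact D)+
  have argmin: "is_arg_min (I R) (\<lambda>v. v \<in> U) v \<longleftrightarrow> v \<in> U \<and> (\<forall>u\<in>U. I R v \<le> I R u)" for R v
    by (auto simp: is_arg_min_def not_less)
  obtain vh where vh: "vh \<in> U" "((\<lambda>z. M vh z + ybar z), vh) \<in> C"
      "\<And>p. p \<in> C \<Longrightarrow> J ((\<lambda>z. M vh z + ybar z), vh) \<le> J p"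
    and unique: "\<And>y v. (y, v) \<in> C \<Longrightarrow> J (y, v) \<le> J ((\<lambda>z. M vh z + ybar z), vh) \<Longrightarrow>
      (AE p\<in>Q in lborel. y p = M vh p + ybar p) \<and> (AE p\<in>Q\<omega> in lborel. v p = vh p)"
    and conv: "\<And>vR. (\<And>R. R > 0 \<Longrightarrow> vR R \<in> U \<and> (\<forall>u\<in>U. I R (vR R) \<le> I R u)) \<Longrightarrow>
      ((\<lambda>R. sq_norm lborel (\<lambda>p. ctl (vR R) p - ctl vh p)) \<longlongrightarrow> 0) at_top"
  proof (rule penalized_convergence[OF controllable[unfolded C_def], folded U_def I_def J_def C_def], goal_cases)
    case (1 vh)
    show ?case by (rule 1(1)[OF 1(2-6)])
  qed
  have norm_eq: "weighted_L2_norm Q\<omega> \<rho>0 (\<lambda>z. v z - w z) = sqrt (sq_norm lborel (\<lambda>p. ctl v p - ctl w p))" for v w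
  proof -
    have "(LINT z:Q\<omega>|lborel. (norm (\<rho>0 z * (v z - w z)))\<^sup>2) = sq_norm lborel (\<lambda>p. ctl v p - ctl w p)"
      unfolding set_lebesgue_integral_def sq_norm_def
      by (rule Bochner_Integration.integral_cong) (auto simp: ctl_def indicator_def algebra_simps)
    then show ?thesis by (simp only: weighted_L2_norm_def L2_norm_def)
  qed
  show ?thesis
  proof (intro conjI allI impI)
    fix R :: real assume R: "R > 0"
    show "\<exists>v. is_arg_min (I R) (\<lambda>v. v \<in> U) v"
      unfolding argmin using I_minimizer_exists[OF R, folded U_def I_def] by auto
    fix v v' assume "is_arg_min (I R) (\<lambda>v. v \<in> U) v \<and> is_arg_min (I R) (\<lambda>v. v \<in> U) v'"
    then show "AE z\<in>Q\<omega> in lborel. v z = v' z"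
      unfolding argmin using I_minimizer_unique[OF R, folded U_def I_def, of v v'] by auto
  next
    show "\<exists>v_hat y_hat. y_hat = (\<lambda>z. M v_hat z + ybar z) \<and>
            is_arg_min J (\<lambda>p. p \<in> C) (y_hat, v_hat) \<and>
            (\<forall>y v. is_arg_min J (\<lambda>p. p \<in> C) (y, v) \<longrightarrow>
               (AE z\<in>Q in lborel. y z = y_hat z) \<and> (AE z\<in>Q\<omega> in lborel. v z = v_hat z)) \<and>
            (\<forall>v_R. (\<forall>R>0. is_arg_min (I R) (\<lambda>v. v \<in> U) (v_R R)) \<longrightarrow>
               ((\<lambda>R. weighted_L2_norm Q\<omega> \<rho>0 (\<lambda>z. v_R R z - v_hat z)) \<longlongrightarrow> 0) at_top)"
    proof (intro exI conjI allI impI)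
      show "is_arg_min J (\<lambda>p. p \<in> C) ((\<lambda>z. M vh z + ybar z), vh)"
        using vh(2,3) unfolding is_arg_min_def not_less[symmetric] by (meson leD)
    next
      fix y v assume "is_arg_min J (\<lambda>p. p \<in> C) (y, v)"
      then have yv: "(y, v) \<in> C" "J (y, v) \<le> J ((\<lambda>z. M vh z + ybar z), vh)"
        using vh(2) by (auto simp only: is_arg_min_def not_less)
      show "AE z\<in>Q in lborel. y z = M vh z + ybar z" "AE z\<in>Q\<omega> in lborel. v z = vh z"
        using unique[OF yv] by auto
    next
      fix v_R assume "\<forall>R>0. is_arg_min (I R) (\<lambda>v. v \<in> U) (v_R R)"
      then have "((\<lambda>R. sq_norm lborel (\<lambda>p. ctl (v_R R) p - ctl vh p)) \<longlongrightarrow> 0) at_top"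
        unfolding argmin by (intro conv) blast
      from tendsto_real_sqrt[OF this]
      show "((\<lambda>R. weighted_L2_norm Q\<omega> \<rho>0 (\<lambda>z. v_R R z - vh z)) \<longlongrightarrow> 0) at_top"
        by (simp add: norm_eq)
    qed (rule refl)
  qed
qed

end
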